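(* Let $\mathcal{L}$ be a bounded first-order language, $\phi\in\mathcal{L}$ a canonical formula and $s\in\mathbb{S}$ a state. If $s\models\phi$ then $\mathcal{W}_{\mathcal{L}}(\phi,s)=\{\phi\}$. If $s\not\models\phi$, then $\mathcal{W}_{\mathcal{L}}(\phi,s)$ is given by: (i) $\mathcal{W}_{\mathcal{L}_A}(\phi,s)=\{\psi\in A\mid s\models\psi\}$ if $\phi=\bot$, and $=\emptyset$ if $\phi\neq\bot$; (ii) $\mathcal{W}_{\mathcal{L}_1\vee\mathcal{L}_2}(\phi_1\vee\phi_2,s)=\{\psi\vee\phi_2\mid\psi\in\mathcal{W}_{\mathcal{L}_1}(\phi_1,s)\}\cup\{\phi_1\vee\psi\mid\psi\in\mathcal{W}_{\mathcal{L}_2}(\phi_2,s)\}$; (iii) $\mathcal{W}_{\mathcal{L}_1\wedge\mathcal{L}_2}(\phi_1\wedge\phi_2,s)=\{\psi_1\wedge\psi_2\mid\psi_1\in\mathcal{W}_{\mathcal{L}_1}(\phi_1,s),\psi_2\in\mathcal{W}_{\mathcal{L}_2}(\phi_2,s)\}$; (iv) for $\bar\phi=\langle\phi_1,\dots,\phi_n\rangle$, $\mathcal{W}_{\bigvee_k\mathcal{L}}(\bigvee\bar\phi,s)=\min_{\sqsubseteq_{\bigvee_k\mathcal{L}}}(W_n\cup W_{n+1})$, where $W_n=\{\bigvee\mathrm{sort}_{\le_{\mathcal{L}}}\langle\phi_1,\dots,\phi_{i-1},\psi,\phi_{i+1},\dots,\phi_n\rangle\mid i\in\{1,\dots,n\},\psi\in\mathcal{W}_{\mathcal{L}}(\phi_i,s)\}$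 and $W_{n+1}=\{\bigvee\mathrm{sort}_{\le_{\mathcal{L}}}\langle\phi_1,\dots,\phi_n,\psi\rangle\mid\psi\in\mathcal{W}_{\mathcal{L}}(\bot_{\mathcal{L}},s)\text{ and }n<k\}$; (v) $\mathcal{W}_{\bigwedge_\omega\mathcal{L}}(\bigwedge\bar\phi,s)=\{\bigwedge\mathrm{sort}_{\le_{\mathcal{L}}}(\min_{\sqsubseteq_{\mathcal{L}}}(\mathcal{W}_{\mathcal{L}}(\phi_1,s)\cup\dots\cup\mathcal{W}_{\mathcal{L}}(\phi_n,s)))\}$; (vi) for $s=((\mathcal{U},\mathcal{I}),\mu)$, $\mathcal{W}_{\exists_X\mathcal{L}}(\exists X.\phi,s)=\min_{\sqsubseteq_{\exists_X\mathcal{L}}}\{c(\exists X.\psi)\mid\nu:X\to\mathcal{U},\ \psi\in\mathcal{W}_{\mathcal{L}}(\phi,((\mathcal{U},\mathcal{I}),\mu[\nu]))\}$; (vii) for $s=((\mathcal{U},\mathcal{I}),\mu)$, $\mathcal{W}_{\forall_X\mathcal{L}}(\forall X.\phi,s)=\min_{\sqsubseteq_{\forall_X\mathcal{L}}}\{c(\forall X.\psi)\mid\psi\in\Omega_\phi(\{((\mathcal{U},\mathcal{I}),\mu[\nu])\mid\nu:X\to\mathcal{U}\})\}$, where for states $s_1,\dots,s_m$ (in any enumeration), $\Omega_{\phi_0}(\{s_1,\dots,s_m\})=\{\phi_m\mid\phi_1\in\mathcal{W}_{\mathcal{L}}(\phi_0,s_1),\dots,\phi_m\in\mathcal{W}_{\mathcal{L}}(\phi_{m-1},s_m)\}$;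 (viii) $\mathcal{W}_{\exists\forall_X\mathcal{L}}(\exists X.\phi,s)=\mathcal{W}_{\exists_X\mathcal{L}}(\exists X.\phi,s)$ and $\mathcal{W}_{\exists\forall_X\mathcal{L}}(\forall X.\phi,s)=\min_{\sqsubseteq_{\exists\forall_X\mathcal{L}}}(\mathcal{W}_{\exists_X\mathcal{L}}(\exists X.\phi,s)\cup\mathcal{W}_{\forall_X\mathcal{L}}(\forall X.\phi,s))$.
   Context: Fix a first-order signature $\Sigma$ and a set of variables $V$. $\mathbb{S}$ is the set of states $s=((\mathcal{U},\mathcal{I}),\mu)$, where $(\mathcal{U},\mathcal{I})$ is a $\Sigma$-structure with finite universe and $\mu$ assigns elements of $\mathcal{U}$ to variables; $\mu[\nu]$ is $\mu$ updated (possibly extended) according to $\nu$. Satisfaction is standard, with $\bot$ false, $\bigvee\bar\phi$/$\bigwedge\bar\phi$ the disjunction/conjunction of the sequence, $\bigvee\epsilon\equiv\bot$. For finite $X\subseteq V$, $\mathfrak{S}_X$ is the set of permutations of $X$ and $\phi\pi$ replaces each free $x\in X$ by $\pi(x)$; a set of formulas is $\mathfrak{S}_V$-closed if closed under such substitutions. For $\bar\phi=\langle\phi_1,\dots,\phi_n\rangle$: $[\bar\phi]=\{1,\dots,n\}$, $\phi_{-i}=\phi_{n-i+1}$; $\epsilon$ empty sequence. Bounded first-order languages (inductively, $X\subseteq V$ finite), each with a designated $\bot_{\mathcal{L}}$: $\mathcal{L}_A=A\cup\{\bot\}$, $\bot_{\mathcal{L}_A}=\bot$ ($A$ finite $\mathfrak{S}_V$-closed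 set of formulas with free variables in $V$); $\mathcal{L}_1\vee\mathcal{L}_2$, $\mathcal{L}_1\wedge\mathcal{L}_2$ (formulas $\phi_1\circ\phi_2$, $\phi_i\in\mathcal{L}_i$; bottom $\bot_{\mathcal{L}_1}\circ\bot_{\mathcal{L}_2}$); $\bigvee_k\mathcal{L}=\{\bigvee\bar\phi\mid|\bar\phi|\le k\}$, bottom $\bigvee\epsilon$; $\bigwedge_\omega\mathcal{L}=\{\bigwedge\bar\phi\mid\bar\phi\neq\epsilon\}$, bottom $\bigwedge\langle\bot_{\mathcal{L}}\rangle$; $\exists_X\mathcal{L}=\{\exists X.\phi\}$, bottom $\exists X.\bot_{\mathcal{L}}$; $\forall_X\mathcal{L}=\{\forall X.\phi\}$, bottom $\forall X.\bot_{\mathcal{L}}$; $\exists\forall_X\mathcal{L}=\{QX.\phi\mid Q\in\{\exists,\forall\}\}$, bottom $\forall X.\bot_{\mathcal{L}}$ ($\phi\in\mathcal{L}$). Subsumption: $\phi\sqsubseteq_{\mathcal{L}_A}\psi$ iff $\phi=\bot$ or $\phi=\psi$; pointwise for binary connectives; $\bigvee\bar\phi\sqsubseteq\bigvee\bar\psi$ iff some injective $m:[\bar\phi]\to[\bar\psi]$ has $\phi_i\sqsubseteq\psi_{m(i)}$ for all $i$; $\bigwedge\bar\phi\sqsubseteq\bigwedge\bar\psi$ iff some $m:[\bar\psi]\to[\bar\phi]$ has $\phi_{m(i)}\sqsubseteq\psi_i$ for all $i$; $QX.\phi\sqsubseteq QX.\psi$ iff $\phi\sqsubseteq\psi\pi$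 for some $\pi\in\mathfrak{S}_X$; in $\exists\forall_X\mathcal{L}$ also $\forall X.\phi\sqsubseteq\exists X.\psi$ iff $\phi\sqsubseteq\psi\pi$ for some $\pi$. Canonicalization $c=c_{\mathcal{L}}$ and total order $\le_{\mathcal{L}}$ on canonical formulas ($c(\phi)=\phi$) by mutual induction ($\min_{\sqsubseteq}F$ = set of $\sqsubseteq$-minimal elements of $F$, $\min_{\le}$ = least element, $\mathrm{sort}_{\le}$ = ascending sort): $c_{\mathcal{L}_A}(\phi)=\phi$; $c(\phi_1\circ\phi_2)=c(\phi_1)\circ c(\phi_2)$; $c(\bigvee\bar\phi)=\bigvee\mathrm{sort}_{\le}\langle c(\phi_1),\dots,c(\phi_n)\rangle$; $c(\bigwedge\bar\phi)=\bigwedge\mathrm{sort}_{\le}(\min_{\sqsubseteq}\{c(\phi_1),\dots,c(\phi_n)\})$; $c(QX.\phi)=QX.\min_{\le}\{c(\phi\pi)\mid\pi\in\mathfrak{S}_X\}$. $\le_{\mathcal{L}_A}$ is an arbitrary fixed total order extending $\sqsubseteq_{\mathcal{L}_A}$; binary connectives ordered lexicographically; $\bigvee\bar\phi\le\bigvee\bar\psi$ iff $\bar\phi$ is a suffix of $\bar\psi$ or at the first index $i$ counted from the end where they differ, $\phi_{-i}<\psi_{-i}$; $\bigwedge\bar\phi\le\bigwedge\bar\psi$ iff $\bar\psi$ is a prefix of $\bar\phi$ or at the first index $i$ where they differ $\phi_i<\psi_i$; $QX.\phi\le QX.\psi$ iff $\phi\le\psi$, and $\forall X.\phi<\exists X.\psi$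 in $\exists\forall_X\mathcal{L}$. Weaken operator: for canonical $\phi\in\mathcal{L}$ and $s\in\mathbb{S}$, $\mathcal{W}_{\mathcal{L}}(\phi,s)=\min_{\sqsubseteq_{\mathcal{L}}}\{c_{\mathcal{L}}(\psi)\mid\psi\in\mathcal{L},\ \phi\sqsubseteq_{\mathcal{L}}\psi,\ s\models\psi\}$.
   Formalization: In (v) the right side is taken as ∅ when all W(φ_i,s) are empty, since ⋀ε is not in the language; and substitutions φπ (for closure of A and for permutations of quantified X) are required to be capture-free, since otherwise (vi) fails. *)

theory Defs
  imports "HOL-Library.Multiset" "HOL-Library.Sublist" "HOL-Combinatorics.Permutations"
begin

section \<open>First-order logic over a signature\<close>

record ('f, 'p) signature =
  fun_ar :: "'f \<Rightarrow> nat"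
  rel_ar :: "'p \<Rightarrow> nat"

datatype ('f, 'v) tm = Var 'v | Fn 'f "('f, 'v) tm list"

text \<open>
  The binary connectives and the sequence connectives are kept syntactically apart, and
  a quantifier binds a set of variables at once.
\<close>

datatype ('f, 'p, 'v) fm =
    Bot
  | Eq "('f, 'v) tm" "('f, 'v) tm"
  | Rel 'p "('f, 'v) tm list"
  | Neg "('f, 'p, 'v) fm"
  | Or "('f, 'p, 'v) fm" "('f, 'p, 'v) fm"
  | And "('f, 'p, 'v) fm" "('f, 'p, 'v) fm"
  | BigOr "('f, 'p, 'v) fm list"
  | BigAnd "('f, 'p, 'v) fm list"
  | Ex "'v set" "('f, 'p, 'v) fm"
  | All "'v set" "('f, 'p, 'v) fm"

fun tm_over :: "('f, 'p) signature \<Rightarrow> ('f, 'v) tm \<Rightarrow> bool" where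
  "tm_over S (Var x) = True"
| "tm_over S (Fn f ts) = (length ts = fun_ar S f \<and> (\<forall>t\<in>set ts. tm_over S t))"

fun fm_over :: "('f, 'p) signature \<Rightarrow> ('f, 'p, 'v) fm \<Rightarrow> bool" where
  "fm_over S Bot = True"
| "fm_over S (Eq t u) = (tm_over S t \<and> tm_over S u)"
| "fm_over S (Rel p ts) = (length ts = rel_ar S p \<and> (\<forall>t\<in>set ts. tm_over S t))"
| "fm_over S (Neg \<phi>) = fm_over S \<phi>"
| "fm_over S (Or \<phi> \<psi>) = (fm_over S \<phi> \<and> fm_over S \<psi>)"
| "fm_over S (And \<phi> \<psi>) = (fm_over S \<phi> \<and> fm_over S \<psi>)"
| "fm_over S (BigOr \<phi>s) = (\<forall>\<phi>\<in>set \<phi>s. fm_over S \<phi>)"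
| "fm_over S (BigAnd \<phi>s) = (\<forall>\<phi>\<in>set \<phi>s. fm_over S \<phi>)"
| "fm_over S (Ex X \<phi>) = (finite X \<and> fm_over S \<phi>)"
| "fm_over S (All X \<phi>) = (finite X \<and> fm_over S \<phi>)"

fun fv_tm :: "('f, 'v) tm \<Rightarrow> 'v set" where
  "fv_tm (Var x) = {x}"
| "fv_tm (Fn f ts) = (\<Union>t\<in>set ts. fv_tm t)"

fun fv :: "('f, 'p, 'v) fm \<Rightarrow> 'v set" where
  "fv Bot = {}"
| "fv (Eq t u) = fv_tm t \<union> fv_tm u"
| "fv (Rel p ts) = (\<Union>t\<in>set ts. fv_tm t)"
| "fv (Neg \<phi>) = fv \<phi>"
| "fv (Or \<phi> \<psi>) = fv \<phi> \<union> fv \<psi>"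
| "fv (And \<phi> \<psi>) = fv \<phi> \<union> fv \<psi>"
| "fv (BigOr \<phi>s) = (\<Union>\<phi>\<in>set \<phi>s. fv \<phi>)"
| "fv (BigAnd \<phi>s) = (\<Union>\<phi>\<in>set \<phi>s. fv \<phi>)"
| "fv (Ex X \<phi>) = fv \<phi> - X"
| "fv (All X \<phi>) = fv \<phi> - X"

subsection \<open>States and satisfaction\<close>

record ('u, 'f, 'p) fo_struct =
  univ :: "'u set"
  fun_int :: "'f \<Rightarrow> 'u list \<Rightarrow> 'u"
  rel_int :: "'p \<Rightarrow> 'u list set"

definition is_struct :: "('f, 'p) signature \<Rightarrow> ('u, 'f, 'p) fo_struct \<Rightarrow> bool" where
  "is_struct S M \<longleftrightarrow> finite (univ M) \<and> univ M \<noteq> {} \<and>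
     (\<forall>f us. length us = fun_ar S f \<and> set us \<subseteq> univ M \<longrightarrow> fun_int M f us \<in> univ M) \<and>
     (\<forall>p. rel_int M p \<subseteq> {us. length us = rel_ar S p \<and> set us \<subseteq> univ M})"

type_synonym ('u, 'f, 'p, 'v) state = "('u, 'f, 'p) fo_struct \<times> ('v \<rightharpoonup> 'u)"

definition states :: "('f, 'p) signature \<Rightarrow> ('u, 'f, 'p, 'v) state set" where
  "states S = {(M, \<mu>) | M \<mu>. is_struct S M \<and> ran \<mu> \<subseteq> univ M}"

definition assigns :: "'v set \<Rightarrow> 'u set \<Rightarrow> ('v \<rightharpoonup> 'u) set" where
  "assigns X U = {\<nu>. dom \<nu> = X \<and> ran \<nu> \<subseteq> U}"

text \<open>
  Assignments are partial, since updating may extend them. A variable without a value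
  evaluates to an arbitrary fixed element; this is only reached for free variables
  that the state does not assign.
\<close>

fun tm_val :: "('u, 'f, 'p) fo_struct \<Rightarrow> ('v \<rightharpoonup> 'u) \<Rightarrow> ('f, 'v) tm \<Rightarrow> 'u" where
  "tm_val M \<mu> (Var x) = the (\<mu> x)"
| "tm_val M \<mu> (Fn f ts) = fun_int M f (map (tm_val M \<mu>) ts)"

fun sat :: "('u, 'f, 'p, 'v) state \<Rightarrow> ('f, 'p, 'v) fm \<Rightarrow> bool"  (infix "\<Turnstile>" 50) where
  "(M, \<mu>) \<Turnstile> Bot \<longleftrightarrow> False"
| "(M, \<mu>) \<Turnstile> Eq t u \<longleftrightarrow> tm_val M \<mu> t = tm_val M \<mu> u"
| "(M, \<mu>) \<Turnstile> Rel p ts \<longleftrightarrow> map (tm_val M \<mu>) ts \<in> rel_int M p"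
| "(M, \<mu>) \<Turnstile> Neg \<phi> \<longleftrightarrow> \<not> (M, \<mu>) \<Turnstile> \<phi>"
| "(M, \<mu>) \<Turnstile> Or \<phi> \<psi> \<longleftrightarrow> (M, \<mu>) \<Turnstile> \<phi> \<or> (M, \<mu>) \<Turnstile> \<psi>"
| "(M, \<mu>) \<Turnstile> And \<phi> \<psi> \<longleftrightarrow> (M, \<mu>) \<Turnstile> \<phi> \<and> (M, \<mu>) \<Turnstile> \<psi>"
| "(M, \<mu>) \<Turnstile> BigOr \<phi>s \<longleftrightarrow> (\<exists>\<phi>\<in>set \<phi>s. (M, \<mu>) \<Turnstile> \<phi>)"
| "(M, \<mu>) \<Turnstile> BigAnd \<phi>s \<longleftrightarrow> (\<forall>\<phi>\<in>set \<phi>s. (M, \<mu>) \<Turnstile> \<phi>)"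
| "(M, \<mu>) \<Turnstile> Ex X \<phi> \<longleftrightarrow> (\<exists>\<nu>\<in>assigns X (univ M). (M, \<mu> ++ \<nu>) \<Turnstile> \<phi>)"
| "(M, \<mu>) \<Turnstile> All X \<phi> \<longleftrightarrow> (\<forall>\<nu>\<in>assigns X (univ M). (M, \<mu> ++ \<nu>) \<Turnstile> \<phi>)"

subsection \<open>Substitution of free variables\<close>

fun subst_tm :: "('v \<Rightarrow> 'v) \<Rightarrow> ('f, 'v) tm \<Rightarrow> ('f, 'v) tm" where
  "subst_tm \<pi> (Var x) = Var (\<pi> x)"
| "subst_tm \<pi> (Fn f ts) = Fn f (map (subst_tm \<pi>) ts)"

definition shield :: "'v set \<Rightarrow> ('v \<Rightarrow> 'v) \<Rightarrow> 'v \<Rightarrow> 'v" where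
  "shield X \<pi> = (\<lambda>x. if x \<in> X then x else \<pi> x)"

fun subst :: "('v \<Rightarrow> 'v) \<Rightarrow> ('f, 'p, 'v) fm \<Rightarrow> ('f, 'p, 'v) fm" where
  "subst \<pi> Bot = Bot"
| "subst \<pi> (Eq t u) = Eq (subst_tm \<pi> t) (subst_tm \<pi> u)"
| "subst \<pi> (Rel p ts) = Rel p (map (subst_tm \<pi>) ts)"
| "subst \<pi> (Neg \<phi>) = Neg (subst \<pi> \<phi>)"
| "subst \<pi> (Or \<phi> \<psi>) = Or (subst \<pi> \<phi>) (subst \<pi> \<psi>)"
| "subst \<pi> (And \<phi> \<psi>) = And (subst \<pi> \<phi>) (subst \<pi> \<psi>)"
| "subst \<pi> (BigOr \<phi>s) = BigOr (map (subst \<pi>) \<phi>s)"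
| "subst \<pi> (BigAnd \<phi>s) = BigAnd (map (subst \<pi>) \<phi>s)"
| "subst \<pi> (Ex X \<phi>) = Ex X (subst (shield X \<pi>) \<phi>)"
| "subst \<pi> (All X \<phi>) = All X (subst (shield X \<pi>) \<phi>)"

text \<open>
  Replacing the free variables of a formula is meaningful only if no replaced occurrence
  gets bound by a quantifier of the formula (``\<open>\<pi>\<close> is free for the formula'').
\<close>

fun capture_free :: "('v \<Rightarrow> 'v) \<Rightarrow> ('f, 'p, 'v) fm \<Rightarrow> bool" where
  "capture_free \<pi> Bot = True"
| "capture_free \<pi> (Eq t u) = True"
| "capture_free \<pi> (Rel p ts) = True"
| "capture_free \<pi> (Neg \<phi>) = capture_free \<pi> \<phi>"
| "capture_free \<pi> (Or \<phi> \<psi>) = (capture_free \<pi> \<phi> \<and> capture_free \<pi> \<psi>)"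
| "capture_free \<pi> (And \<phi> \<psi>) = (capture_free \<pi> \<phi> \<and> capture_free \<pi> \<psi>)"
| "capture_free \<pi> (BigOr \<phi>s) = (\<forall>\<phi>\<in>set \<phi>s. capture_free \<pi> \<phi>)"
| "capture_free \<pi> (BigAnd \<phi>s) = (\<forall>\<phi>\<in>set \<phi>s. capture_free \<pi> \<phi>)"
| "capture_free \<pi> (Ex X \<phi>) =
     ((\<forall>x\<in>fv \<phi> - X. \<pi> x \<notin> X) \<and> capture_free (shield X \<pi>) \<phi>)"
| "capture_free \<pi> (All X \<phi>) =
     ((\<forall>x\<in>fv \<phi> - X. \<pi> x \<notin> X) \<and> capture_free (shield X \<pi>) \<phi>)"

definition perm_closed :: "'v set \<Rightarrow> ('f, 'p, 'v) fm set \<Rightarrow> bool" where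
  "perm_closed V A \<longleftrightarrow>
     (\<forall>\<phi>\<in>A. \<forall>\<pi>. \<pi> permutes V \<longrightarrow> capture_free \<pi> \<phi> \<and> subst \<pi> \<phi> \<in> A)"

section \<open>Minima and sorting\<close>

definition minimals :: "('a \<Rightarrow> 'a \<Rightarrow> bool) \<Rightarrow> 'a set \<Rightarrow> 'a set" where
  "minimals sub F = {x \<in> F. \<forall>y\<in>F. sub y x \<longrightarrow> sub x y}"

definition least_of :: "('a \<Rightarrow> 'a \<Rightarrow> bool) \<Rightarrow> 'a set \<Rightarrow> 'a" where
  "least_of le F = (THE x. x \<in> F \<and> (\<forall>y\<in>F. le x y))"

definition sort_list :: "('a \<Rightarrow> 'a \<Rightarrow> bool) \<Rightarrow> 'a list \<Rightarrow> 'a list" where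
  "sort_list le xs = (THE ys. mset ys = mset xs \<and> sorted_wrt le ys)"

definition sort_set :: "('a \<Rightarrow> 'a \<Rightarrow> bool) \<Rightarrow> 'a set \<Rightarrow> 'a list" where
  "sort_set le F = (THE ys. set ys = F \<and> distinct ys \<and> sorted_wrt le ys)"

definition first_diff_le :: "('a \<Rightarrow> 'a \<Rightarrow> bool) \<Rightarrow> 'a list \<Rightarrow> 'a list \<Rightarrow> bool" where
  "first_diff_le le xs ys \<longleftrightarrow>
     (\<exists>i. i < length xs \<and> i < length ys \<and> take i xs = take i ys \<and>
          xs ! i \<noteq> ys ! i \<and> le (xs ! i) (ys ! i))"

section \<open>Bounded first-order languages\<close>

text \<open>
  An expression of this type records how a language is built. A base language carries, next
  to its set of formulas, the total order that is chosen for it.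
\<close>

datatype ('f, 'p, 'v) lang =
    LBase "('f, 'p, 'v) fm set" "(('f, 'p, 'v) fm) rel"
  | LOr "('f, 'p, 'v) lang" "('f, 'p, 'v) lang"
  | LAnd "('f, 'p, 'v) lang" "('f, 'p, 'v) lang"
  | LBigOr nat "('f, 'p, 'v) lang"
  | LBigAnd "('f, 'p, 'v) lang"
  | LEx "'v set" "('f, 'p, 'v) lang"
  | LAll "'v set" "('f, 'p, 'v) lang"
  | LExAll "'v set" "('f, 'p, 'v) lang"

primrec fms :: "('f, 'p, 'v) lang \<Rightarrow> ('f, 'p, 'v) fm set" where
  "fms (LBase A r) = A \<union> {Bot}"
| "fms (LOr L1 L2) = {Or \<phi>1 \<phi>2 | \<phi>1 \<phi>2. \<phi>1 \<in> fms L1 \<and> \<phi>2 \<in> fms L2}"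
| "fms (LAnd L1 L2) = {And \<phi>1 \<phi>2 | \<phi>1 \<phi>2. \<phi>1 \<in> fms L1 \<and> \<phi>2 \<in> fms L2}"
| "fms (LBigOr k L) = {BigOr \<phi>s | \<phi>s. set \<phi>s \<subseteq> fms L \<and> length \<phi>s \<le> k}"
| "fms (LBigAnd L) = {BigAnd \<phi>s | \<phi>s. set \<phi>s \<subseteq> fms L \<and> \<phi>s \<noteq> []}"
| "fms (LEx X L) = {Ex X \<phi> | \<phi>. \<phi> \<in> fms L}"
| "fms (LAll X L) = {All X \<phi> | \<phi>. \<phi> \<in> fms L}"
| "fms (LExAll X L) = {Ex X \<phi> | \<phi>. \<phi> \<in> fms L} \<union> {All X \<phi> | \<phi>. \<phi> \<in> fms L}"

primrec bottom :: "('f, 'p, 'v) lang \<Rightarrow> ('f, 'p, 'v) fm" where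
  "bottom (LBase A r) = Bot"
| "bottom (LOr L1 L2) = Or (bottom L1) (bottom L2)"
| "bottom (LAnd L1 L2) = And (bottom L1) (bottom L2)"
| "bottom (LBigOr k L) = BigOr []"
| "bottom (LBigAnd L) = BigAnd [bottom L]"
| "bottom (LEx X L) = Ex X (bottom L)"
| "bottom (LAll X L) = All X (bottom L)"
| "bottom (LExAll X L) = All X (bottom L)"

primrec sub :: "('f, 'p, 'v) lang \<Rightarrow> ('f, 'p, 'v) fm \<Rightarrow> ('f, 'p, 'v) fm \<Rightarrow> bool" where
  "sub (LBase A r) \<phi> \<psi> \<longleftrightarrow> \<phi> = Bot \<or> \<phi> = \<psi>"
| "sub (LOr L1 L2) \<phi> \<psi> \<longleftrightarrow>
     (\<exists>\<phi>1 \<phi>2 \<psi>1 \<psi>2. \<phi> = Or \<phi>1 \<phi>2 \<and> \<psi> = Or \<psi>1 \<psi>2 \<and> sub L1 \<phi>1 \<psi>1 \<and> sub L2 \<phi>2 \<psi>2)"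
| "sub (LAnd L1 L2) \<phi> \<psi> \<longleftrightarrow>
     (\<exists>\<phi>1 \<phi>2 \<psi>1 \<psi>2. \<phi> = And \<phi>1 \<phi>2 \<and> \<psi> = And \<psi>1 \<psi>2 \<and> sub L1 \<phi>1 \<psi>1 \<and> sub L2 \<phi>2 \<psi>2)"
| "sub (LBigOr k L) \<phi> \<psi> \<longleftrightarrow>
     (\<exists>\<phi>s \<psi>s m. \<phi> = BigOr \<phi>s \<and> \<psi> = BigOr \<psi>s \<and>
        inj_on m {..<length \<phi>s} \<and> m ` {..<length \<phi>s} \<subseteq> {..<length \<psi>s} \<and>
        (\<forall>i<length \<phi>s. sub L (\<phi>s ! i) (\<psi>s ! m i)))"
| "sub (LBigAnd L) \<phi> \<psi> \<longleftrightarrow>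
     (\<exists>\<phi>s \<psi>s m. \<phi> = BigAnd \<phi>s \<and> \<psi> = BigAnd \<psi>s \<and>
        m ` {..<length \<psi>s} \<subseteq> {..<length \<phi>s} \<and>
        (\<forall>i<length \<psi>s. sub L (\<phi>s ! m i) (\<psi>s ! i)))"
| "sub (LEx X L) \<phi> \<psi> \<longleftrightarrow>
     (\<exists>\<phi>' \<psi>' \<pi>. \<phi> = Ex X \<phi>' \<and> \<psi> = Ex X \<psi>' \<and> \<pi> permutes X \<and> sub L \<phi>' (subst \<pi> \<psi>'))"
| "sub (LAll X L) \<phi> \<psi> \<longleftrightarrow>
     (\<exists>\<phi>' \<psi>' \<pi>. \<phi> = All X \<phi>' \<and> \<psi> = All X \<psi>' \<and> \<pi> permutes X \<and> sub L \<phi>' (subst \<pi> \<psi>'))"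
| "sub (LExAll X L) \<phi> \<psi> \<longleftrightarrow>
     (\<exists>\<phi>' \<psi>' \<pi>. (\<phi> = Ex X \<phi>' \<and> \<psi> = Ex X \<psi>' \<or>
                 \<phi> = All X \<phi>' \<and> \<psi> = All X \<psi>' \<or>
                 \<phi> = All X \<phi>' \<and> \<psi> = Ex X \<psi>') \<and>
                \<pi> permutes X \<and> sub L \<phi>' (subst \<pi> \<psi>'))"

text \<open>
  In the quantifier cases, \<^const>\<open>capture_free\<close> asks that all substitutions by permutations of
  \<open>X\<close> that occur in subsumption and canonicalization are meaningful. It holds for instance
  if no variable of \<open>X\<close> is bound again inside the body. Without it, a formula such as
  \<open>\<forall>y. R x y\<close> in the scope of \<open>\<exists>{x, y}\<close> would be identified with \<open>\<forall>y. R y y\<close>.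
\<close>

primrec bounded_lang :: "('f, 'p) signature \<Rightarrow> 'v set \<Rightarrow> ('f, 'p, 'v) lang \<Rightarrow> bool" where
  "bounded_lang S V (LBase A r) \<longleftrightarrow>
     finite A \<and> (\<forall>\<phi>\<in>A. fm_over S \<phi> \<and> fv \<phi> \<subseteq> V) \<and> perm_closed V A \<and>
     linear_order_on (A \<union> {Bot}) r \<and>
     (\<forall>\<phi>\<in>A \<union> {Bot}. \<forall>\<psi>\<in>A \<union> {Bot}. sub (LBase A r) \<phi> \<psi> \<longrightarrow> (\<phi>, \<psi>) \<in> r)"
| "bounded_lang S V (LOr L1 L2) \<longleftrightarrow> bounded_lang S V L1 \<and> bounded_lang S V L2"
| "bounded_lang S V (LAnd L1 L2) \<longleftrightarrow> bounded_lang S V L1 \<and> bounded_lang S V L2"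
| "bounded_lang S V (LBigOr k L) \<longleftrightarrow> bounded_lang S V L"
| "bounded_lang S V (LBigAnd L) \<longleftrightarrow> bounded_lang S V L"
| "bounded_lang S V (LEx X L) \<longleftrightarrow> finite X \<and> X \<subseteq> V \<and> bounded_lang S V L \<and>
     (\<forall>\<phi>\<in>fms L. \<forall>\<pi>. \<pi> permutes X \<longrightarrow> capture_free \<pi> \<phi>)"
| "bounded_lang S V (LAll X L) \<longleftrightarrow> finite X \<and> X \<subseteq> V \<and> bounded_lang S V L \<and>
     (\<forall>\<phi>\<in>fms L. \<forall>\<pi>. \<pi> permutes X \<longrightarrow> capture_free \<pi> \<phi>)"
| "bounded_lang S V (LExAll X L) \<longleftrightarrow> finite X \<and> X \<subseteq> V \<and> bounded_lang S V L \<and>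
     (\<forall>\<phi>\<in>fms L. \<forall>\<pi>. \<pi> permutes X \<longrightarrow> capture_free \<pi> \<phi>)"

section \<open>The order and canonicalization\<close>

text \<open>
  The order never refers to canonicalization in its own definition, so it is defined first,
  on arbitrary formulas. It is a total order only on the canonical formulas.
\<close>

primrec le :: "('f, 'p, 'v) lang \<Rightarrow> ('f, 'p, 'v) fm \<Rightarrow> ('f, 'p, 'v) fm \<Rightarrow> bool" where
  "le (LBase A r) \<phi> \<psi> \<longleftrightarrow> (\<phi>, \<psi>) \<in> r"
| "le (LOr L1 L2) \<phi> \<psi> \<longleftrightarrow>
     (\<exists>\<phi>1 \<phi>2 \<psi>1 \<psi>2. \<phi> = Or \<phi>1 \<phi>2 \<and> \<psi> = Or \<psi>1 \<psi>2 \<and>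
        (le L1 \<phi>1 \<psi>1 \<and> \<phi>1 \<noteq> \<psi>1 \<or> \<phi>1 = \<psi>1 \<and> le L2 \<phi>2 \<psi>2))"
| "le (LAnd L1 L2) \<phi> \<psi> \<longleftrightarrow>
     (\<exists>\<phi>1 \<phi>2 \<psi>1 \<psi>2. \<phi> = And \<phi>1 \<phi>2 \<and> \<psi> = And \<psi>1 \<psi>2 \<and>
        (le L1 \<phi>1 \<psi>1 \<and> \<phi>1 \<noteq> \<psi>1 \<or> \<phi>1 = \<psi>1 \<and> le L2 \<phi>2 \<psi>2))"
| "le (LBigOr k L) \<phi> \<psi> \<longleftrightarrow>
     (\<exists>\<phi>s \<psi>s. \<phi> = BigOr \<phi>s \<and> \<psi> = BigOr \<psi>s \<and>
        (suffix \<phi>s \<psi>s \<or> first_diff_le (le L) (rev \<phi>s) (rev \<psi>s)))"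
| "le (LBigAnd L) \<phi> \<psi> \<longleftrightarrow>
     (\<exists>\<phi>s \<psi>s. \<phi> = BigAnd \<phi>s \<and> \<psi> = BigAnd \<psi>s \<and>
        (prefix \<psi>s \<phi>s \<or> first_diff_le (le L) \<phi>s \<psi>s))"
| "le (LEx X L) \<phi> \<psi> \<longleftrightarrow> (\<exists>\<phi>' \<psi>'. \<phi> = Ex X \<phi>' \<and> \<psi> = Ex X \<psi>' \<and> le L \<phi>' \<psi>')"
| "le (LAll X L) \<phi> \<psi> \<longleftrightarrow> (\<exists>\<phi>' \<psi>'. \<phi> = All X \<phi>' \<and> \<psi> = All X \<psi>' \<and> le L \<phi>' \<psi>')"
| "le (LExAll X L) \<phi> \<psi> \<longleftrightarrow>
     (\<exists>\<phi>' \<psi>'. \<phi> = Ex X \<phi>' \<and> \<psi> = Ex X \<psi>' \<and> le L \<phi>' \<psi>' \<or>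
              \<phi> = All X \<phi>' \<and> \<psi> = All X \<psi>' \<and> le L \<phi>' \<psi>' \<or>
              \<phi> = All X \<phi>' \<and> \<psi> = Ex X \<psi>')"

primrec canon :: "('f, 'p, 'v) lang \<Rightarrow> ('f, 'p, 'v) fm \<Rightarrow> ('f, 'p, 'v) fm" where
  "canon (LBase A r) \<phi> = \<phi>"
| "canon (LOr L1 L2) \<phi> =
     (case \<phi> of Or \<phi>1 \<phi>2 \<Rightarrow> Or (canon L1 \<phi>1) (canon L2 \<phi>2) | _ \<Rightarrow> \<phi>)"
| "canon (LAnd L1 L2) \<phi> =
     (case \<phi> of And \<phi>1 \<phi>2 \<Rightarrow> And (canon L1 \<phi>1) (canon L2 \<phi>2) | _ \<Rightarrow> \<phi>)"
| "canon (LBigOr k L) \<phi> =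
     (case \<phi> of BigOr \<phi>s \<Rightarrow> BigOr (sort_list (le L) (map (canon L) \<phi>s)) | _ \<Rightarrow> \<phi>)"
| "canon (LBigAnd L) \<phi> =
     (case \<phi> of BigAnd \<phi>s \<Rightarrow>
        BigAnd (sort_set (le L) (minimals (sub L) {canon L \<psi> | \<psi>. \<psi> \<in> set \<phi>s})) | _ \<Rightarrow> \<phi>)"
| "canon (LEx X L) \<phi> =
     (case \<phi> of Ex Y \<psi> \<Rightarrow>
        Ex X (least_of (le L) {canon L (subst \<pi> \<psi>) | \<pi>. \<pi> permutes X}) | _ \<Rightarrow> \<phi>)"
| "canon (LAll X L) \<phi> =
     (case \<phi> of All Y \<psi> \<Rightarrow>
        All X (least_of (le L) {canon L (subst \<pi> \<psi>) | \<pi>. \<pi> permutes X}) | _ \<Rightarrow> \<phi>)"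
| "canon (LExAll X L) \<phi> =
     (case \<phi> of Ex Y \<psi> \<Rightarrow>
        Ex X (least_of (le L) {canon L (subst \<pi> \<psi>) | \<pi>. \<pi> permutes X})
      | All Y \<psi> \<Rightarrow>
        All X (least_of (le L) {canon L (subst \<pi> \<psi>) | \<pi>. \<pi> permutes X})
      | _ \<Rightarrow> \<phi>)"

definition canonical :: "('f, 'p, 'v) lang \<Rightarrow> ('f, 'p, 'v) fm \<Rightarrow> bool" where
  "canonical L \<phi> \<longleftrightarrow> canon L \<phi> = \<phi>"

section \<open>The weaken operator\<close>

definition weaken ::
  "('f, 'p, 'v) lang \<Rightarrow> ('f, 'p, 'v) fm \<Rightarrow> ('u, 'f, 'p, 'v) state \<Rightarrow> ('f, 'p, 'v) fm set" where
  "weaken L \<phi> s = minimals (sub L) {canon L \<psi> | \<psi>. \<psi> \<in> fms L \<and> sub L \<phi> \<psi> \<and> s \<Turnstile> \<psi>}"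

primrec weaken_seq ::
  "('f, 'p, 'v) lang \<Rightarrow> ('f, 'p, 'v) fm \<Rightarrow> ('u, 'f, 'p, 'v) state list \<Rightarrow> ('f, 'p, 'v) fm set" where
  "weaken_seq L \<phi> [] = {\<phi>}"
| "weaken_seq L \<phi> (s # ss) = (\<Union>\<psi>\<in>weaken L \<phi> s. weaken_seq L \<psi> ss)"

end

theory Submission
  imports Defs "HOL-Combinatorics.Cycles"
begin

text \<open>
  Subsumption is a preorder that implies entailment, it is a partial order on the canonical
  formulas, there are only finitely many of these, and every formula is equivalent to its
  canonical form. Hence the canonical formulas above \<open>\<phi>\<close> that hold in \<open>s\<close> form a finite poset, and
  \<open>weaken L \<phi> s\<close> consists of its minimal elements. If every element of this poset lies above
  an element of a subset \<open>W\<close>, then the poset and \<open>W\<close> have the same minimal elements. Each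
  recursive equation exhibits such a \<open>W\<close>, built from weakenings of subformulas.
\<close>

section \<open>Substitution\<close>

text \<open>Two obstacles shape the development. Below an inner quantifier a permutation of the
  quantified variables is cut off at the variables bound there, so inductions on languages run over
  injective capture-avoiding maps instead of permutations. Moreover \<open>sort_list\<close>,
  \<open>sort_set\<close> and \<open>least_of\<close> are definite descriptions, which mean what
  they should only if the order of the sublanguage is linear on its canonical formulas; therefore
  equivalence with the canonical form, antisymmetry, linearity and finiteness go through one joint
  induction. Antisymmetry is the hard part. For bounded disjunctions and for quantifiers, mutual
  subsumption produces a permutation of a finite set, and running around its cycles turns a chain of
  subsumptions into equivalences. In the equations, the candidate set is already an antichain for
  base languages and binary connectives and has at most one element for conjunctions. For bounded
  disjunctions and for the single quantifiers it may contain comparable formulas, and the outer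
  \<open>minimals\<close> stays.\<close>

lemma shield_comp:
  assumes "x \<notin> X \<Longrightarrow> \<sigma> x \<notin> X"
  shows "(shield X \<pi> \<circ> shield X \<sigma>) x = shield X (\<pi> \<circ> \<sigma>) x"
  using assms by (simp add: shield_def)

lemma subst_tm_cong: "(\<And>x. x \<in> fv_tm t \<Longrightarrow> \<pi> x = \<sigma> x) \<Longrightarrow> subst_tm \<pi> t = subst_tm \<sigma> t"
  by (induction t) auto

text \<open>Only values on free variables matter. This permits exchanging a map for another that
  agrees with it there: a composition of shielded maps for a shielded composition, and later a
  renaming for a genuine permutation of \<open>V\<close>.\<close>

lemma subst_cong: "(\<And>x. x \<in> fv \<phi> \<Longrightarrow> \<pi> x = \<sigma> x) \<Longrightarrow> subst \<pi> \<phi> = subst \<sigma> \<phi>"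
proof (induction \<phi> arbitrary: \<pi> \<sigma>)
  case (Ex X \<phi>)
  have "subst (shield X \<pi>) \<phi> = subst (shield X \<sigma>) \<phi>"
    using Ex.prems by (intro Ex.IH) (simp add: shield_def)
  then show ?case by simp
next
  case (All X \<phi>)
  have "subst (shield X \<pi>) \<phi> = subst (shield X \<sigma>) \<phi>"
    using All.prems by (intro All.IH) (simp add: shield_def)
  then show ?case by simp
next
  case (Eq t u)
  then show ?case using subst_tm_cong[of t \<pi> \<sigma>] subst_tm_cong[of u \<pi> \<sigma>] by simp
next
  case (Rel p ts)
  then show ?case by (auto intro: subst_tm_cong)
next
  case (Neg \<phi>)
  have "subst \<pi> \<phi> = subst \<sigma> \<phi>" using Neg.prems by (intro Neg.IH) simp
  then show ?case by simp
next
  case (Or \<phi> \<psi>)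
  have "subst \<pi> \<phi> = subst \<sigma> \<phi>" "subst \<pi> \<psi> = subst \<sigma> \<psi>"
    using Or.prems by (intro Or.IH; simp)+
  then show ?case by simp
next
  case (And \<phi> \<psi>)
  have "subst \<pi> \<phi> = subst \<sigma> \<phi>" "subst \<pi> \<psi> = subst \<sigma> \<psi>"
    using And.prems by (intro And.IH; simp)+
  then show ?case by simp
next
  case (BigOr \<phi>s)
  have "subst \<pi> \<phi> = subst \<sigma> \<phi>" if "\<phi> \<in> set \<phi>s" for \<phi>
    using BigOr.prems that by (intro BigOr.IH) auto
  then show ?case by simp
next
  case (BigAnd \<phi>s)
  have "subst \<pi> \<phi> = subst \<sigma> \<phi>" if "\<phi> \<in> set \<phi>s" for \<phi>
    using BigAnd.prems that by (intro BigAnd.IH) auto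
  then show ?case by simp
qed simp

lemma subst_tm_id: "subst_tm (\<lambda>x. x) t = t"
  by (induction t) (auto intro: map_idI)

lemma shield_id: "shield X (\<lambda>x. x) = (\<lambda>x. x)"
  by (auto simp: shield_def)

lemma subst_id [simp]: "subst id \<phi> = \<phi>"
  unfolding id_def by (induction \<phi>) (auto simp: subst_tm_id shield_id intro: map_idI)

lemma subst_tm_comp: "subst_tm \<pi> (subst_tm \<sigma> t) = subst_tm (\<pi> \<circ> \<sigma>) t"
  by (induction t) auto

text \<open>Without capture the free variables outside \<open>X\<close> are sent outside
  \<open>X\<close>, so on the free variables of the body shielding commutes with composition. A
  captured variable would be skipped by the second substitution.\<close>

lemma subst_comp: "capture_free \<sigma> \<phi> \<Longrightarrow> subst \<pi> (subst \<sigma> \<phi>) = subst (\<pi> \<circ> \<sigma>) \<phi>"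
proof (induction \<phi> arbitrary: \<pi> \<sigma>)
  case (Ex X \<phi>)
  then have "subst (shield X \<pi>) (subst (shield X \<sigma>) \<phi>) = subst (shield X \<pi> \<circ> shield X \<sigma>) \<phi>"
    by (intro Ex.IH) auto
  also have "\<dots> = subst (shield X (\<pi> \<circ> \<sigma>)) \<phi>"
    using Ex.prems by (intro subst_cong shield_comp) auto
  finally show ?case by (simp del: o_apply)
next
  case (All X \<phi>)
  then have "subst (shield X \<pi>) (subst (shield X \<sigma>) \<phi>) = subst (shield X \<pi> \<circ> shield X \<sigma>) \<phi>"
    by (intro All.IH) auto
  also have "\<dots> = subst (shield X (\<pi> \<circ> \<sigma>)) \<phi>"
    using All.prems by (intro subst_cong shield_comp) auto
  finally show ?case by (simp del: o_apply)
qed (auto simp: subst_tm_comp)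

lemma finite_fv_tm: "finite (fv_tm t)"
  by (induction t) auto

lemma finite_fv: "finite (fv \<phi>)"
  by (induction \<phi>) (auto simp: finite_fv_tm)

section \<open>Coincidence and substitution lemmas for satisfaction\<close>

lemma tm_val_cong:
  "(\<And>x. x \<in> fv_tm t \<Longrightarrow> \<mu> x = \<mu>' x) \<Longrightarrow> tm_val M \<mu> t = tm_val M \<mu>' t"
proof (induction t)
  case (Fn f ts)
  then have "map (tm_val M \<mu>) ts = map (tm_val M \<mu>') ts" by auto
  then show ?case by (simp del: map_eq_conv)
qed simp

lemma sat_cong: "(\<And>x. x \<in> fv \<phi> \<Longrightarrow> \<mu> x = \<mu>' x) \<Longrightarrow> (M, \<mu>) \<Turnstile> \<phi> \<longleftrightarrow> (M, \<mu>') \<Turnstile> \<phi>"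
proof (induction \<phi> arbitrary: \<mu> \<mu>')
  case (Eq t u)
  then show ?case
    using tm_val_cong[of t \<mu> \<mu>' M] tm_val_cong[of u \<mu> \<mu>' M] by simp
next
  case (Rel p ts)
  then have "map (tm_val M \<mu>) ts = map (tm_val M \<mu>') ts"
    by (auto intro: tm_val_cong)
  then show ?case by (simp del: map_eq_conv)
next
  case (Neg \<phi>)
  have "(M, \<mu>) \<Turnstile> \<phi> \<longleftrightarrow> (M, \<mu>') \<Turnstile> \<phi>" using Neg.prems by (intro Neg.IH) simp
  then show ?case by simp
next
  case (Or \<phi> \<psi>)
  have "(M, \<mu>) \<Turnstile> \<phi> \<longleftrightarrow> (M, \<mu>') \<Turnstile> \<phi>" "(M, \<mu>) \<Turnstile> \<psi> \<longleftrightarrow> (M, \<mu>') \<Turnstile> \<psi>"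
    using Or.prems by (intro Or.IH; simp)+
  then show ?case by simp
next
  case (And \<phi> \<psi>)
  have "(M, \<mu>) \<Turnstile> \<phi> \<longleftrightarrow> (M, \<mu>') \<Turnstile> \<phi>" "(M, \<mu>) \<Turnstile> \<psi> \<longleftrightarrow> (M, \<mu>') \<Turnstile> \<psi>"
    using And.prems by (intro And.IH; simp)+
  then show ?case by simp
next
  case (BigOr \<phi>s)
  have "(M, \<mu>) \<Turnstile> \<phi> \<longleftrightarrow> (M, \<mu>') \<Turnstile> \<phi>" if "\<phi> \<in> set \<phi>s" for \<phi>
    using BigOr.prems that by (intro BigOr.IH) auto
  then show ?case by simp
next
  case (BigAnd \<phi>s)
  have "(M, \<mu>) \<Turnstile> \<phi> \<longleftrightarrow> (M, \<mu>') \<Turnstile> \<phi>" if "\<phi> \<in> set \<phi>s" for \<phi>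
    using BigAnd.prems that by (intro BigAnd.IH) auto
  then show ?case by simp
next
  case (Ex X \<phi>)
  have "(M, \<mu> ++ \<nu>) \<Turnstile> \<phi> \<longleftrightarrow> (M, \<mu>' ++ \<nu>) \<Turnstile> \<phi>" if "\<nu> \<in> assigns X (univ M)" for \<nu>
    using Ex.prems that
    by (intro Ex.IH) (auto simp: assigns_def map_add_def split: option.splits)
  then show ?case by simp
next
  case (All X \<phi>)
  have "(M, \<mu> ++ \<nu>) \<Turnstile> \<phi> \<longleftrightarrow> (M, \<mu>' ++ \<nu>) \<Turnstile> \<phi>" if "\<nu> \<in> assigns X (univ M)" for \<nu>
    using All.prems that
    by (intro All.IH) (auto simp: assigns_def map_add_def split: option.splits)
  then show ?case by simp
qed simp

lemma tm_val_subst: "tm_val M \<mu> (subst_tm \<pi> t) = tm_val M (\<mu> \<circ> \<pi>) t"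
  by (induction t) (auto intro!: arg_cong[of _ _ "fun_int M _"])

text \<open>An assignment \<open>\<nu>\<close> with domain \<open>X\<close> hides
  \<open>\<mu>\<close> on \<open>X\<close>, while \<open>\<pi>\<close> keeps the other variable
  outside \<open>X\<close>. Hence reading through the shielded map and overriding by
  \<open>\<nu>\<close> can be exchanged; this is the quantifier step of
  \<open>sat_subst\<close>.\<close>

lemma map_add_shield:
  assumes "dom \<nu> = X" and "x \<notin> X \<Longrightarrow> \<pi> x \<notin> X"
  shows "((\<mu> ++ \<nu>) \<circ> shield X \<pi>) x = ((\<mu> \<circ> \<pi>) ++ \<nu>) x"
  using assms by (auto simp: shield_def map_add_def split: option.splits)

lemma sat_subst: "capture_free \<pi> \<phi> \<Longrightarrow> (M, \<mu>) \<Turnstile> subst \<pi> \<phi> \<longleftrightarrow> (M, \<mu> \<circ> \<pi>) \<Turnstile> \<phi>"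
proof (induction \<phi> arbitrary: \<pi> \<mu>)
  case (Rel p ts)
  have "map (tm_val M \<mu> \<circ> subst_tm \<pi>) ts = map (tm_val M (\<mu> \<circ> \<pi>)) ts"
    by (simp add: tm_val_subst)
  then show ?case by (simp del: map_eq_conv o_apply)
next
  case (Ex X \<phi>)
  have "(M, \<mu> ++ \<nu>) \<Turnstile> subst (shield X \<pi>) \<phi> \<longleftrightarrow> (M, (\<mu> \<circ> \<pi>) ++ \<nu>) \<Turnstile> \<phi>"
    if "\<nu> \<in> assigns X (univ M)" for \<nu>
  proof -
    have "(M, \<mu> ++ \<nu>) \<Turnstile> subst (shield X \<pi>) \<phi> \<longleftrightarrow> (M, (\<mu> ++ \<nu>) \<circ> shield X \<pi>) \<Turnstile> \<phi>"
      using Ex.prems by (intro Ex.IH) simp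
    also have "\<dots> \<longleftrightarrow> (M, (\<mu> \<circ> \<pi>) ++ \<nu>) \<Turnstile> \<phi>"
      using Ex.prems that by (intro sat_cong map_add_shield) (auto simp: assigns_def)
    finally show ?thesis .
  qed
  then show ?case by (simp del: o_apply)
next
  case (All X \<phi>)
  have "(M, \<mu> ++ \<nu>) \<Turnstile> subst (shield X \<pi>) \<phi> \<longleftrightarrow> (M, (\<mu> \<circ> \<pi>) ++ \<nu>) \<Turnstile> \<phi>"
    if "\<nu> \<in> assigns X (univ M)" for \<nu>
  proof -
    have "(M, \<mu> ++ \<nu>) \<Turnstile> subst (shield X \<pi>) \<phi> \<longleftrightarrow> (M, (\<mu> ++ \<nu>) \<circ> shield X \<pi>) \<Turnstile> \<phi>"
      using All.prems by (intro All.IH) simp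
    also have "\<dots> \<longleftrightarrow> (M, (\<mu> \<circ> \<pi>) ++ \<nu>) \<Turnstile> \<phi>"
      using All.prems that by (intro sat_cong map_add_shield) (auto simp: assigns_def)
    finally show ?thesis .
  qed
  then show ?case by (simp del: o_apply)
qed (simp_all add: tm_val_subst)

section \<open>Minimal elements\<close>

text \<open>Minimality is meant in the preorder sense, so a non-minimal \<open>x\<close> has a
  strictly lower \<open>y\<close>. By transitivity the elements below \<open>y\<close> are among
  those below \<open>x\<close>, and \<open>x\<close> itself is lost, so their number drops.\<close>

lemma ex_minimal_below:
  assumes "finite U" "reflp_on U R" "transp_on U R" "x \<in> U"
  shows "\<exists>m\<in>minimals R U. R m x"
  using assms(4)
proof (induction "card {y \<in> U. R y x}" arbitrary: x rule: less_induct)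
  case less
  show ?case
  proof (cases "x \<in> minimals R U")
    case True
    then show ?thesis using assms(2) less.prems by (auto dest: reflp_onD)
  next
    case False
    then obtain y where y: "y \<in> U" "R y x" "\<not> R x y"
      using less.prems by (auto simp: minimals_def)
    have "{z \<in> U. R z y} \<subset> {z \<in> U. R z x}"
      using y less.prems assms(2,3) by (auto dest: reflp_onD transp_onD)
    then have "card {z \<in> U. R z y} < card {z \<in> U. R z x}"
      using assms(1) by (intro psubset_card_mono) auto
    from less.hyps[OF this y(1)] obtain m where "m \<in> minimals R U" "R m y" by blast
    moreover from this have "m \<in> U" by (simp add: minimals_def)
    ultimately show ?thesis using y less.prems assms(3) by (blast dest: transp_onD)
  qed
qed

text \<open>A minimal \<open>x\<close> of \<open>U\<close> has some \<open>w\<close> of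
  \<open>W\<close> below it, and antisymmetry forces \<open>x = w\<close>. Conversely, whatever lies
  below a minimal element of \<open>W\<close> has again an element of \<open>W\<close> below it, and
  transitivity leads back up.\<close>

lemma minimals_eq_of_dense:
  assumes "transp_on U R" "antisymp_on U R" "W \<subseteq> U" "\<And>x. x \<in> U \<Longrightarrow> \<exists>w\<in>W. R w x"
  shows "minimals R U = minimals R W"
proof (intro set_eqI iffI)
  fix x assume x: "x \<in> minimals R U"
  then obtain w where w: "w \<in> W" "R w x" using assms(4) by (auto simp: minimals_def)
  have "x = w"
    using x w assms(2,3) by (auto simp: minimals_def dest: antisymp_onD)
  with x w assms(3) show "x \<in> minimals R W" by (auto simp: minimals_def)
next
  fix x assume x: "x \<in> minimals R W"
  have "R x y" if y: "y \<in> U" "R y x" for y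
  proof -
    obtain w where w: "w \<in> W" "R w y" using assms(4) y by blast
    have U: "x \<in> U" "w \<in> U" using x w assms(3) by (auto simp: minimals_def)
    then have "R w x" using w y assms(1) by (blast dest: transp_onD)
    then have "R x w" using x w by (auto simp: minimals_def)
    with w y U show ?thesis using assms(1) by (blast dest: transp_onD)
  qed
  with x assms(3) show "x \<in> minimals R U" by (auto simp: minimals_def)
qed

lemma minimals_subset: "minimals R U \<subseteq> U"
  by (auto simp: minimals_def)

section \<open>Linear orders and sorting\<close>

text \<open>The order \<open>le L\<close> is linear only on canonical formulas, so all four
  properties are taken relative to a carrier.\<close>

definition lin_on :: "'a set \<Rightarrow> ('a \<Rightarrow> 'a \<Rightarrow> bool) \<Rightarrow> bool" where
  "lin_on A R \<longleftrightarrow> reflp_on A R \<and> transp_on A R \<and> antisymp_on A R \<and> totalp_on A R"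

lemma lin_onI:
  assumes "\<And>x. x \<in> A \<Longrightarrow> R x x"
    and "\<And>x y z. x \<in> A \<Longrightarrow> y \<in> A \<Longrightarrow> z \<in> A \<Longrightarrow> R x y \<Longrightarrow> R y z \<Longrightarrow> R x z"
    and "\<And>x y. x \<in> A \<Longrightarrow> y \<in> A \<Longrightarrow> R x y \<Longrightarrow> R y x \<Longrightarrow> x = y"
    and "\<And>x y. x \<in> A \<Longrightarrow> y \<in> A \<Longrightarrow> x \<noteq> y \<Longrightarrow> R x y \<or> R y x"
  shows "lin_on A R"
  unfolding lin_on_def reflp_on_def transp_on_def antisymp_on_def totalp_on_def
  by (intro conjI ballI impI) (use assms in blast)+

lemma lin_onD:
  assumes "lin_on A R"
  shows "x \<in> A \<Longrightarrow> R x x"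
    and "x \<in> A \<Longrightarrow> y \<in> A \<Longrightarrow> z \<in> A \<Longrightarrow> R x y \<Longrightarrow> R y z \<Longrightarrow> R x z"
    and "x \<in> A \<Longrightarrow> y \<in> A \<Longrightarrow> R x y \<Longrightarrow> R y x \<Longrightarrow> x = y"
    and "x \<in> A \<Longrightarrow> y \<in> A \<Longrightarrow> R x y \<or> R y x"
  using assms unfolding lin_on_def
  by (blast dest: reflp_onD transp_onD antisymp_onD totalp_onD)+

text \<open>An order equivalence carries the four properties over to the image. In this way
  \<open>le\<close> on a composite language is read through the constructor from an order on pairs,
  lists or bodies.\<close>

lemma lin_on_image:
  assumes "lin_on A R" "\<And>x y. x \<in> A \<Longrightarrow> y \<in> A \<Longrightarrow> Q (f x) (f y) \<longleftrightarrow> R x y"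
  shows "lin_on (f ` A) Q"
proof (rule lin_onI, goal_cases)
  case (2 x y z)
  then show ?case using assms(2) lin_onD(2)[OF assms(1)] by blast
next
  case (3 x y)
  then show ?case using assms(2) lin_onD(3)[OF assms(1)] by blast
next
  case (4 x y)
  then show ?case using assms(2) lin_onD(4)[OF assms(1)] by blast
qed (use assms(2) lin_onD(1)[OF assms(1)] in blast)

lemma lin_on_subset: "lin_on B R \<Longrightarrow> A \<subseteq> B \<Longrightarrow> lin_on A R"
  unfolding lin_on_def
  by (meson antisymp_on_subset reflp_on_subset totalp_on_subset transp_on_subset)

lemma ex_sorted:
  assumes "lin_on A R" "set xs \<subseteq> A"
  shows "\<exists>ys. mset ys = mset xs \<and> sorted_wrt R ys"
  using assms(2)
proof (induction xs)
  case (Cons x xs)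
  then obtain ys where ys: "mset ys = mset xs" "sorted_wrt R ys" by auto
  from ys(1) have "set ys = set xs" by (rule mset_eq_setD)
  with Cons.prems have A: "x \<in> A" "set ys \<subseteq> A" by auto
  \<comment> \<open>Insertion of \<open>x\<close>: the two filters inherit the sorting of
    \<open>ys\<close>, and an element at or below \<open>x\<close> precedes one that is not, by
    totality and transitivity through \<open>x\<close>.\<close>
  let ?zs = "filter (\<lambda>y. R y x) ys @ [x] @ filter (\<lambda>y. \<not> R y x) ys"
  have "mset ?zs = mset (x # xs)" using ys(1) by (simp flip: ys(1))
  moreover have "R y z" if "y \<in> set ys" "R y x" "z \<in> set ys" "\<not> R z x" for y z
    using lin_onD(2,4)[OF assms(1)] A that by (metis subsetD)
  moreover have "R x z" if "z \<in> set ys" "\<not> R z x" for z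
    using lin_onD(4)[OF assms(1)] A that by blast
  ultimately have "mset ?zs = mset (x # xs) \<and> sorted_wrt R ?zs"
    using ys(2) by (auto simp: sorted_wrt_append sorted_wrt_filter)
  then show ?case by blast
qed simp

text \<open>If the heads differed, each would occur in the tail of the other list, hence each would
  precede the other, and antisymmetry would equate them.\<close>

lemma sorted_unique:
  assumes "lin_on A R" "set xs \<subseteq> A" "mset xs = mset ys" "sorted_wrt R xs" "sorted_wrt R ys"
  shows "xs = ys"
  using assms(2-)
proof (induction xs arbitrary: ys)
  case (Cons x xs)
  then obtain y ys' where ys: "ys = y # ys'" by (cases ys) auto
  have set_eq: "set (x # xs) = set ys" using Cons.prems by (metis mset_eq_setD)
  have "x = y"
  proof (rule ccontr)
    assume "x \<noteq> y"
    with set_eq ys have xy: "x \<in> set ys'" "y \<in> set xs" by auto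
    then have "R x y" "R y x" using Cons.prems ys by auto
    with xy \<open>x \<noteq> y\<close> Cons.prems(1) lin_onD(3)[OF assms(1)] show False by auto
  qed
  with Cons ys show ?case by auto
qed simp

text \<open>\<open>sort_list\<close> is a definite description; existence and uniqueness of the
  sorted list yield its specification. Multisets are used because repeated disjuncts have to survive
  sorting.\<close>

lemma sort_list:
  assumes "lin_on A R" "set xs \<subseteq> A"
  shows mset_sort_list: "mset (sort_list R xs) = mset xs"
    and sorted_sort_list: "sorted_wrt R (sort_list R xs)"
proof -
  have "\<exists>!ys. mset ys = mset xs \<and> sorted_wrt R ys"
  proof (rule ex_ex1I)
    fix ys zs assume *: "mset ys = mset xs \<and> sorted_wrt R ys" "mset zs = mset xs \<and> sorted_wrt R zs"
    then have "set ys \<subseteq> A" using assms(2) by (metis mset_eq_setD)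
    with * show "ys = zs" using sorted_unique[OF assms(1)] by metis
  qed (rule ex_sorted[OF assms])
  from theI'[OF this]
  show "mset (sort_list R xs) = mset xs" "sorted_wrt R (sort_list R xs)"
    unfolding sort_list_def by auto
qed

lemma set_sort_list: "lin_on A R \<Longrightarrow> set xs \<subseteq> A \<Longrightarrow> set (sort_list R xs) = set xs"
  using mset_sort_list by (metis mset_eq_setD)

lemma length_sort_list: "lin_on A R \<Longrightarrow> set xs \<subseteq> A \<Longrightarrow> length (sort_list R xs) = length xs"
  using mset_sort_list by (metis mset_eq_length)

text \<open>Reduces to \<open>sort_list\<close> on a repetition-free enumeration: for distinct lists
  the set determines the multiset, so uniqueness of sorted lists applies.\<close>

lemma sort_set:
  assumes "lin_on A R" "F \<subseteq> A" "finite F"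
  shows set_sort_set: "set (sort_set R F) = F"
    and distinct_sort_set: "distinct (sort_set R F)"
    and sorted_sort_set: "sorted_wrt R (sort_set R F)"
proof -
  have "\<exists>!ys. set ys = F \<and> distinct ys \<and> sorted_wrt R ys"
  proof (rule ex_ex1I)
    from assms(3) obtain xs where xs: "set xs = F" "distinct xs"
      using finite_distinct_list by blast
    let ?ys = "sort_list R xs"
    have "mset ?ys = mset xs" "sorted_wrt R ?ys"
      using sort_list[OF assms(1), of xs] xs assms(2) by auto
    with xs show "\<exists>ys. set ys = F \<and> distinct ys \<and> sorted_wrt R ys"
      by (metis mset_eq_setD mset_eq_imp_distinct_iff)
  next
    fix ys zs
    assume "set ys = F \<and> distinct ys \<and> sorted_wrt R ys" "set zs = F \<and> distinct zs \<and> sorted_wrt R zs"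
    then show "ys = zs"
      using sorted_unique[OF assms(1), of ys zs] assms(2) set_eq_iff_mset_eq_distinct[of ys zs]
      by auto
  qed
  from theI'[OF this]
  show "set (sort_set R F) = F" "distinct (sort_set R F)" "sorted_wrt R (sort_set R F)"
    unfolding sort_set_def by auto
qed

lemma least_of_in:
  assumes "lin_on A R" "F \<subseteq> A" "finite F" "F \<noteq> {}"
  shows "least_of R F \<in> F"
proof -
  note lin = lin_onD[OF lin_on_subset[OF assms(1,2)]]
  from assms(3,4) assms(2) have "\<exists>x\<in>F. \<forall>y\<in>F. R x y"
  proof (induction rule: finite_ne_induct)
    case (singleton x)
    then show ?case using lin_onD(1)[OF assms(1)] by auto
  next
    case (insert x F)
    then obtain z where z: "z \<in> F" "\<forall>y\<in>F. R z y" by auto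
    have A: "x \<in> A" "z \<in> A" "F \<subseteq> A" using z insert.prems by auto
    show ?case
    proof (cases "R x z")
      case True
      have "R x y" if "y \<in> F" for y
        using lin_onD(2)[OF assms(1) A(1,2) _ True] that A z by auto
      with A lin_onD(1)[OF assms(1)] show ?thesis by auto
    next
      case False
      with A lin_onD(4)[OF assms(1)] have "R z x" by blast
      with z show ?thesis by auto
    qed
  qed
  with lin(3) have "\<exists>!x. x \<in> F \<and> (\<forall>y\<in>F. R x y)" by blast
  from theI'[OF this] show ?thesis
    unfolding least_of_def by auto
qed

section \<open>Lexicographic comparison of lists\<close>

lemma first_diff_le_simps [simp]:
  "\<not> first_diff_le R [] ys" "\<not> first_diff_le R xs []"
  "first_diff_le R (x # xs) (y # ys) \<longleftrightarrow> x \<noteq> y \<and> R x y \<or> x = y \<and> first_diff_le R xs ys"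
proof -
  show "first_diff_le R (x # xs) (y # ys) \<longleftrightarrow> x \<noteq> y \<and> R x y \<or> x = y \<and> first_diff_le R xs ys"
    (is "?l \<longleftrightarrow> ?r")
  proof
    assume ?l
    then obtain i where i: "i < length (x # xs)" "i < length (y # ys)"
      "take i (x # xs) = take i (y # ys)" "(x # xs) ! i \<noteq> (y # ys) ! i"
      "R ((x # xs) ! i) ((y # ys) ! i)"
      unfolding first_diff_le_def by blast
    then show ?r by (cases i) (auto simp: first_diff_le_def)
  next
    assume ?r
    then show ?l
    proof
      assume "x = y \<and> first_diff_le R xs ys"
      then obtain i where "x = y" "i < length xs" "i < length ys" "take i xs = take i ys"
        "xs ! i \<noteq> ys ! i" "R (xs ! i) (ys ! i)"
        unfolding first_diff_le_def by blast
      then show ?l unfolding first_diff_le_def by (intro exI[of _ "Suc i"]) simp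
    qed (auto simp: first_diff_le_def)
  qed
qed (simp_all add: first_diff_le_def)

lemma first_diff_le_trans:
  assumes "lin_on A R" "set xs \<subseteq> A" "set ys \<subseteq> A" "set zs \<subseteq> A"
    "first_diff_le R xs ys" "first_diff_le R ys zs"
  shows "first_diff_le R xs zs"
  using assms(2-)
proof (induction xs arbitrary: ys zs)
  case (Cons x xs)
  from Cons.prems obtain y ys' where ys: "ys = y # ys'" by (cases ys) auto
  from Cons.prems obtain z zs' where zs: "zs = z # zs'" by (cases zs) auto
  \<comment> \<open>Either all three heads agree and the tails decide, or one of the two head
    comparisons is strict and already separates \<open>x\<close> from \<open>z\<close>.\<close>
  show ?case
  proof (cases "x = y \<and> y = z")
    case True
    with Cons.IH[of ys' zs'] Cons.prems show ?thesis by (simp add: ys zs)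
  next
    case False
    with Cons.prems have R: "R x y \<or> x = y" "R y z \<or> y = z" by (auto simp: ys zs)
    have A: "x \<in> A" "y \<in> A" "z \<in> A" using Cons.prems by (auto simp: ys zs)
    have "R x z" using R A lin_onD(1)[OF assms(1)] lin_onD(2)[OF assms(1) A] by metis
    moreover have "x \<noteq> z" using False R A lin_onD(3)[OF assms(1)] by metis
    ultimately show ?thesis by (simp add: zs)
  qed
qed simp

lemma first_diff_le_antisym:
  assumes "lin_on A R" "set xs \<subseteq> A" "set ys \<subseteq> A" "first_diff_le R xs ys" "first_diff_le R ys xs"
  shows False
  using assms(2-)
proof (induction xs arbitrary: ys)
  case (Cons x xs)
  from Cons.prems obtain y ys' where ys: "ys = y # ys'" by (cases ys) auto
  show ?case
    using Cons lin_onD(3)[OF assms(1), of x y] unfolding ys by auto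
qed simp

lemma first_diff_le_total:
  assumes "lin_on A R" "set xs \<subseteq> A" "set ys \<subseteq> A"
  shows "prefix xs ys \<or> prefix ys xs \<or> first_diff_le R xs ys \<or> first_diff_le R ys xs"
  using assms(2-)
proof (induction xs arbitrary: ys)
  case (Cons x xs)
  show ?case
  proof (cases ys)
    case ys: (Cons y ys')
    then show ?thesis
      using Cons.IH[of ys'] Cons.prems lin_onD(4)[OF assms(1), of x y] by auto
  qed simp
qed simp

lemma first_diff_le_prefix_right: "prefix ys' ys \<Longrightarrow> first_diff_le R xs ys' \<Longrightarrow> first_diff_le R xs ys"
  by (auto simp: first_diff_le_def prefix_def nth_append)

text \<open>The dictionary order in which a prefix comes first. Applied to reversed lists it is the
  order of \<open>LBigOr\<close>, which compares from the end and puts suffixes first.\<close>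

lemma lin_on_prefix_order:
  assumes "lin_on A R"
  shows "lin_on (lists A) (\<lambda>xs ys. prefix xs ys \<or> first_diff_le R xs ys)"
proof (rule lin_onI, goal_cases)
  case (2 xs ys zs)
  then have A: "set xs \<subseteq> A" "set ys \<subseteq> A" "set zs \<subseteq> A" by auto
  have "first_diff_le R xs zs \<or> prefix xs zs" if "prefix ys zs \<or> prefix xs ys"
    using that
  proof
    assume "prefix ys zs"
    with 2(4) show ?thesis
      by (meson first_diff_le_prefix_right prefix_order.trans)
  next
    assume xy: "prefix xs ys"
    show ?thesis
    proof (cases "prefix ys zs")
      case True
      with xy show ?thesis by (meson prefix_order.trans)
    next
      case False
      with 2(5) have "first_diff_le R ys zs" by simp
      then obtain i where i: "i < length ys" "i < length zs" "take i ys = take i zs"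
        "ys ! i \<noteq> zs ! i" "R (ys ! i) (zs ! i)"
        unfolding first_diff_le_def by blast
      from xy obtain us where us: "ys = xs @ us" by (auto simp: prefix_def)
      \<comment> \<open>Here \<open>xs\<close> is a prefix of \<open>ys\<close>. If the first
        difference of \<open>ys\<close> and \<open>zs\<close> lies inside \<open>xs\<close>, it also
        separates \<open>xs\<close> from \<open>zs\<close>; otherwise \<open>zs\<close> still agrees
        with \<open>ys\<close> on the whole of \<open>xs\<close>.\<close>
      show ?thesis
      proof (cases "i < length xs")
        case True
        with i us have "first_diff_le R xs zs"
          unfolding first_diff_le_def by (intro exI[of _ i]) (auto simp: nth_append)
        then show ?thesis ..
      next
        case False
        with us have "xs = take (length xs) (take i ys)" by simp
        also have "\<dots> = take (length xs) zs" using i(3) False by (simp add: min_def)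
        finally show ?thesis by (metis take_is_prefix)
      qed
    qed
  qed
  moreover have "first_diff_le R xs zs" if "first_diff_le R xs ys" "first_diff_le R ys zs"
    using first_diff_le_trans[OF assms A that] .
  ultimately show ?case using 2 by blast
next
  case (3 xs ys)
  then have A: "set xs \<subseteq> A" "set ys \<subseteq> A" by auto
  have *: "\<not> first_diff_le R us vs" if "prefix us vs \<or> prefix vs us" for us vs
    using that by (auto simp: first_diff_le_def prefix_def nth_append)
  show ?case
    using 3(3,4) *[of xs ys] *[of ys xs] first_diff_le_antisym[OF assms A]
    by (auto intro: prefix_order.antisym)
next
  case (4 xs ys)
  then show ?case using first_diff_le_total[OF assms, of xs ys] by auto
qed simp

lemma lin_on_converse: "lin_on A R \<Longrightarrow> lin_on A (\<lambda>x y. R y x)"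
  unfolding lin_on_def reflp_on_def transp_on_def antisymp_on_def totalp_on_def by blast

lemma first_diff_le_converse: "first_diff_le (\<lambda>x y. R y x) ys xs \<longleftrightarrow> first_diff_le R xs ys"
  unfolding first_diff_le_def by metis

text \<open>Conjunctions are ordered with the longer list first. Reversing both the element order
  and the resulting order on lists in \<open>lin_on_prefix_order\<close> gives exactly this
  relation.\<close>

lemma lin_on_revprefix_order:
  assumes "lin_on A R"
  shows "lin_on (lists A) (\<lambda>xs ys. prefix ys xs \<or> first_diff_le R xs ys)"
  using lin_on_converse[OF lin_on_prefix_order[OF lin_on_converse[OF assms]]]
  unfolding first_diff_le_converse[of R] .

section \<open>Embeddings of lists\<close>

text \<open>The matching of disjuncts in subsumption, separated from languages so that its preorder
  and antisymmetry properties can be shown for an arbitrary relation on a carrier.\<close>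

definition emb :: "('a \<Rightarrow> 'a \<Rightarrow> bool) \<Rightarrow> 'a list \<Rightarrow> 'a list \<Rightarrow> bool" where
  "emb R xs ys \<longleftrightarrow> (\<exists>m. inj_on m {..<length xs} \<and> m ` {..<length xs} \<subseteq> {..<length ys} \<and>
     (\<forall>i<length xs. R (xs ! i) (ys ! m i)))"

text \<open>The Smyth preorder on sets. The index map for conjunctions may repeat values, so
  subsumption of conjunctions sees only their sets of conjuncts; order and multiplicity
  disappear.\<close>

definition cover :: "('a \<Rightarrow> 'a \<Rightarrow> bool) \<Rightarrow> 'a set \<Rightarrow> 'a set \<Rightarrow> bool" where
  "cover R F G \<longleftrightarrow> (\<forall>y\<in>G. \<exists>x\<in>F. R x y)"

lemma sub_BigOr: "sub (LBigOr k L) \<phi> \<psi> \<longleftrightarrow>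
    (\<exists>\<phi>s \<psi>s. \<phi> = BigOr \<phi>s \<and> \<psi> = BigOr \<psi>s \<and> emb (sub L) \<phi>s \<psi>s)"
  by (auto simp: emb_def)

lemma sub_BigAnd: "sub (LBigAnd L) \<phi> \<psi> \<longleftrightarrow>
    (\<exists>\<phi>s \<psi>s. \<phi> = BigAnd \<phi>s \<and> \<psi> = BigAnd \<psi>s \<and> cover (sub L) (set \<phi>s) (set \<psi>s))"
proof -
  have "(\<exists>m. m ` {..<length \<psi>s} \<subseteq> {..<length \<phi>s} \<and> (\<forall>i<length \<psi>s. sub L (\<phi>s ! m i) (\<psi>s ! i)))
      \<longleftrightarrow> cover (sub L) (set \<phi>s) (set \<psi>s)" (is "?l \<longleftrightarrow> ?r") for \<phi>s \<psi>s
  proof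
    assume ?l
    then obtain m where "m ` {..<length \<psi>s} \<subseteq> {..<length \<phi>s}"
      "\<forall>i<length \<psi>s. sub L (\<phi>s ! m i) (\<psi>s ! i)" by blast
    then show ?r unfolding cover_def by (metis imageI in_set_conv_nth lessThan_iff subsetD)
  next
    assume ?r
    then have "\<forall>i\<in>{..<length \<psi>s}. \<exists>j. j < length \<phi>s \<and> sub L (\<phi>s ! j) (\<psi>s ! i)"
      unfolding cover_def by (metis in_set_conv_nth lessThan_iff)
    from bchoice[OF this] show ?l by (auto simp: image_subset_iff)
  qed
  then show ?thesis by simp
qed

declare sub.simps(4,5) [simp del]

lemma cover_trans:
  assumes "transp_on A R" "F \<subseteq> A" "G \<subseteq> A" "H \<subseteq> A" "cover R F G" "cover R G H"
  shows "cover R F H"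
  unfolding cover_def
proof
  fix z assume z: "z \<in> H"
  with assms(6) obtain y where y: "y \<in> G" "R y z" unfolding cover_def by blast
  with assms(5) obtain x where "x \<in> F" "R x y" unfolding cover_def by blast
  with y z assms(1-4) show "\<exists>x\<in>F. R x z" by (blast dest: transp_onD)
qed

lemma emb_refl: "reflp_on A R \<Longrightarrow> set xs \<subseteq> A \<Longrightarrow> emb R xs xs"
  unfolding emb_def by (intro exI[of _ id]) (auto simp: reflp_on_def subset_iff)

lemma emb_trans:
  assumes "transp_on A R" "set xs \<subseteq> A" "set ys \<subseteq> A" "set zs \<subseteq> A" "emb R xs ys" "emb R ys zs"
  shows "emb R xs zs"
proof -
  from assms(5) obtain m where m: "inj_on m {..<length xs}" "m ` {..<length xs} \<subseteq> {..<length ys}"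
    "\<forall>i<length xs. R (xs ! i) (ys ! m i)" unfolding emb_def by blast
  from assms(6) obtain m' where m': "inj_on m' {..<length ys}" "m' ` {..<length ys} \<subseteq> {..<length zs}"
    "\<forall>i<length ys. R (ys ! i) (zs ! m' i)" unfolding emb_def by blast
  have "inj_on (m' \<circ> m) {..<length xs}"
    using m(1) inj_on_subset[OF m'(1) m(2)] by (rule comp_inj_on)
  moreover have "(m' \<circ> m) ` {..<length xs} \<subseteq> {..<length zs}" using m(2) m'(2) by auto
  moreover have "R (xs ! i) (zs ! (m' \<circ> m) i)" if "i < length xs" for i
  proof -
    have "m i < length ys" using m(2) that by auto
    moreover from this have "m' (m i) < length zs" using m'(2) by auto
    ultimately show ?thesis
      using transp_onD[OF assms(1), of "xs ! i" "ys ! m i" "zs ! m' (m i)"] that m(3) m'(3) assms(2-4)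
      by (auto simp: subset_iff)
  qed
  ultimately show ?thesis unfolding emb_def by blast
qed

text \<open>The permutation relating the two lists serves as the index map. Consequently sorting a
  disjunction does not leave its class under mutual subsumption.\<close>

lemma emb_mset:
  assumes "reflp_on A R" "set xs \<subseteq> A" "mset xs = mset ys"
  shows "emb R xs ys"
proof -
  obtain p where p: "p permutes {..<length ys}" "permute_list p ys = xs"
    using assms(3) by (rule mset_eq_permutation)
  have len: "length xs = length ys" using p by auto
  have "xs ! i = ys ! p i" if "i < length xs" for i
    using permute_list_nth[OF p(1)] p(2) that len by simp
  then have "\<forall>i<length xs. R (xs ! i) (ys ! p i)"
    using assms(1,2) by (metis nth_mem reflp_onD subsetD)
  then show ?thesis
    unfolding emb_def using p(1) len permutes_inj_on[OF p(1)] permutes_image[OF p(1)]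
    by (intro exI[of _ p]) auto
qed

lemma emb_map:
  assumes "list_all2 R xs ys" shows "emb R xs ys"
  unfolding emb_def using assms
  by (intro exI[of _ id]) (auto simp: list_all2_conv_all_nth)

lemma permutes_finite_order:
  assumes "finite A" "p permutes A"
  obtains n where "p ^^ n = id" "n > 0"
  using assms permutation_is_nilpotent[of p] unfolding permutation_permutes by blast

text \<open>The composite of the two injections permutes the indices. The sequence
  \<open>xs ! i\<close>, \<open>ys ! m i\<close>, \<open>xs ! \<sigma> i\<close>, and so on only
  moves upwards, yet returns to \<open>xs ! i\<close> because a permutation of a finite set has
  finite order. So \<open>m\<close> is a bijection that matches equal entries.\<close>

lemma emb_antisym:
  assumes refl: "reflp_on A R" and tr: "transp_on A R" and anti: "antisymp_on A R"
    and A: "set xs \<subseteq> A" "set ys \<subseteq> A" and emb: "emb R xs ys" "emb R ys xs"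
  shows "mset xs = mset ys"
proof -
  from emb(1) obtain m where m: "inj_on m {..<length xs}" "m ` {..<length xs} \<subseteq> {..<length ys}"
    "\<forall>i<length xs. R (xs ! i) (ys ! m i)" unfolding emb_def by blast
  from emb(2) obtain m' where m': "inj_on m' {..<length ys}" "m' ` {..<length ys} \<subseteq> {..<length xs}"
    "\<forall>i<length ys. R (ys ! i) (xs ! m' i)" unfolding emb_def by blast
  have len: "length xs = length ys"
    using card_inj_on_le[OF m(1,2)] card_inj_on_le[OF m'(1,2)] by simp
  let ?I = "{..<length xs}"
  \<comment> \<open>Extended by the identity beyond the indices, as \<open>permutes\<close>
    demands.\<close>
  define \<sigma> where "\<sigma> i = (if i \<in> ?I then m' (m i) else i)" for i
  have inj: "inj_on (m' \<circ> m) ?I"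
    using m(1) inj_on_subset[OF m'(1) m(2)] by (rule comp_inj_on)
  have "(m' \<circ> m) ` ?I \<subseteq> ?I" using m(2) m'(2) by auto
  then have "bij_betw (m' \<circ> m) ?I ?I"
    using inj endo_inj_surj[OF _ _ inj] by (simp add: bij_betw_def)
  then have "bij_betw \<sigma> ?I ?I"
    by (rule bij_betw_cong[THEN iffD1, rotated]) (simp add: \<sigma>_def)
  then have perm: "\<sigma> permutes ?I" by (rule bij_imp_permutes) (simp add: \<sigma>_def)
  obtain n where n: "\<sigma> ^^ n = id" "n > 0" using permutes_finite_order[OF _ perm] by blast
  have mi: "m i < length ys" if "i < length xs" for i using m(2) that by auto
  have \<sigma>i: "(\<sigma> ^^ j) i < length xs" if "i < length xs" for i j
    using that permutes_in_image[OF permutes_funpow[OF perm], of j i] by simp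
  have step: "R (ys ! m i) (xs ! \<sigma> i)" if "i < length xs" for i
    using m'(3) mi[OF that] that by (simp add: \<sigma>_def)
  have xA: "xs ! i \<in> A" "ys ! m i \<in> A" if "i < length xs" for i
    using A that mi[OF that] by (auto simp: subset_iff)
  have chain: "R (xs ! \<sigma> i) (xs ! (\<sigma> ^^ Suc j) i)" if i: "i < length xs" for i j
  proof (induction j)
    case 0
    show ?case using reflp_onD[OF refl] xA(1)[OF \<sigma>i[OF i, of 1]] by simp
  next
    case (Suc j)
    let ?k = "(\<sigma> ^^ Suc j) i"
    have k: "?k < length xs" "\<sigma> ?k < length xs" "\<sigma> i < length xs"
      using \<sigma>i[OF i, of "Suc j"] \<sigma>i[OF i, of "Suc (Suc j)"] \<sigma>i[OF i, of 1] by auto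
    have "R (xs ! ?k) (xs ! \<sigma> ?k)"
      using transp_onD[OF tr _ _ _ m(3)[rule_format, OF k(1)] step[OF k(1)]] xA k by blast
    with Suc have "R (xs ! \<sigma> i) (xs ! \<sigma> ?k)"
      using transp_onD[OF tr] xA k by blast
    then show ?case by simp
  qed
  have eq: "xs ! i = ys ! m i" if i: "i < length xs" for i
  proof -
    have k: "\<sigma> i < length xs" using \<sigma>i[OF i, of 1] by simp
    \<comment> \<open>As \<open>n\<close> is positive, \<open>Suc (n - 1)\<close> is
      \<open>n\<close>, and the chain that starts at \<open>\<sigma> i\<close> closes up at
      \<open>i\<close>.\<close>
    have "R (xs ! \<sigma> i) (xs ! i)" using chain[OF i, of "n - 1"] n by simp
    with step[OF i] have "R (ys ! m i) (xs ! i)"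
      using transp_onD[OF tr] xA[OF i] xA[OF k] by blast
    with m(3) i xA[OF i] show ?thesis using antisymp_onD[OF anti] by blast
  qed
  have "m ` ?I = {..<length ys}"
    using m(1,2) len by (intro card_subset_eq) (auto simp: card_image)
  then have "mset_set {..<length ys} = image_mset m (mset_set ?I)"
    using m(1) by (simp add: image_mset_mset_set)
  moreover have "mset zs = image_mset ((!) zs) (mset_set {..<length zs})" for zs :: "'a list"
    by (metis map_nth mset_map mset_upt atLeast0LessThan)
  ultimately have "mset ys = image_mset (\<lambda>i. ys ! m i) (mset_set ?I)"
    by (simp add: multiset.map_comp comp_def)
  also have "\<dots> = image_mset ((!) xs) (mset_set ?I)"
    using eq by (intro image_mset_cong) simp
  also have "\<dots> = mset xs"
    by (metis map_nth mset_map mset_upt atLeast0LessThan)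
  finally show ?thesis by simp
qed

text \<open>An \<open>x\<close> in \<open>F\<close> has some \<open>y\<close> of \<open>G\<close>
  below it, and \<open>y\<close> has some \<open>z\<close> of \<open>F\<close> below it. Minimality
  of \<open>x\<close> in \<open>F\<close> reverses this, so \<open>x\<close> and \<open>y\<close>
  lie below each other and coincide. Reducing conjunctions to their minimal conjuncts is what makes
  this available.\<close>

lemma cover_antisym:
  assumes "transp_on A R" "antisymp_on A R" "F \<subseteq> A" "G \<subseteq> A"
    and F: "minimals R F = F" and G: "minimals R G = G" and "cover R F G" "cover R G F"
  shows "F = G"
proof -
  have "F \<subseteq> G" if "F \<subseteq> A" "G \<subseteq> A" "minimals R F = F" "cover R F G" "cover R G F" for F G
  proof
    fix x assume x: "x \<in> F"
    with that(5) obtain y where y: "y \<in> G" "R y x" unfolding cover_def by blast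
    with that(4) obtain z where z: "z \<in> F" "R z y" unfolding cover_def by blast
    have A: "x \<in> A" "y \<in> A" "z \<in> A" using that(1,2) x y z by auto
    have "R z x" using transp_onD[OF assms(1)] A y z by blast
    with x z that(3) have "R x z" by (auto simp: minimals_def)
    with z have "R x y" using transp_onD[OF assms(1)] A by blast
    with y A have "x = y" using antisymp_onD[OF assms(2)] by blast
    with y show "x \<in> G" by simp
  qed
  from this[of F G] this[of G F] assms show ?thesis by blast
qed

section \<open>Renaming of languages\<close>

definition lang_vars :: "('f, 'p, 'v) lang \<Rightarrow> 'v set" where
  "lang_vars L = (\<Union>\<phi>\<in>fms L. fv \<phi>)"

text \<open>
  The permutations that matter are those of the quantified sets, but below a quantifier
  they turn into functions of the form \<^term>\<open>shield X \<pi>\<close>, which are in general not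
  permutations. They remain injective on the variables that can occur.
\<close>

definition renaming :: "'v set \<Rightarrow> ('f, 'p, 'v) lang \<Rightarrow> ('v \<Rightarrow> 'v) \<Rightarrow> bool" where
  "renaming V L \<pi> \<longleftrightarrow>
     (\<forall>\<phi>\<in>fms L. capture_free \<pi> \<phi>) \<and> inj_on \<pi> (lang_vars L) \<and> \<pi> ` lang_vars L \<subseteq> V"

lemma bottom_in_fms: "bottom L \<in> fms L"
  by (induction L) auto

lemma fms_nonempty: "\<exists>\<phi>. \<phi> \<in> fms L"
  using bottom_in_fms by blast

text \<open>No language is empty, so each side of a binary connective contributes all its variables.
  For \<open>k = 0\<close> the only disjunction is \<open>BigOr []\<close>, whence the exceptional
  case.\<close>

lemma lang_vars_simps:
  "lang_vars (LBase A r) = (\<Union>\<phi>\<in>A. fv \<phi>)"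
  "lang_vars (LOr L1 L2) = lang_vars L1 \<union> lang_vars L2"
  "lang_vars (LAnd L1 L2) = lang_vars L1 \<union> lang_vars L2"
  "lang_vars (LBigOr k L) = (if k = 0 then {} else lang_vars L)"
  "lang_vars (LBigAnd L) = lang_vars L"
  "lang_vars (LEx X L) = lang_vars L - X"
  "lang_vars (LAll X L) = lang_vars L - X"
  "lang_vars (LExAll X L) = lang_vars L - X"
proof -
  show "lang_vars (LOr L1 L2) = lang_vars L1 \<union> lang_vars L2"
    using fms_nonempty[of L1] fms_nonempty[of L2] by (fastforce simp: lang_vars_def)
  show "lang_vars (LAnd L1 L2) = lang_vars L1 \<union> lang_vars L2"
    using fms_nonempty[of L1] fms_nonempty[of L2] by (fastforce simp: lang_vars_def)
  have "x \<in> lang_vars (LBigOr k L)" if "0 < k" "x \<in> lang_vars L" for x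
  proof -
    from that(2) obtain \<phi> where "\<phi> \<in> fms L" "x \<in> fv \<phi>" by (auto simp: lang_vars_def)
    with that(1) have "BigOr [\<phi>] \<in> fms (LBigOr k L)" "x \<in> fv (BigOr [\<phi>])" by auto
    then show ?thesis unfolding lang_vars_def by blast
  qed
  moreover have "lang_vars (LBigOr k L) \<subseteq> lang_vars L" "k = 0 \<Longrightarrow> lang_vars (LBigOr k L) = {}"
    by (fastforce simp: lang_vars_def)+
  ultimately show "lang_vars (LBigOr k L) = (if k = 0 then {} else lang_vars L)"
    by auto
  have "x \<in> lang_vars (LBigAnd L)" if "x \<in> lang_vars L" for x
  proof -
    from that obtain \<phi> where "\<phi> \<in> fms L" "x \<in> fv \<phi>" by (auto simp: lang_vars_def)
    then have "BigAnd [\<phi>] \<in> fms (LBigAnd L)" "x \<in> fv (BigAnd [\<phi>])" by auto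
    then show ?thesis unfolding lang_vars_def by blast
  qed
  moreover have "lang_vars (LBigAnd L) \<subseteq> lang_vars L"
    by (fastforce simp: lang_vars_def)
  ultimately show "lang_vars (LBigAnd L) = lang_vars L"
    by auto
qed (fastforce simp: lang_vars_def)+

lemma lang_vars_subset: "bounded_lang S V L \<Longrightarrow> lang_vars L \<subseteq> V"
  by (induction L) (auto simp: lang_vars_simps split: if_splits)

lemma finite_lang_vars: "bounded_lang S V L \<Longrightarrow> finite (lang_vars L)"
  by (induction L) (auto simp: lang_vars_simps finite_fv)

lemma renaming_capture_free: "renaming V L \<pi> \<Longrightarrow> \<phi> \<in> fms L \<Longrightarrow> capture_free \<pi> \<phi>"
  by (simp add: renaming_def)

lemma fv_subset_lang_vars: "\<phi> \<in> fms L \<Longrightarrow> fv \<phi> \<subseteq> lang_vars L"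
  by (auto simp: lang_vars_def)

lemma renaming_mono:
  assumes "renaming V L' \<pi>" "\<And>\<phi>. \<phi> \<in> fms L \<Longrightarrow> capture_free \<pi> \<phi>" "lang_vars L \<subseteq> lang_vars L'"
  shows "renaming V L \<pi>"
  using assms unfolding renaming_def by (blast intro: inj_on_subset)

lemma renaming_LOrD:
  assumes "renaming V (LOr L1 L2) \<pi>" shows "renaming V L1 \<pi>" "renaming V L2 \<pi>"
proof -
  have "capture_free \<pi> (Or \<phi>1 \<phi>2)" if "\<phi>1 \<in> fms L1" "\<phi>2 \<in> fms L2" for \<phi>1 \<phi>2
    by (rule renaming_capture_free[OF assms]) (use that in simp)
  then show "renaming V L1 \<pi>" "renaming V L2 \<pi>"
    using fms_nonempty[of L1] fms_nonempty[of L2]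
    by (auto intro!: renaming_mono[OF assms] simp: lang_vars_simps)
qed

lemma renaming_LAndD:
  assumes "renaming V (LAnd L1 L2) \<pi>" shows "renaming V L1 \<pi>" "renaming V L2 \<pi>"
proof -
  have "capture_free \<pi> (And \<phi>1 \<phi>2)" if "\<phi>1 \<in> fms L1" "\<phi>2 \<in> fms L2" for \<phi>1 \<phi>2
    by (rule renaming_capture_free[OF assms]) (use that in simp)
  then show "renaming V L1 \<pi>" "renaming V L2 \<pi>"
    using fms_nonempty[of L1] fms_nonempty[of L2]
    by (auto intro!: renaming_mono[OF assms] simp: lang_vars_simps)
qed

lemma renaming_LBigOrD:
  assumes "renaming V (LBigOr k L) \<pi>" "k > 0" shows "renaming V L \<pi>"
proof (rule renaming_mono[OF assms(1)])
  fix \<phi> assume "\<phi> \<in> fms L"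
  then show "capture_free \<pi> \<phi>"
    using renaming_capture_free[OF assms(1), of "BigOr [\<phi>]"] assms(2) by simp
qed (use assms(2) in \<open>simp add: lang_vars_simps\<close>)

lemma renaming_LBigAndD:
  assumes "renaming V (LBigAnd L) \<pi>" shows "renaming V L \<pi>"
proof (rule renaming_mono[OF assms(1)])
  fix \<phi> assume "\<phi> \<in> fms L"
  then show "capture_free \<pi> \<phi>"
    using renaming_capture_free[OF assms(1), of "BigAnd [\<phi>]"] by simp
qed (simp add: lang_vars_simps)

lemma renaming_LAll_iff: "renaming V (LAll X L) \<pi> \<longleftrightarrow> renaming V (LEx X L) \<pi>"
  by (fastforce simp: renaming_def lang_vars_simps)

lemma renaming_LExAll_iff: "renaming V (LExAll X L) \<pi> \<longleftrightarrow> renaming V (LEx X L) \<pi>"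
  by (fastforce simp: renaming_def lang_vars_simps)

text \<open>Absence of capture says that variables outside \<open>X\<close> that occur in the body
  are sent outside \<open>X\<close>. Since the shielded map fixes \<open>X\<close>, the values on
  the two parts cannot collide and injectivity survives.\<close>

lemma renaming_LExD:
  assumes "renaming V (LEx X L) \<pi>" "X \<subseteq> V"
  shows "renaming V L (shield X \<pi>)"
    and "x \<in> lang_vars L \<Longrightarrow> x \<notin> X \<Longrightarrow> \<pi> x \<notin> X"
proof -
  have cf: "capture_free \<pi> (Ex X \<phi>)" if "\<phi> \<in> fms L" for \<phi>
    using assms(1) that by (auto simp: renaming_def)
  show *: "\<pi> x \<notin> X" if "x \<in> lang_vars L" "x \<notin> X" for x
    using that cf by (auto simp: lang_vars_def)
  have "inj_on (shield X \<pi>) (lang_vars L)"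
    using assms(1) * by (auto simp: renaming_def lang_vars_simps inj_on_def shield_def)
  moreover have "shield X \<pi> ` lang_vars L \<subseteq> V"
    using assms by (auto simp: renaming_def lang_vars_simps shield_def)
  ultimately show "renaming V L (shield X \<pi>)"
    using cf by (auto simp: renaming_def)
qed

text \<open>The entry point for renamings: permutations of the quantified set act on the body of the
  quantifier. Capture-freeness is the side condition that \<open>bounded_lang\<close> places on
  quantifiers.\<close>

lemma renaming_permutes:
  assumes "bounded_lang S V (LEx X L)" "\<pi> permutes X"
  shows "renaming V L \<pi>"
proof -
  from assms(1) have X: "X \<subseteq> V" and L: "bounded_lang S V L"
    and cf: "\<forall>\<phi>\<in>fms L. \<forall>\<pi>. \<pi> permutes X \<longrightarrow> capture_free \<pi> \<phi>" by auto
  have "\<pi> ` V = V" using permutes_image[OF permutes_subset[OF assms(2) X]] .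
  then have "\<pi> ` lang_vars L \<subseteq> V" using lang_vars_subset[OF L] by blast
  with cf assms(2) show ?thesis
    by (auto simp: renaming_def permutes_inj_on)
qed

text \<open>Inside the finite union of \<open>F\<close> and its image, the parts missed by
  \<open>F\<close> and by the image have equal size. A bijection between them completes
  \<open>\<pi>\<close> to a permutation of this union, which is the identity elsewhere.\<close>

lemma extend_to_permutation:
  assumes "finite F" "F \<subseteq> V" "inj_on \<pi> F" "\<pi> ` F \<subseteq> V"
  shows "\<exists>\<sigma>. \<sigma> permutes V \<and> (\<forall>x\<in>F. \<sigma> x = \<pi> x)"
proof -
  let ?U = "F \<union> \<pi> ` F"
  have "card (?U - F) = card (?U - \<pi> ` F)"
    using assms(1,3) by (simp add: card_Diff_subset card_image)
  then obtain g where g: "bij_betw g (?U - F) (?U - \<pi> ` F)"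
    using assms(1) by (metis finite_Diff finite_Un finite_imageI finite_same_card_bij)
  define \<sigma> where "\<sigma> x = (if x \<in> F then \<pi> x else if x \<in> ?U then g x else x)" for x
  have "bij_betw \<sigma> F (\<pi> ` F)"
    using assms(3) by (auto simp: bij_betw_def \<sigma>_def inj_on_def)
  moreover have "bij_betw \<sigma> (?U - F) (?U - \<pi> ` F)"
    by (rule bij_betw_cong[THEN iffD1, OF _ g]) (auto simp: \<sigma>_def)
  ultimately have "bij_betw \<sigma> (F \<union> (?U - F)) (\<pi> ` F \<union> (?U - \<pi> ` F))"
    by (rule bij_betw_combine) auto
  then have "bij_betw \<sigma> ?U ?U" by (simp add: Un_absorb1 sup_commute Un_left_commute)
  then have "\<sigma> permutes ?U" by (rule bij_imp_permutes) (simp add: \<sigma>_def)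
  then have "\<sigma> permutes V" by (rule permutes_subset) (use assms in auto)
  then show ?thesis by (intro exI[of _ \<sigma>]) (simp add: \<sigma>_def)
qed

text \<open>Closure of a base language is assumed for permutations of \<open>V\<close>, whereas the
  induction hands down shielded maps. Since only finitely many variables occur, such a map can be
  replaced by a permutation of \<open>V\<close> that agrees with it on them.\<close>

lemma subst_in_fms:
  "bounded_lang S V L \<Longrightarrow> renaming V L \<pi> \<Longrightarrow> \<phi> \<in> fms L \<Longrightarrow> subst \<pi> \<phi> \<in> fms L"
proof (induction L arbitrary: \<pi> \<phi>)
  case (LBase A r)
  show ?case
  proof (cases "\<phi> = Bot")
    case False
    with LBase.prems have \<phi>: "\<phi> \<in> A" by simp
    obtain \<sigma> where \<sigma>: "\<sigma> permutes V" "\<forall>x\<in>lang_vars (LBase A r). \<sigma> x = \<pi> x"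
      using extend_to_permutation[of "lang_vars (LBase A r)" V \<pi>] LBase.prems
        finite_lang_vars[of S V "LBase A r"] lang_vars_subset[of S V "LBase A r"]
      unfolding renaming_def by blast
    have "subst \<sigma> \<phi> = subst \<pi> \<phi>"
      using fv_subset_lang_vars[OF LBase.prems(3)] \<sigma>(2) by (intro subst_cong) auto
    moreover have "subst \<sigma> \<phi> \<in> A" using \<phi> \<sigma>(1) LBase.prems(1) by (simp add: perm_closed_def)
    ultimately show ?thesis by simp
  qed simp
next
  case (LOr L1 L2)
  then show ?case using renaming_LOrD[OF LOr.prems(2)] by auto
next
  case (LAnd L1 L2)
  then show ?case using renaming_LAndD[OF LAnd.prems(2)] by auto
next
  case (LBigOr k L)
  then show ?case using renaming_LBigOrD[OF LBigOr.prems(2)]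
    by (cases "k = 0") (auto simp: subset_iff)
next
  case (LBigAnd L)
  then show ?case using renaming_LBigAndD[OF LBigAnd.prems(2)] by (auto simp: subset_iff)
next
  case (LEx X L)
  then show ?case using renaming_LExD(1)[OF LEx.prems(2)] by auto
next
  case (LAll X L)
  then show ?case using renaming_LExD(1)[OF LAll.prems(2)[unfolded renaming_LAll_iff]] by auto
next
  case (LExAll X L)
  then show ?case using renaming_LExD(1)[OF LExAll.prems(2)[unfolded renaming_LExAll_iff]] by auto
qed

lemma subst_permutes_in_fms:
  "bounded_lang S V (LEx X L) \<Longrightarrow> \<pi> permutes X \<Longrightarrow> \<phi> \<in> fms L \<Longrightarrow> subst \<pi> \<phi> \<in> fms L"
  using subst_in_fms[of S V L, OF _ renaming_permutes] by simp

lemma subst_comp_permutes: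
  assumes "bounded_lang S V (LEx X L)" "\<sigma> permutes X" "\<phi> \<in> fms L"
  shows "subst \<pi> (subst \<sigma> \<phi>) = subst (\<pi> \<circ> \<sigma>) \<phi>"
  using renaming_capture_free[OF renaming_permutes[OF assms(1,2)] assms(3)] by (rule subst_comp)

section \<open>Subsumption\<close>

text \<open>The comparison of bodies common to the three quantifier languages, so that the arguments
  about permuted bound variables are made once.\<close>

definition bsub ::
  "'v set \<Rightarrow> ('f, 'p, 'v) lang \<Rightarrow> ('f, 'p, 'v) fm \<Rightarrow> ('f, 'p, 'v) fm \<Rightarrow> bool" where
  "bsub X L \<phi> \<psi> \<longleftrightarrow> (\<exists>\<pi>. \<pi> permutes X \<and> sub L \<phi> (subst \<pi> \<psi>))"

lemma sub_quantifier:
  "sub (LEx X L) \<phi> \<psi> \<longleftrightarrow> (\<exists>\<phi>' \<psi>'. \<phi> = Ex X \<phi>' \<and> \<psi> = Ex X \<psi>' \<and> bsub X L \<phi>' \<psi>')"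
  "sub (LAll X L) \<phi> \<psi> \<longleftrightarrow> (\<exists>\<phi>' \<psi>'. \<phi> = All X \<phi>' \<and> \<psi> = All X \<psi>' \<and> bsub X L \<phi>' \<psi>')"
  "sub (LExAll X L) \<phi> \<psi> \<longleftrightarrow>
     (\<exists>\<phi>' \<psi>'. (\<phi> = Ex X \<phi>' \<and> \<psi> = Ex X \<psi>' \<or> \<phi> = All X \<phi>' \<and> \<psi> = All X \<psi>' \<or>
        \<phi> = All X \<phi>' \<and> \<psi> = Ex X \<psi>') \<and> bsub X L \<phi>' \<psi>')"
  by (auto simp: bsub_def)

declare sub.simps(6-8) [simp del]

lemma sub_imp_bsub: "sub L \<phi> \<psi> \<Longrightarrow> bsub X L \<phi> \<psi>"
  unfolding bsub_def by (intro exI[of _ id]) (simp add: permutes_id)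

lemma sub_refl: "\<phi> \<in> fms L \<Longrightarrow> sub L \<phi> \<phi>"
proof (induction L arbitrary: \<phi>)
  case (LBigOr k L)
  then have "reflp_on (fms L) (sub L)" by (auto intro: reflp_onI)
  with LBigOr.prems show ?case by (auto simp: sub_BigOr intro: emb_refl)
next
  case (LBigAnd L)
  then show ?case by (auto simp: sub_BigAnd cover_def subset_iff intro!: bexI)
qed (auto simp: sub_quantifier intro: sub_imp_bsub)

lemma reflp_sub: "reflp_on (fms L) (sub L)"
  by (auto intro: reflp_onI sub_refl)

text \<open>The permutation \<open>\<sigma>\<close> moves only variables of \<open>X\<close>, which
  the shielded map fixes, and the shielded map sends the other occurring variables outside
  \<open>X\<close>, where \<open>\<sigma>\<close> is the identity. The two therefore commute on the
  variables of the body.\<close>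

lemma bsub_subst:
  assumes L: "bounded_lang S V (LEx X L)" and \<pi>: "renaming V (LEx X L) \<pi>"
    and fms: "\<phi> \<in> fms L" "\<psi> \<in> fms L"
    and IH: "\<And>\<pi> \<phi> \<psi>. renaming V L \<pi> \<Longrightarrow> \<phi> \<in> fms L \<Longrightarrow> \<psi> \<in> fms L \<Longrightarrow> sub L \<phi> \<psi> \<Longrightarrow>
      sub L (subst \<pi> \<phi>) (subst \<pi> \<psi>)"
    and "bsub X L \<phi> \<psi>"
  shows "bsub X L (subst (shield X \<pi>) \<phi>) (subst (shield X \<pi>) \<psi>)"
proof -
  let ?\<pi> = "shield X \<pi>"
  obtain \<sigma> where \<sigma>: "\<sigma> permutes X" "sub L \<phi> (subst \<sigma> \<psi>)" using assms(6) by (auto simp: bsub_def)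
  have X: "X \<subseteq> V" using L by simp
  note ren = renaming_LExD[OF \<pi> X]
  have "subst ?\<pi> (subst \<sigma> \<psi>) = subst (?\<pi> \<circ> \<sigma>) \<psi>"
    by (rule subst_comp_permutes[OF L \<sigma>(1) fms(2)])
  also have "\<dots> = subst (\<sigma> \<circ> ?\<pi>) \<psi>"
  proof (rule subst_cong)
    fix x assume "x \<in> fv \<psi>"
    then have x: "x \<in> lang_vars L" using fv_subset_lang_vars[OF fms(2)] by blast
    show "(?\<pi> \<circ> \<sigma>) x = (\<sigma> \<circ> ?\<pi>) x"
      using ren(2)[OF x] \<sigma>(1) permutes_in_image[OF \<sigma>(1), of x]
      by (auto simp: shield_def permutes_not_in)
  qed
  also have "\<dots> = subst \<sigma> (subst ?\<pi> \<psi>)"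
    using renaming_capture_free[OF ren(1) fms(2)] by (simp add: subst_comp)
  finally have "sub L (subst ?\<pi> \<phi>) (subst \<sigma> (subst ?\<pi> \<psi>))"
    using IH[OF ren(1) fms(1) subst_permutes_in_fms[OF L \<sigma>(1) fms(2)] \<sigma>(2)] by simp
  with \<sigma>(1) show ?thesis by (auto simp: bsub_def)
qed

text \<open>Needed wherever subsumptions under a quantifier are chained, because the permutation
  from one link has to be applied to both sides of the next. In the base case \<open>Bot\<close> is
  unaffected by renaming.\<close>

lemma sub_subst:
  "bounded_lang S V L \<Longrightarrow> renaming V L \<pi> \<Longrightarrow> \<phi> \<in> fms L \<Longrightarrow> \<psi> \<in> fms L \<Longrightarrow> sub L \<phi> \<psi> \<Longrightarrow>
    sub L (subst \<pi> \<phi>) (subst \<pi> \<psi>)"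
proof (induction L arbitrary: \<pi> \<phi> \<psi>)
  case (LBase A r)
  then show ?case by auto
next
  case (LOr L1 L2)
  then show ?case using renaming_LOrD[OF LOr.prems(2)] by auto
next
  case (LAnd L1 L2)
  then show ?case using renaming_LAndD[OF LAnd.prems(2)] by auto
next
  case (LBigOr k L)
  from LBigOr.prems obtain \<phi>s \<psi>s m where eqs: "\<phi> = BigOr \<phi>s" "\<psi> = BigOr \<psi>s"
    and m: "inj_on m {..<length \<phi>s}" "m ` {..<length \<phi>s} \<subseteq> {..<length \<psi>s}"
      "\<forall>i<length \<phi>s. sub L (\<phi>s ! i) (\<psi>s ! m i)"
    and sub: "set \<phi>s \<subseteq> fms L" "set \<psi>s \<subseteq> fms L" "length \<phi>s \<le> k"
    by (auto simp: sub_BigOr emb_def)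
  have "sub L (subst \<pi> (\<phi>s ! i)) (subst \<pi> (\<psi>s ! m i))" if i: "i < length \<phi>s" for i
  proof (rule LBigOr.IH)
    have "m i < length \<psi>s" using m(2) i by auto
    then show "\<psi>s ! m i \<in> fms L" using sub(2) by (auto simp: subset_iff)
    show "renaming V L \<pi>" using renaming_LBigOrD[OF LBigOr.prems(2)] sub(3) i by simp
  qed (use i m sub LBigOr.prems in \<open>auto simp: subset_iff\<close>)
  moreover have "m i < length \<psi>s" if "i < length \<phi>s" for i using m(2) that by auto
  ultimately have "emb (sub L) (map (subst \<pi>) \<phi>s) (map (subst \<pi>) \<psi>s)"
    unfolding emb_def using m(1,2) by (intro exI[of _ m]) auto
  then show ?case by (simp add: eqs sub_BigOr)
next
  case (LBigAnd L)
  from LBigAnd.prems(3-5) obtain \<phi>s \<psi>s where eqs: "\<phi> = BigAnd \<phi>s" "\<psi> = BigAnd \<psi>s"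
    and sub: "set \<phi>s \<subseteq> fms L" "set \<psi>s \<subseteq> fms L" "cover (sub L) (set \<phi>s) (set \<psi>s)"
    by (auto simp: sub_BigAnd)
  have "cover (sub L) (subst \<pi> ` set \<phi>s) (subst \<pi> ` set \<psi>s)"
    unfolding cover_def
  proof
    fix y assume "y \<in> subst \<pi> ` set \<psi>s"
    then obtain \<psi>' where \<psi>': "y = subst \<pi> \<psi>'" "\<psi>' \<in> set \<psi>s" by auto
    with sub(3) obtain \<phi>' where \<phi>': "\<phi>' \<in> set \<phi>s" "sub L \<phi>' \<psi>'" unfolding cover_def by blast
    have "sub L (subst \<pi> \<phi>') y"
      unfolding \<psi>'(1) using LBigAnd.prems(1) renaming_LBigAndD[OF LBigAnd.prems(2)] \<phi>' \<psi>'(2) sub(1,2)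
      by (intro LBigAnd.IH) auto
    with \<phi>'(1) show "\<exists>x\<in>subst \<pi> ` set \<phi>s. sub L x y" by blast
  qed
  then show ?case by (simp add: eqs sub_BigAnd)
next
  case (LEx X L)
  have L: "bounded_lang S V (LEx X L)" "bounded_lang S V L" using LEx.prems(1) by auto
  note * = bsub_subst[OF L(1) LEx.prems(2) _ _ LEx.IH[OF L(2)]]
  from LEx.prems(3-5) * show ?case by (auto simp: sub_quantifier)
next
  case (LAll X L)
  have L: "bounded_lang S V (LEx X L)" "bounded_lang S V L" using LAll.prems(1) by auto
  note * = bsub_subst[OF L(1) LAll.prems(2)[unfolded renaming_LAll_iff] _ _ LAll.IH[OF L(2)]]
  from LAll.prems(3-5) * show ?case by (auto simp: sub_quantifier)
next
  case (LExAll X L)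
  have L: "bounded_lang S V (LEx X L)" "bounded_lang S V L" using LExAll.prems(1) by auto
  note * = bsub_subst[OF L(1) LExAll.prems(2)[unfolded renaming_LExAll_iff] _ _ LExAll.IH[OF L(2)]]
  from LExAll.prems(3-5) * show ?case by (auto simp: sub_quantifier)
qed

lemma sub_subst_permutes:
  assumes "bounded_lang S V (LEx X L)" "\<pi> permutes X" "\<phi> \<in> fms L" "\<psi> \<in> fms L" "sub L \<phi> \<psi>"
  shows "sub L (subst \<pi> \<phi>) (subst \<pi> \<psi>)"
  using sub_subst[of S V L, OF _ renaming_permutes[OF assms(1,2)] assms(3-5)] assms(1) by simp

text \<open>Applying \<open>\<pi>\<close> to the second subsumption puts the permuted
  \<open>\<psi>\<close> between \<open>\<phi>\<close> and \<open>\<chi>\<close> under the composed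
  permutation.\<close>

lemma bsub_trans:
  assumes L: "bounded_lang S V (LEx X L)" and fms: "\<phi> \<in> fms L" "\<psi> \<in> fms L" "\<chi> \<in> fms L"
    and tr: "transp_on (fms L) (sub L)" and sub: "bsub X L \<phi> \<psi>" "bsub X L \<psi> \<chi>"
  shows "bsub X L \<phi> \<chi>"
proof -
  obtain \<pi> where \<pi>: "\<pi> permutes X" "sub L \<phi> (subst \<pi> \<psi>)" using sub(1) by (auto simp: bsub_def)
  obtain \<sigma> where \<sigma>: "\<sigma> permutes X" "sub L \<psi> (subst \<sigma> \<chi>)" using sub(2) by (auto simp: bsub_def)
  note in_fms = subst_permutes_in_fms[OF L]
  have "sub L (subst \<pi> \<psi>) (subst \<pi> (subst \<sigma> \<chi>))"
    by (intro sub_subst_permutes[OF L \<pi>(1)] fms in_fms \<sigma>)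
  then have "sub L \<phi> (subst \<pi> (subst \<sigma> \<chi>))"
    by (intro transp_onD[OF tr _ _ _ \<pi>(2)] fms in_fms \<sigma> \<pi>(1))
  then show ?thesis
    unfolding bsub_def subst_comp_permutes[OF L \<sigma>(1) fms(3)]
    using permutes_compose[OF \<sigma>(1) \<pi>(1)] by blast
qed

lemma transp_sub: "bounded_lang S V L \<Longrightarrow> transp_on (fms L) (sub L)"
proof (induction L)
  case (LBase A r)
  then show ?case by (auto intro!: transp_onI)
next
  case (LOr L1 L2)
  then show ?case by (fastforce intro!: transp_onI dest: transp_onD)
next
  case (LAnd L1 L2)
  then show ?case by (fastforce intro!: transp_onI dest: transp_onD)
next
  case (LBigOr k L)
  then have tr: "transp_on (fms L) (sub L)" by simp
  show ?case by (rule transp_onI) (auto simp: sub_BigOr intro: emb_trans[OF tr])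
next
  case (LBigAnd L)
  then have tr: "transp_on (fms L) (sub L)" by simp
  show ?case by (rule transp_onI) (auto simp: sub_BigAnd intro: cover_trans[OF tr])
next
  case (LEx X L)
  then have tr: "transp_on (fms L) (sub L)" by simp
  show ?case by (rule transp_onI) (auto simp: sub_quantifier intro: bsub_trans[OF LEx.prems _ _ _ tr])
next
  case (LAll X L)
  then have tr: "transp_on (fms L) (sub L)" and L: "bounded_lang S V (LEx X L)" by auto
  show ?case by (rule transp_onI) (auto simp: sub_quantifier intro: bsub_trans[OF L _ _ _ tr])
next
  case (LExAll X L)
  then have tr: "transp_on (fms L) (sub L)" and L: "bounded_lang S V (LEx X L)" by auto
  show ?case by (rule transp_onI) (auto simp: sub_quantifier intro: bsub_trans[OF L _ _ _ tr])
qed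

lemma sub_trans:
  assumes "bounded_lang S V L" "sub L \<phi> \<psi>" "sub L \<psi> \<chi>" "\<phi> \<in> fms L" "\<psi> \<in> fms L" "\<chi> \<in> fms L"
  shows "sub L \<phi> \<chi>"
  using transp_onD[OF transp_sub[OF assms(1)] assms(4-6,2,3)] .

lemma bottom_sub: "\<phi> \<in> fms L \<Longrightarrow> sub L (bottom L) \<phi>"
proof (induction L arbitrary: \<phi>)
  case (LBigOr k L)
  then show ?case by (auto simp: sub_BigOr emb_def)
next
  case (LBigAnd L)
  then show ?case by (auto simp: sub_BigAnd cover_def)
qed (auto simp: sub_quantifier intro: sub_imp_bsub)

section \<open>Subsumption implies entailment\<close>

lemma map_add_permutes:
  assumes "\<pi> permutes X" "\<nu> \<in> assigns X U"
  shows "(\<mu> ++ \<nu>) \<circ> \<pi> = \<mu> ++ (\<nu> \<circ> \<pi>)" and "\<nu> \<circ> \<pi> \<in> assigns X U"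
proof -
  \<comment> \<open>The domain of \<open>\<nu>\<close> is exactly \<open>X\<close>, which
    \<open>\<pi>\<close> preserves, so composing with \<open>\<pi>\<close> acts on the overriding
    part alone.\<close>
  have dom: "\<nu> x = None \<longleftrightarrow> x \<notin> X" for x using assms(2) by (auto simp: assigns_def)
  show "(\<mu> ++ \<nu>) \<circ> \<pi> = \<mu> ++ (\<nu> \<circ> \<pi>)"
  proof
    fix x show "((\<mu> ++ \<nu>) \<circ> \<pi>) x = (\<mu> ++ (\<nu> \<circ> \<pi>)) x"
      using dom[of "\<pi> x"] permutes_in_image[OF assms(1), of x] permutes_not_in[OF assms(1), of x]
      by (cases "x \<in> X") (auto simp: map_add_def split: option.splits)
  qed
  have "dom (\<nu> \<circ> \<pi>) = X"
    using dom permutes_in_image[OF assms(1)] by (auto simp: dom_def)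
  then show "\<nu> \<circ> \<pi> \<in> assigns X U"
    using assms(2) by (auto simp: assigns_def ran_def)
qed

lemma sat_subst_permutes:
  assumes "bounded_lang S V (LEx X L)" "\<pi> permutes X" "\<phi> \<in> fms L" "\<nu> \<in> assigns X U"
  shows "(M, \<mu> ++ \<nu>) \<Turnstile> subst \<pi> \<phi> \<longleftrightarrow> (M, \<mu> ++ (\<nu> \<circ> \<pi>)) \<Turnstile> \<phi>"
  using sat_subst[OF renaming_capture_free[OF renaming_permutes[OF assms(1,2)] assms(3)]]
    map_add_permutes[OF assms(2,4)] by metis

lemma states_map_add:
  assumes "(M, \<mu>) \<in> states S" "\<nu> \<in> assigns X (univ M)" shows "(M, \<mu> ++ \<nu>) \<in> states S"
  using assms by (auto simp: states_def assigns_def ran_def)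

lemma assigns_nonempty:
  assumes "(M, \<mu>) \<in> states S" shows "\<exists>\<nu>. \<nu> \<in> assigns X (univ M)"
proof -
  from assms obtain u where "u \<in> univ M" by (auto simp: states_def is_struct_def)
  then have "(\<lambda>x. if x \<in> X then Some u else None) \<in> assigns X (univ M)"
    by (auto simp: assigns_def ran_def dom_def split: if_splits)
  then show ?thesis by blast
qed

text \<open>Composition with \<open>\<pi>\<close> permutes the set of all assignments of
  \<open>X\<close>, so a quantifier over all of them does not notice a permutation of its bound
  variables.\<close>

lemma sat_quantifier_subst:
  assumes L: "bounded_lang S V (LEx X L)" "\<pi> permutes X" "\<phi> \<in> fms L"
  shows "(M, \<mu>) \<Turnstile> Ex X (subst \<pi> \<phi>) \<longleftrightarrow> (M, \<mu>) \<Turnstile> Ex X \<phi>"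
    and "(M, \<mu>) \<Turnstile> All X (subst \<pi> \<phi>) \<longleftrightarrow> (M, \<mu>) \<Turnstile> All X \<phi>"
proof -
  have bij: "\<exists>\<nu>'\<in>assigns X (univ M). \<nu> = \<nu>' \<circ> \<pi>" if "\<nu> \<in> assigns X (univ M)" for \<nu>
    using map_add_permutes(2)[OF permutes_inv[OF assms(2)] that] permutes_inv_o(2)[OF assms(2)]
    by (intro bexI[of _ "\<nu> \<circ> inv \<pi>"]) (auto simp: comp_assoc)
  show "(M, \<mu>) \<Turnstile> Ex X (subst \<pi> \<phi>) \<longleftrightarrow> (M, \<mu>) \<Turnstile> Ex X \<phi>"
    unfolding sat.simps using sat_subst_permutes[OF assms] map_add_permutes(2)[OF assms(2)] bij
    by metis
  show "(M, \<mu>) \<Turnstile> All X (subst \<pi> \<phi>) \<longleftrightarrow> (M, \<mu>) \<Turnstile> All X \<phi>"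
    unfolding sat.simps using sat_subst_permutes[OF assms] map_add_permutes(2)[OF assms(2)] bij
    by metis
qed

lemma sub_sat:
  "bounded_lang S V L \<Longrightarrow> (M, \<mu>) \<in> states S \<Longrightarrow> sub L \<phi> \<psi> \<Longrightarrow> \<phi> \<in> fms L \<Longrightarrow> \<psi> \<in> fms L \<Longrightarrow>
    (M, \<mu>) \<Turnstile> \<phi> \<Longrightarrow> (M, \<mu>) \<Turnstile> \<psi>"
proof (induction L arbitrary: \<phi> \<psi> \<mu>)
  case (LBase A r)
  then show ?case by auto
next
  case (LOr L1 L2)
  then show ?case by auto
next
  case (LAnd L1 L2)
  then show ?case by auto
next
  case (LBigOr k L)
  from LBigOr.prems(3-5) obtain \<phi>s \<psi>s m where eqs: "\<phi> = BigOr \<phi>s" "\<psi> = BigOr \<psi>s"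
    and m: "m ` {..<length \<phi>s} \<subseteq> {..<length \<psi>s}"
      "\<forall>i<length \<phi>s. sub L (\<phi>s ! i) (\<psi>s ! m i)"
    and fms: "set \<phi>s \<subseteq> fms L" "set \<psi>s \<subseteq> fms L"
    by (auto simp: sub_BigOr emb_def)
  from LBigOr.prems(6) obtain i where i: "i < length \<phi>s" "(M, \<mu>) \<Turnstile> \<phi>s ! i"
    unfolding eqs by (auto simp: in_set_conv_nth)
  then have mi: "m i < length \<psi>s" using m(1) by auto
  have "(M, \<mu>) \<Turnstile> \<psi>s ! m i"
    using LBigOr.IH[of \<mu> "\<phi>s ! i" "\<psi>s ! m i"] LBigOr.prems(1,2) m(2) i mi fms
    by (auto simp: subset_iff)
  with mi show ?case unfolding eqs by auto
next
  case (LBigAnd L)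
  from LBigAnd.prems(3-5) obtain \<phi>s \<psi>s where eqs: "\<phi> = BigAnd \<phi>s" "\<psi> = BigAnd \<psi>s"
    and fms: "set \<phi>s \<subseteq> fms L" "set \<psi>s \<subseteq> fms L" "cover (sub L) (set \<phi>s) (set \<psi>s)"
    by (auto simp: sub_BigAnd)
  have "(M, \<mu>) \<Turnstile> \<psi>'" if "\<psi>' \<in> set \<psi>s" for \<psi>'
  proof -
    from that fms(3) obtain \<phi>' where "\<phi>' \<in> set \<phi>s" "sub L \<phi>' \<psi>'" unfolding cover_def by blast
    with that show ?thesis
      using LBigAnd.IH[of \<mu> \<phi>' \<psi>'] LBigAnd.prems(1,2,6) fms(1,2) by (auto simp: eqs)
  qed
  then show ?case by (simp add: eqs)
next
  case (LEx X L)
  then obtain \<phi>' \<psi>' \<pi> where *: "\<phi> = Ex X \<phi>'" "\<psi> = Ex X \<psi>'" "\<phi>' \<in> fms L" "\<psi>' \<in> fms L"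
      "\<pi> permutes X" "sub L \<phi>' (subst \<pi> \<psi>')" by (auto simp: sub_quantifier bsub_def)
  have L: "bounded_lang S V (LEx X L)" "bounded_lang S V L" using LEx.prems(1) by auto
  note step = LEx.IH[OF L(2) states_map_add[OF LEx.prems(2)] *(6) *(3) subst_permutes_in_fms[OF L(1) *(5,4)]]
  have "(M, \<mu>) \<Turnstile> Ex X (subst \<pi> \<psi>')" using LEx.prems(6) step unfolding * by auto
  then show ?case unfolding * sat_quantifier_subst[OF L(1) *(5,4)] .
next
  case (LAll X L)
  then obtain \<phi>' \<psi>' \<pi> where *: "\<phi> = All X \<phi>'" "\<psi> = All X \<psi>'" "\<phi>' \<in> fms L" "\<psi>' \<in> fms L"
      "\<pi> permutes X" "sub L \<phi>' (subst \<pi> \<psi>')" by (auto simp: sub_quantifier bsub_def)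
  have L: "bounded_lang S V (LEx X L)" "bounded_lang S V L" using LAll.prems(1) by auto
  note step = LAll.IH[OF L(2) states_map_add[OF LAll.prems(2)] *(6) *(3) subst_permutes_in_fms[OF L(1) *(5,4)]]
  have "(M, \<mu>) \<Turnstile> All X (subst \<pi> \<psi>')" using LAll.prems(6) step unfolding * by auto
  then show ?case unfolding * sat_quantifier_subst[OF L(1) *(5,4)] .
next
  case (LExAll X L)
  then obtain \<phi>' \<psi>' \<pi> where *: "\<phi>' \<in> fms L" "\<psi>' \<in> fms L"
      "\<pi> permutes X" "sub L \<phi>' (subst \<pi> \<psi>')"
      and eqs: "\<phi> = Ex X \<phi>' \<and> \<psi> = Ex X \<psi>' \<or> \<phi> = All X \<phi>' \<and> \<psi> = All X \<psi>' \<or>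
        \<phi> = All X \<phi>' \<and> \<psi> = Ex X \<psi>'" by (auto simp: sub_quantifier bsub_def)
  have L: "bounded_lang S V (LEx X L)" "bounded_lang S V L" using LExAll.prems(1) by auto
  note step = LExAll.IH[OF L(2) states_map_add[OF LExAll.prems(2)] *(4,1) subst_permutes_in_fms[OF L(1) *(3,2)]]
  have Ex: "(M, \<mu>) \<Turnstile> Ex X (subst \<pi> \<psi>')" if "(M, \<mu>) \<Turnstile> Ex X \<phi>'" using that step by auto
  have All: "(M, \<mu>) \<Turnstile> All X (subst \<pi> \<psi>')" if "(M, \<mu>) \<Turnstile> All X \<phi>'" using that step by auto
  \<comment> \<open>Universes are nonempty, so an assignment of \<open>X\<close> exists. This covers
    the mixed case in which a universal formula subsumes an existential one.\<close>
  have "(M, \<mu>) \<Turnstile> Ex X \<phi>'" if "(M, \<mu>) \<Turnstile> All X \<phi>'"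
    using that assigns_nonempty[OF LExAll.prems(2)] by auto
  with eqs LExAll.prems(6) Ex All show ?case
    unfolding sat_quantifier_subst[OF L(1) *(3,2)] by blast
qed

section \<open>Canonical formulas\<close>

text \<open>Taken as the range of \<open>canon\<close>, which can be computed constructor by
  constructor. That its members are the fixed points follows later from
  \<open>canon_cfms\<close>.\<close>

definition cfms :: "('f, 'p, 'v) lang \<Rightarrow> ('f, 'p, 'v) fm set" where
  "cfms L = canon L ` fms L"

text \<open>The invariant of the induction on languages. Mutual subsumption with the canonical form
  replaces semantic equivalence, and finiteness serves both the existence of minimal elements and
  the finiteness of canonical conjunctions one level up.\<close>

definition well_canon :: "('f, 'p, 'v) lang \<Rightarrow> bool" where
  "well_canon L \<longleftrightarrow>
     (\<forall>\<phi>\<in>fms L. canon L \<phi> \<in> fms L \<and> sub L \<phi> (canon L \<phi>) \<and> sub L (canon L \<phi>) \<phi>) \<and>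
     antisymp_on (cfms L) (sub L) \<and> lin_on (cfms L) (le L) \<and> finite (cfms L)"

lemma well_canonD:
  assumes "well_canon L"
  shows "\<phi> \<in> fms L \<Longrightarrow> canon L \<phi> \<in> fms L"
    and "\<phi> \<in> fms L \<Longrightarrow> sub L \<phi> (canon L \<phi>)"
    and "\<phi> \<in> fms L \<Longrightarrow> sub L (canon L \<phi>) \<phi>"
    and "antisymp_on (cfms L) (sub L)"
    and "lin_on (cfms L) (le L)"
    and "finite (cfms L)"
  using assms by (auto simp: well_canon_def)

lemma canon_in_cfms: "\<phi> \<in> fms L \<Longrightarrow> canon L \<phi> \<in> cfms L"
  by (simp add: cfms_def)

lemma cfms_subset_fms: "well_canon L \<Longrightarrow> cfms L \<subseteq> fms L"
  using well_canonD(1) by (auto simp: cfms_def)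

text \<open>Both canonical forms belong to the same class under mutual subsumption, and antisymmetry
  leaves one canonical formula per class.\<close>

lemma canon_eqI:
  assumes "bounded_lang S V L" "well_canon L" "\<phi> \<in> fms L" "\<psi> \<in> fms L" "sub L \<phi> \<psi>" "sub L \<psi> \<phi>"
  shows "canon L \<phi> = canon L \<psi>"
proof -
  have "sub L (canon L \<alpha>) (canon L \<beta>)" if "\<alpha> \<in> fms L" "\<beta> \<in> fms L" "sub L \<alpha> \<beta>" for \<alpha> \<beta>
  proof -
    have "sub L (canon L \<alpha>) \<beta>"
      using sub_trans[OF assms(1) well_canonD(3)[OF assms(2) that(1)] that(3)] well_canonD(1)[OF assms(2)] that
      by simp
    then show ?thesis
      using sub_trans[OF assms(1) _ well_canonD(2)[OF assms(2) that(2)]] well_canonD(1)[OF assms(2)] that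
      by simp
  qed
  with assms show ?thesis
    using antisymp_onD[OF well_canonD(4)[OF assms(2)]] canon_in_cfms by metis
qed

text \<open>Idempotence: a formula and its canonical form subsume each other, hence have the same
  canonical form.\<close>

lemma canon_cfms:
  assumes "bounded_lang S V L" "well_canon L" "\<phi> \<in> cfms L"
  shows "canon L \<phi> = \<phi>"
proof -
  from assms(3) obtain \<psi> where \<psi>: "\<psi> \<in> fms L" "\<phi> = canon L \<psi>" by (auto simp: cfms_def)
  note wc = well_canonD[OF assms(2)]
  show ?thesis
    unfolding \<psi>(2) by (rule canon_eqI[OF assms(1,2) wc(1)[OF \<psi>(1)] \<psi>(1) wc(3)[OF \<psi>(1)] wc(2)[OF \<psi>(1)]])
qed

lemma sub_canon_iff:
  assumes "bounded_lang S V L" "well_canon L" "\<phi> \<in> fms L" "\<psi> \<in> fms L"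
  shows "sub L \<phi> (canon L \<psi>) \<longleftrightarrow> sub L \<phi> \<psi>" "sub L (canon L \<psi>) \<phi> \<longleftrightarrow> sub L \<psi> \<phi>"
  using sub_trans[OF assms(1)] well_canonD(1-3)[OF assms(2,4)] assms(3,4) by metis+

lemma antisymp_cfms_sub: "well_canon L \<Longrightarrow> antisymp_on (cfms L) (sub L)"
  by (rule well_canonD)

lemma transp_cfms_sub:
  "bounded_lang S V L \<Longrightarrow> well_canon L \<Longrightarrow> transp_on (cfms L) (sub L)"
  using transp_sub cfms_subset_fms transp_on_subset by metis

lemma reflp_cfms_sub: "well_canon L \<Longrightarrow> reflp_on (cfms L) (sub L)"
  using reflp_sub cfms_subset_fms reflp_on_subset by metis

subsection \<open>Binary connectives\<close>

lemma lin_on_lex: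
  assumes "lin_on A R" "lin_on B Q"
  shows "lin_on (A \<times> B) (\<lambda>x y. R (fst x) (fst y) \<and> fst x \<noteq> fst y \<or> fst x = fst y \<and> Q (snd x) (snd y))"
proof (rule lin_onI, goal_cases)
  case (1 x)
  then show ?case using lin_onD(1)[OF assms(2)] by auto
next
  case (2 x y z)
  then have A: "fst x \<in> A" "fst y \<in> A" "fst z \<in> A" "snd x \<in> B" "snd y \<in> B" "snd z \<in> B" by auto
  from 2(4,5) show ?case
    using lin_onD(2)[OF assms(1) A(1-3)] lin_onD(2)[OF assms(2) A(4-6)] lin_onD(3)[OF assms(1) A(1,2)]
    by metis
next
  case (3 x y)
  then have A: "fst x \<in> A" "fst y \<in> A" "snd x \<in> B" "snd y \<in> B" by auto
  from 3(3,4) show ?case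
    using lin_onD(3)[OF assms(1) A(1,2)] lin_onD(3)[OF assms(2) A(3,4)] by (metis prod.expand)
next
  case (4 x y)
  then have A: "fst x \<in> A" "fst y \<in> A" "snd x \<in> B" "snd y \<in> B" by auto
  then show ?case
    using lin_onD(4)[OF assms(1) A(1,2)] lin_onD(4)[OF assms(2) A(3,4)] by metis
qed

lemma cfms_LOr: "cfms (LOr L1 L2) = (\<lambda>(\<phi>1, \<phi>2). Or \<phi>1 \<phi>2) ` (cfms L1 \<times> cfms L2)"
proof -
  let ?f = "\<lambda>(\<phi>1, \<phi>2). Or \<phi>1 \<phi>2"
  have "fms (LOr L1 L2) = ?f ` (fms L1 \<times> fms L2)" by auto
  then have "cfms (LOr L1 L2) = (\<lambda>p. ?f (map_prod (canon L1) (canon L2) p)) ` (fms L1 \<times> fms L2)"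
    unfolding cfms_def by (simp add: image_image case_prod_beta)
  also have "\<dots> = ?f ` map_prod (canon L1) (canon L2) ` (fms L1 \<times> fms L2)"
    by (simp only: image_image)
  finally show ?thesis by (simp only: map_prod_surj_on[OF refl refl] cfms_def)
qed

lemma cfms_LAnd: "cfms (LAnd L1 L2) = (\<lambda>(\<phi>1, \<phi>2). And \<phi>1 \<phi>2) ` (cfms L1 \<times> cfms L2)"
proof -
  let ?f = "\<lambda>(\<phi>1, \<phi>2). And \<phi>1 \<phi>2"
  have "fms (LAnd L1 L2) = ?f ` (fms L1 \<times> fms L2)" by auto
  then have "cfms (LAnd L1 L2) = (\<lambda>p. ?f (map_prod (canon L1) (canon L2) p)) ` (fms L1 \<times> fms L2)"
    unfolding cfms_def by (simp add: image_image case_prod_beta)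
  also have "\<dots> = ?f ` map_prod (canon L1) (canon L2) ` (fms L1 \<times> fms L2)"
    by (simp only: image_image)
  finally show ?thesis by (simp only: map_prod_surj_on[OF refl refl] cfms_def)
qed

lemma well_canon_LOr:
  assumes "well_canon L1" "well_canon L2" shows "well_canon (LOr L1 L2)"
  unfolding well_canon_def
proof (intro conjI)
  show "antisymp_on (cfms (LOr L1 L2)) (sub (LOr L1 L2))"
    using well_canonD(4)[OF assms(1)] well_canonD(4)[OF assms(2)]
    by (auto intro!: antisymp_onI simp: cfms_LOr dest: antisymp_onD)
  show "lin_on (cfms (LOr L1 L2)) (le (LOr L1 L2))"
    unfolding cfms_LOr
    by (rule lin_on_image[OF lin_on_lex[OF well_canonD(5)[OF assms(1)] well_canonD(5)[OF assms(2)]]]) auto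
qed (use well_canonD(1-3,6)[OF assms(1)] well_canonD(1-3,6)[OF assms(2)] in \<open>auto simp: cfms_LOr\<close>)

lemma well_canon_LAnd:
  assumes "well_canon L1" "well_canon L2" shows "well_canon (LAnd L1 L2)"
  unfolding well_canon_def
proof (intro conjI)
  show "antisymp_on (cfms (LAnd L1 L2)) (sub (LAnd L1 L2))"
    using well_canonD(4)[OF assms(1)] well_canonD(4)[OF assms(2)]
    by (auto intro!: antisymp_onI simp: cfms_LAnd dest: antisymp_onD)
  show "lin_on (cfms (LAnd L1 L2)) (le (LAnd L1 L2))"
    unfolding cfms_LAnd
    by (rule lin_on_image[OF lin_on_lex[OF well_canonD(5)[OF assms(1)] well_canonD(5)[OF assms(2)]]]) auto
qed (use well_canonD(1-3,6)[OF assms(1)] well_canonD(1-3,6)[OF assms(2)] in \<open>auto simp: cfms_LAnd\<close>)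

lemma well_canon_LBase:
  assumes "bounded_lang S V (LBase A r)" shows "well_canon (LBase A r)"
  unfolding well_canon_def
proof (intro conjI)
  have cfms: "cfms (LBase A r) = A \<union> {Bot}" by (auto simp: cfms_def)
  show "antisymp_on (cfms (LBase A r)) (sub (LBase A r))"
    by (rule antisymp_onI) auto
  have "linear_order_on (A \<union> {Bot}) r" using assms by simp
  then have "refl_on (A \<union> {Bot}) r" "trans r" "antisym r" "total_on (A \<union> {Bot}) r"
    unfolding linear_order_on_def partial_order_on_def preorder_on_def by auto
  then show "lin_on (cfms (LBase A r)) (le (LBase A r))"
    unfolding cfms by (intro lin_onI) (auto dest: refl_onD transD antisymD simp: total_on_def)
  show "finite (cfms (LBase A r))" using assms by (simp add: cfms)
qed auto

subsection \<open>Sequence connectives\<close>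

lemma canon_BigOr:
  "canon (LBigOr k L) (BigOr \<phi>s) = BigOr (sort_list (le L) (map (canon L) \<phi>s))"
  by simp

lemma canon_BigAnd:
  "canon (LBigAnd L) (BigAnd \<phi>s) =
     BigAnd (sort_set (le L) (minimals (sub L) (canon L ` set \<phi>s)))"
  by (simp add: image_def) (metis (mono_tags, lifting))

declare canon.simps(5) [simp del]

lemma cfms_LBigOrD:
  assumes "well_canon L" "\<phi> \<in> cfms (LBigOr k L)"
  obtains \<phi>s where "\<phi> = BigOr \<phi>s" "set \<phi>s \<subseteq> cfms L" "length \<phi>s \<le> k" "sorted_wrt (le L) \<phi>s"
proof -
  from assms(2) obtain \<psi>s where \<psi>s: "set \<psi>s \<subseteq> fms L" "length \<psi>s \<le> k"
    "\<phi> = BigOr (sort_list (le L) (map (canon L) \<psi>s))"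
    by (auto simp: cfms_def)
  have sub: "set (map (canon L) \<psi>s) \<subseteq> cfms L" using \<psi>s(1) by (auto simp: cfms_def)
  note lin = well_canonD(5)[OF assms(1)]
  show ?thesis
    using that[OF \<psi>s(3)] set_sort_list[OF lin sub] sorted_sort_list[OF lin sub]
      length_sort_list[OF lin sub] sub \<psi>s(2) by simp
qed

lemma BigOr_in_cfms:
  assumes "bounded_lang S V L" "well_canon L" "set \<phi>s \<subseteq> cfms L" "length \<phi>s \<le> k"
  shows "BigOr (sort_list (le L) \<phi>s) \<in> cfms (LBigOr k L)"
proof -
  have "map (canon L) \<phi>s = \<phi>s"
    using assms(3) canon_cfms[OF assms(1,2)] by (intro map_idI) auto
  then have "BigOr (sort_list (le L) \<phi>s) = canon (LBigOr k L) (BigOr \<phi>s)" by simp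
  moreover have "BigOr \<phi>s \<in> fms (LBigOr k L)" using assms(3,4) cfms_subset_fms[OF assms(2)] by auto
  ultimately show ?thesis by (metis canon_in_cfms)
qed

lemma sub_BigOr_sort_list:
  assumes "lin_on A (le L)" "A \<subseteq> fms L" "set \<phi>s \<subseteq> A"
  shows "sub (LBigOr k L) (BigOr \<phi>s) (BigOr (sort_list (le L) \<phi>s))"
    and "sub (LBigOr k L) (BigOr (sort_list (le L) \<phi>s)) (BigOr \<phi>s)"
  using emb_mset[OF reflp_sub[of L]] assms set_sort_list[OF assms(1,3)] mset_sort_list[OF assms(1,3)]
  by (auto simp: sub_BigOr)

text \<open>Mutual embedding determines canonical disjuncts up to rearrangement, and sorting picks
  one list from each class. The bound \<open>k\<close> keeps the set of canonical formulas
  finite.\<close>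

lemma well_canon_LBigOr:
  assumes L: "bounded_lang S V L" and wc: "well_canon L"
  shows "well_canon (LBigOr k L)"
  unfolding well_canon_def
proof (intro conjI ballI)
  let ?K = "LBigOr k L"
  note wcD = well_canonD[OF wc]
  show "canon ?K \<phi> \<in> fms ?K" "sub ?K \<phi> (canon ?K \<phi>)" "sub ?K (canon ?K \<phi>) \<phi>"
    if fms: "\<phi> \<in> fms ?K" for \<phi>
  proof -
    from fms obtain \<phi>s where \<phi>s: "\<phi> = BigOr \<phi>s" "set \<phi>s \<subseteq> fms L" "length \<phi>s \<le> k" by auto
    let ?c = "map (canon L) \<phi>s"
    have c: "set ?c \<subseteq> cfms L" using \<phi>s(2) by (auto simp: cfms_def)
    have sc: "set (sort_list (le L) ?c) = set ?c" "length (sort_list (le L) ?c) = length \<phi>s"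
      using set_sort_list[OF wcD(5) c] length_sort_list[OF wcD(5) c] by auto
    have sub_fms: "set ?c \<subseteq> fms L" "set (sort_list (le L) ?c) \<subseteq> fms L"
      using sc c cfms_subset_fms[OF wc] by auto
    show "canon ?K \<phi> \<in> fms ?K" using \<phi>s sc sub_fms by simp
    have "emb (sub L) \<phi>s ?c" "emb (sub L) ?c \<phi>s"
      using wcD(2,3) \<phi>s(2) by (auto intro!: emb_map simp: list_all2_conv_all_nth subset_iff)
    then have "sub ?K \<phi> (BigOr ?c)" "sub ?K (BigOr ?c) \<phi>" by (auto simp: sub_BigOr \<phi>s(1))
    moreover have "BigOr ?c \<in> fms ?K" using sub_fms \<phi>s(3) by auto
    moreover note sub_BigOr_sort_list[OF wcD(5) cfms_subset_fms[OF wc] c, of k] \<open>canon ?K \<phi> \<in> fms ?K\<close> fms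
    ultimately show "sub ?K \<phi> (canon ?K \<phi>)" "sub ?K (canon ?K \<phi>) \<phi>"
      using sub_trans[of S V ?K] L unfolding \<phi>s(1) canon_BigOr by (metis bounded_lang.simps(4))+
  qed
  show "antisymp_on (cfms ?K) (sub ?K)"
  proof (rule antisymp_onI)
    fix \<phi> \<psi> assume "\<phi> \<in> cfms ?K" "\<psi> \<in> cfms ?K" and sub: "sub ?K \<phi> \<psi>" "sub ?K \<psi> \<phi>"
    then obtain \<phi>s \<psi>s where \<phi>s: "\<phi> = BigOr \<phi>s" "set \<phi>s \<subseteq> cfms L" "sorted_wrt (le L) \<phi>s"
      and \<psi>s: "\<psi> = BigOr \<psi>s" "set \<psi>s \<subseteq> cfms L" "sorted_wrt (le L) \<psi>s"
      by (meson cfms_LBigOrD[OF wc])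
    have "mset \<phi>s = mset \<psi>s"
      using sub emb_antisym[OF reflp_cfms_sub[OF wc] transp_cfms_sub[OF L wc] wcD(4) \<phi>s(2) \<psi>s(2)]
      by (auto simp: sub_BigOr \<phi>s(1) \<psi>s(1))
    then show "\<phi> = \<psi>" using sorted_unique[OF wcD(5) \<phi>s(2) _ \<phi>s(3) \<psi>s(3)] \<phi>s(1) \<psi>s(1) by simp
  qed
  \<comment> \<open>Reversal turns the comparison from the end into the dictionary order on all
    lists over canonical formulas; linearity then passes to the canonical disjunctions among
    them.\<close>
  have "lin_on ((\<lambda>xs. BigOr (rev xs)) ` lists (cfms L)) (le ?K)"
    by (rule lin_on_image[OF lin_on_prefix_order[OF wcD(5)]]) (simp add: suffix_to_prefix)
  moreover have "cfms ?K \<subseteq> (\<lambda>xs. BigOr (rev xs)) ` lists (cfms L)"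
  proof
    fix \<phi> assume "\<phi> \<in> cfms ?K"
    then obtain \<phi>s where "\<phi> = BigOr \<phi>s" "set \<phi>s \<subseteq> cfms L" by (meson cfms_LBigOrD[OF wc])
    then show "\<phi> \<in> (\<lambda>xs. BigOr (rev xs)) ` lists (cfms L)"
      by (intro image_eqI[of _ _ "rev \<phi>s"]) auto
  qed
  ultimately show "lin_on (cfms ?K) (le ?K)" by (rule lin_on_subset)
  have "cfms ?K \<subseteq> BigOr ` {xs. set xs \<subseteq> cfms L \<and> length xs \<le> k}"
    by (auto elim!: cfms_LBigOrD[OF wc])
  then show "finite (cfms ?K)"
    using finite_lists_length_le[OF wcD(6)] finite_surj by blast
qed

lemma minimals_idem: "minimals R (minimals R F) = minimals R F"
  by (auto simp: minimals_def)

lemma cfms_LBigAndD: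
  assumes "bounded_lang S V L" "well_canon L" "\<phi> \<in> cfms (LBigAnd L)"
  obtains \<phi>s where "\<phi> = BigAnd \<phi>s" "set \<phi>s \<subseteq> cfms L" "\<phi>s \<noteq> []" "sorted_wrt (le L) \<phi>s"
    "distinct \<phi>s" "minimals (sub L) (set \<phi>s) = set \<phi>s"
proof -
  from assms(3) obtain \<psi>s where \<psi>s: "set \<psi>s \<subseteq> fms L" "\<psi>s \<noteq> []"
    "\<phi> = BigAnd (sort_set (le L) (minimals (sub L) (canon L ` set \<psi>s)))"
    by (auto simp: cfms_def canon_BigAnd)
  let ?F = "minimals (sub L) (canon L ` set \<psi>s)"
  have c: "canon L ` set \<psi>s \<subseteq> cfms L" using \<psi>s(1) by (auto simp: cfms_def)
  then have F: "?F \<subseteq> cfms L" "finite ?F"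
    using minimals_subset[of "sub L" "canon L ` set \<psi>s"]
    by (auto intro: finite_subset[OF minimals_subset])
  \<comment> \<open>A conjunction in the language has at least one conjunct. Finiteness of the
    candidates guarantees that a minimal one survives.\<close>
  have "?F \<noteq> {}"
    using ex_minimal_below[OF _ reflp_on_subset[OF reflp_cfms_sub[OF assms(2)] c]
        transp_on_subset[OF transp_cfms_sub[OF assms(1,2)] c]] \<psi>s(2)
    by (cases \<psi>s) auto
  with F sort_set[OF well_canonD(5)[OF assms(2)] F] show ?thesis
    by (intro that[OF \<psi>s(3)]) (auto simp: minimals_idem)
qed

lemma cover_minimals:
  assumes "reflp_on A R" "transp_on A R" "finite F" "F \<subseteq> A"
  shows "cover R F (minimals R F)" "cover R (minimals R F) F"
proof -
  show "cover R F (minimals R F)"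
    using reflp_onD[OF assms(1)] minimals_subset[of R F] assms(4) unfolding cover_def by blast
  show "cover R (minimals R F) F"
    using ex_minimal_below[OF assms(3) reflp_on_subset[OF assms(1,4)] transp_on_subset[OF assms(2,4)]]
    unfolding cover_def by blast
qed

text \<open>There is no bound on the length of a conjunction, but a canonical one lists its
  conjuncts without repetition and draws them from a finite set, so finitely many remain.\<close>

lemma well_canon_LBigAnd:
  assumes L: "bounded_lang S V L" and wc: "well_canon L"
  shows "well_canon (LBigAnd L)"
  unfolding well_canon_def
proof (intro conjI ballI)
  let ?K = "LBigAnd L"
  note wcD = well_canonD[OF wc]
  show "canon ?K \<phi> \<in> fms ?K" "sub ?K \<phi> (canon ?K \<phi>)" "sub ?K (canon ?K \<phi>) \<phi>"
    if fms: "\<phi> \<in> fms ?K" for \<phi>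
  proof -
    from fms obtain \<phi>s where \<phi>s: "\<phi> = BigAnd \<phi>s" "set \<phi>s \<subseteq> fms L" by auto
    let ?C = "canon L ` set \<phi>s"
    have C: "?C \<subseteq> cfms L" using \<phi>s(2) by (auto simp: cfms_def)
    have m: "minimals (sub L) ?C \<subseteq> cfms L" "finite (minimals (sub L) ?C)"
      using minimals_subset[of "sub L" ?C] C by (auto intro: finite_subset[OF minimals_subset])
    note set_m = set_sort_set[OF wcD(5) m]
    obtain \<chi>s where \<chi>s: "canon ?K \<phi> = BigAnd \<chi>s" "set \<chi>s \<subseteq> cfms L" "\<chi>s \<noteq> []"
      using cfms_LBigAndD[OF L wc canon_in_cfms[OF fms]] by metis
    then show "canon ?K \<phi> \<in> fms ?K" using cfms_subset_fms[OF wc] by auto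
    have set_eq: "set \<chi>s = minimals (sub L) ?C"
      using \<chi>s(1) set_m unfolding \<phi>s(1) canon_BigAnd by simp
    have A: "set \<phi>s \<subseteq> fms L" "?C \<subseteq> fms L" "set \<chi>s \<subseteq> fms L"
      using \<phi>s(2) C \<chi>s(2) cfms_subset_fms[OF wc] by auto
    have 1: "cover (sub L) (set \<phi>s) ?C" "cover (sub L) ?C (set \<phi>s)"
      using wcD(2,3) \<phi>s(2) unfolding cover_def by blast+
    have 2: "cover (sub L) ?C (set \<chi>s)" "cover (sub L) (set \<chi>s) ?C"
      using cover_minimals[OF reflp_sub transp_sub[OF L] _ A(2)] by (auto simp: set_eq)
    show "sub ?K \<phi> (canon ?K \<phi>)" "sub ?K (canon ?K \<phi>) \<phi>"
      using cover_trans[OF transp_sub[OF L] A 1(1) 2(1)] cover_trans[OF transp_sub[OF L] A(3,2,1) 2(2) 1(2)]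
      unfolding \<chi>s(1) by (auto simp: \<phi>s(1) sub_BigAnd)
  qed
  show "antisymp_on (cfms ?K) (sub ?K)"
  proof (rule antisymp_onI)
    fix \<phi> \<psi> assume "\<phi> \<in> cfms ?K" "\<psi> \<in> cfms ?K" and sub: "sub ?K \<phi> \<psi>" "sub ?K \<psi> \<phi>"
    then obtain \<phi>s \<psi>s where
      \<phi>s: "\<phi> = BigAnd \<phi>s" "set \<phi>s \<subseteq> cfms L" "sorted_wrt (le L) \<phi>s" "distinct \<phi>s"
        "minimals (sub L) (set \<phi>s) = set \<phi>s"
      and \<psi>s: "\<psi> = BigAnd \<psi>s" "set \<psi>s \<subseteq> cfms L" "sorted_wrt (le L) \<psi>s" "distinct \<psi>s"
        "minimals (sub L) (set \<psi>s) = set \<psi>s"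
      by (meson cfms_LBigAndD[OF L wc])
    have "set \<phi>s = set \<psi>s"
      using sub by (intro cover_antisym[OF transp_cfms_sub[OF L wc] wcD(4) \<phi>s(2) \<psi>s(2) \<phi>s(5) \<psi>s(5)])
        (auto simp: sub_BigAnd \<phi>s(1) \<psi>s(1))
    then have "mset \<phi>s = mset \<psi>s" using \<phi>s(4) \<psi>s(4) by (simp add: set_eq_iff_mset_eq_distinct)
    then show "\<phi> = \<psi>" using sorted_unique[OF wcD(5) \<phi>s(2) _ \<phi>s(3) \<psi>s(3)] \<phi>s(1) \<psi>s(1) by simp
  qed
  have "lin_on (BigAnd ` lists (cfms L)) (le ?K)"
    by (rule lin_on_image[OF lin_on_revprefix_order[OF wcD(5)]]) simp
  moreover have "cfms ?K \<subseteq> BigAnd ` lists (cfms L)"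
    by (auto elim!: cfms_LBigAndD[OF L wc] intro!: imageI)
  ultimately show "lin_on (cfms ?K) (le ?K)" by (rule lin_on_subset)
  have "cfms ?K \<subseteq> BigAnd ` {xs. set xs \<subseteq> cfms L \<and> distinct xs}"
    by (auto elim!: cfms_LBigAndD[OF L wc] intro!: imageI)
  moreover have "finite {xs. set xs \<subseteq> cfms L \<and> distinct xs}"
    using finite_subset_distinct[OF wcD(6)] by simp
  ultimately show "finite (cfms ?K)" using finite_surj by blast
qed

subsection \<open>Quantifiers\<close>

definition bcanon :: "'v set \<Rightarrow> ('f, 'p, 'v) lang \<Rightarrow> ('f, 'p, 'v) fm \<Rightarrow> ('f, 'p, 'v) fm" where
  "bcanon X L \<psi> = least_of (le L) {canon L (subst \<pi> \<psi>) | \<pi>. \<pi> permutes X}"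

lemma canon_quantifier:
  "canon (LEx X L) (Ex Y \<psi>) = Ex X (bcanon X L \<psi>)"
  "canon (LAll X L) (All Y \<psi>) = All X (bcanon X L \<psi>)"
  "canon (LExAll X L) (Ex Y \<psi>) = Ex X (bcanon X L \<psi>)"
  "canon (LExAll X L) (All Y \<psi>) = All X (bcanon X L \<psi>)"
  by (simp_all add: bcanon_def)

declare canon.simps(6-8) [simp del]

lemma cfms_quantifier:
  "cfms (LEx X L) = Ex X ` bcanon X L ` fms L"
  "cfms (LAll X L) = All X ` bcanon X L ` fms L"
  "cfms (LExAll X L) = Ex X ` bcanon X L ` fms L \<union> All X ` bcanon X L ` fms L"
proof -
  have "fms (LEx X L) = Ex X ` fms L" "fms (LAll X L) = All X ` fms L"
    "fms (LExAll X L) = Ex X ` fms L \<union> All X ` fms L"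
    by auto
  then show "cfms (LEx X L) = Ex X ` bcanon X L ` fms L"
    "cfms (LAll X L) = All X ` bcanon X L ` fms L"
    "cfms (LExAll X L) = Ex X ` bcanon X L ` fms L \<union> All X ` bcanon X L ` fms L"
    unfolding cfms_def by (simp_all only: image_Un image_image canon_quantifier)
qed

context
  fixes S :: "('f, 'p) signature" and V :: "'v set" and X :: "'v set"
    and L :: "('f, 'p, 'v) lang"
  assumes LX: "bounded_lang S V (LEx X L)" and wc: "well_canon L"
begin

lemma bounded_body: "bounded_lang S V L"
  using LX by simp

lemma bcanon_obtain:
  assumes "\<psi> \<in> fms L"
  obtains \<pi> where "\<pi> permutes X" "bcanon X L \<psi> = canon L (subst \<pi> \<psi>)"
proof -
  let ?F = "{canon L (subst \<pi> \<psi>) | \<pi>. \<pi> permutes X}"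
  have F: "?F = (\<lambda>\<pi>. canon L (subst \<pi> \<psi>)) ` {\<pi>. \<pi> permutes X}" by auto
  have "?F \<subseteq> cfms L"
    using subst_permutes_in_fms[OF LX _ assms] by (auto simp: cfms_def)
  moreover have "finite ?F" unfolding F using LX by (intro finite_imageI finite_permutations) simp
  moreover have "?F \<noteq> {}" using permutes_id[of X] by blast
  ultimately have "bcanon X L \<psi> \<in> ?F"
    unfolding bcanon_def by (rule least_of_in[OF well_canonD(5)[OF wc]])
  then show ?thesis using that by blast
qed

lemma bcanon_in_cfms:
  assumes "\<psi> \<in> fms L"
  shows "bcanon X L \<psi> \<in> cfms L"
proof -
  obtain \<pi> where "\<pi> permutes X" "bcanon X L \<psi> = canon L (subst \<pi> \<psi>)"
    using bcanon_obtain[OF assms] .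
  then show ?thesis using subst_permutes_in_fms[OF LX _ assms] by (simp add: canon_in_cfms)
qed

lemma bcanon_in_fms: "\<psi> \<in> fms L \<Longrightarrow> bcanon X L \<psi> \<in> fms L"
  using bcanon_in_cfms cfms_subset_fms[OF wc] by blast

lemma subst_inverse:
  assumes "\<pi> permutes X" "\<psi> \<in> fms L" shows "subst (inv \<pi>) (subst \<pi> \<psi>) = \<psi>"
  using subst_comp_permutes[OF LX assms] permutes_inv_o(2)[OF assms(1)] by simp

text \<open>The canonical body is the canonical form of some permuted copy of \<open>\<psi>\<close>;
  applying the inverse permutation gives the other direction.\<close>

lemma bsub_bcanon:
  assumes "\<psi> \<in> fms L"
  shows "bsub X L \<psi> (bcanon X L \<psi>)" "bsub X L (bcanon X L \<psi>) \<psi>"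
proof -
  obtain \<pi> where \<pi>: "\<pi> permutes X" "bcanon X L \<psi> = canon L (subst \<pi> \<psi>)"
    using bcanon_obtain[OF assms] .
  have fms: "subst \<pi> \<psi> \<in> fms L" using subst_permutes_in_fms[OF LX \<pi>(1) assms] .
  note wcD = well_canonD[OF wc]
  show "bsub X L (bcanon X L \<psi>) \<psi>"
    unfolding bsub_def using \<pi> wcD(3)[OF fms] by auto
  have "sub L (subst (inv \<pi>) (subst \<pi> \<psi>)) (subst (inv \<pi>) (bcanon X L \<psi>))"
    using sub_subst_permutes[OF LX permutes_inv[OF \<pi>(1)] fms] wcD(1,2)[OF fms] \<pi>(2) by simp
  then show "bsub X L \<psi> (bcanon X L \<psi>)"
    unfolding subst_inverse[OF \<pi>(1) assms] bsub_def using permutes_inv[OF \<pi>(1)] by blast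
qed

text \<open>A permutation of \<open>X\<close> has finite order, so the chain \<open>\<phi> \<sqsubseteq> \<phi>\<tau> \<sqsubseteq> \<phi>\<tau>\<tau> \<sqsubseteq> \<dots>\<close> returns to \<open>\<phi>\<close>.\<close>

lemma sub_subst_reverse:
  assumes \<tau>: "\<tau> permutes X" and \<phi>: "\<phi> \<in> fms L" and sub: "sub L \<phi> (subst \<tau> \<phi>)"
  shows "sub L (subst \<tau> \<phi>) \<phi>"
proof -
  have fms: "subst (\<tau> ^^ j) \<phi> \<in> fms L" for j
    using subst_permutes_in_fms[OF LX permutes_funpow[OF \<tau>] \<phi>] .
  have fms1: "subst \<tau> \<phi> \<in> fms L" using subst_permutes_in_fms[OF LX \<tau> \<phi>] .
  have chain: "sub L (subst \<tau> \<phi>) (subst (\<tau> ^^ Suc j) \<phi>)" for j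
  proof (induction j)
    case 0
    show ?case using sub_refl[OF fms1] by simp
  next
    case (Suc j)
    have "sub L (subst (\<tau> ^^ Suc j) \<phi>) (subst (\<tau> ^^ Suc j) (subst \<tau> \<phi>))"
      by (rule sub_subst_permutes[OF LX permutes_funpow[OF \<tau>] \<phi> fms1 sub])
    also have "subst (\<tau> ^^ Suc j) (subst \<tau> \<phi>) = subst (\<tau> ^^ Suc (Suc j)) \<phi>"
      using subst_comp_permutes[OF LX \<tau> \<phi>] by (metis funpow_Suc_right)
    finally show ?case
      using sub_trans[OF bounded_body Suc _ fms1 fms fms] by blast
  qed
  have "finite X" using LX by simp
  then obtain n where "\<tau> ^^ n = id" "n > 0" using permutes_finite_order[OF _ \<tau>] by blast
  with chain[of "n - 1"] show ?thesis by simp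
qed

text \<open>One and the same permutation works in both directions. With \<open>\<tau>\<close> the
  composite, \<open>\<phi>\<close> lies below the permuted \<open>\<psi>\<close>, which lies below
  \<open>\<phi>\<close> permuted by \<open>\<tau>\<close>; by \<open>sub_subst_reverse\<close> the
  latter lies below \<open>\<phi>\<close> again.\<close>

lemma bsub_antisymE:
  assumes fms: "\<phi> \<in> fms L" "\<psi> \<in> fms L" and sub: "bsub X L \<phi> \<psi>" "bsub X L \<psi> \<phi>"
  obtains \<pi> where "\<pi> permutes X" "sub L \<phi> (subst \<pi> \<psi>)" "sub L (subst \<pi> \<psi>) \<phi>"
proof -
  obtain \<pi> where \<pi>: "\<pi> permutes X" "sub L \<phi> (subst \<pi> \<psi>)" using sub(1) by (auto simp: bsub_def)
  obtain \<sigma> where \<sigma>: "\<sigma> permutes X" "sub L \<psi> (subst \<sigma> \<phi>)" using sub(2) by (auto simp: bsub_def)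
  let ?\<tau> = "\<pi> \<circ> \<sigma>"
  note in_fms = subst_permutes_in_fms[OF LX]
  have \<tau>: "?\<tau> permutes X" using permutes_compose[OF \<sigma>(1) \<pi>(1)] .
  have "sub L (subst \<pi> \<psi>) (subst \<pi> (subst \<sigma> \<phi>))"
    by (intro sub_subst_permutes[OF LX \<pi>(1)] fms in_fms \<sigma>)
  then have 1: "sub L (subst \<pi> \<psi>) (subst ?\<tau> \<phi>)" by (simp only: subst_comp_permutes[OF LX \<sigma>(1) fms(1)])
  then have "sub L \<phi> (subst ?\<tau> \<phi>)"
    using sub_trans[OF bounded_body \<pi>(2)] in_fms \<pi>(1) \<tau> fms by blast
  then have "sub L (subst ?\<tau> \<phi>) \<phi>" by (rule sub_subst_reverse[OF \<tau> fms(1)])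
  with 1 have "sub L (subst \<pi> \<psi>) \<phi>"
    using sub_trans[OF bounded_body] in_fms \<pi>(1) \<tau> fms by blast
  with \<pi> that show ?thesis by blast
qed

text \<open>Bodies that subsume each other up to permutation offer the same set of candidates,
  because any permutation of one is matched by a permutation of the other with equal canonical form.
  The least candidate is then the same.\<close>

lemma bcanon_eqI:
  assumes fms: "\<phi> \<in> fms L" "\<psi> \<in> fms L" and sub: "bsub X L \<phi> \<psi>" "bsub X L \<psi> \<phi>"
  shows "bcanon X L \<phi> = bcanon X L \<psi>"
proof -
  have incl: "{canon L (subst \<pi> \<phi>) | \<pi>. \<pi> permutes X} \<subseteq> {canon L (subst \<pi> \<psi>) | \<pi>. \<pi> permutes X}"
    if fms: "\<phi> \<in> fms L" "\<psi> \<in> fms L" and sub: "bsub X L \<phi> \<psi>" "bsub X L \<psi> \<phi>" for \<phi> \<psi>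
  proof safe
    fix \<sigma> assume \<sigma>: "\<sigma> permutes X"
    obtain \<pi> where \<pi>: "\<pi> permutes X" "sub L \<phi> (subst \<pi> \<psi>)" "sub L (subst \<pi> \<psi>) \<phi>"
      using bsub_antisymE[OF fms sub] .
    note in_fms = subst_permutes_in_fms[OF LX]
    note sub_subst = sub_subst_permutes[OF LX \<sigma>]
    have "canon L (subst \<sigma> \<phi>) = canon L (subst \<sigma> (subst \<pi> \<psi>))"
      using \<sigma> \<pi> fms by (intro canon_eqI[OF bounded_body wc] in_fms sub_subst)
    also have "\<dots> = canon L (subst (\<sigma> \<circ> \<pi>) \<psi>)"
      by (simp only: subst_comp_permutes[OF LX \<pi>(1) fms(2)])
    finally show "\<exists>\<rho>. canon L (subst \<sigma> \<phi>) = canon L (subst \<rho> \<psi>) \<and> \<rho> permutes X"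
      using permutes_compose[OF \<pi>(1) \<sigma>] by blast
  qed
  show ?thesis
    unfolding bcanon_def
    by (rule arg_cong[OF subset_antisym[OF incl[OF assms] incl[OF fms(2,1) sub(2,1)]]])
qed

lemma antisymp_bsub: "antisymp_on (bcanon X L ` fms L) (bsub X L)"
proof (rule antisymp_onI)
  fix \<phi> \<psi>
  assume "\<phi> \<in> bcanon X L ` fms L" "\<psi> \<in> bcanon X L ` fms L" and sub: "bsub X L \<phi> \<psi>" "bsub X L \<psi> \<phi>"
  then obtain \<alpha> \<beta> where ab: "\<alpha> \<in> fms L" "\<phi> = bcanon X L \<alpha>" "\<beta> \<in> fms L" "\<psi> = bcanon X L \<beta>" by blast
  note bcanon_in_fms[OF ab(1)] bcanon_in_fms[OF ab(3)] bsub_bcanon[OF ab(1)] bsub_bcanon[OF ab(3)]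
  moreover note trans = bsub_trans[OF LX _ _ _ transp_sub[OF bounded_body]]
  ultimately have "bsub X L \<alpha> \<beta>" "bsub X L \<beta> \<alpha>" using sub unfolding ab(2,4) by (meson ab(1,3))+
  then show "\<phi> = \<psi>" using bcanon_eqI ab by blast
qed

lemma lin_on_bcanon: "lin_on (bcanon X L ` fms L) (le L)"
  by (rule lin_on_subset[OF well_canonD(5)[OF wc]]) (auto intro: bcanon_in_cfms)

lemma finite_bcanon: "finite (bcanon X L ` fms L)"
  by (rule finite_subset[OF _ well_canonD(6)[OF wc]]) (auto intro: bcanon_in_cfms)

lemma well_canon_LEx: "well_canon (LEx X L)"
  unfolding well_canon_def
proof (intro conjI ballI)
  show "antisymp_on (cfms (LEx X L)) (sub (LEx X L))"
    using antisymp_bsub by (auto intro!: antisymp_onI simp: cfms_quantifier sub_quantifier dest: antisymp_onD)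
  show "lin_on (cfms (LEx X L)) (le (LEx X L))"
    unfolding cfms_quantifier by (rule lin_on_image[OF lin_on_bcanon]) simp
qed (use finite_bcanon bcanon_in_fms bsub_bcanon in
    \<open>auto simp: canon_quantifier sub_quantifier cfms_quantifier\<close>)

lemma well_canon_LAll: "well_canon (LAll X L)"
  unfolding well_canon_def
proof (intro conjI ballI)
  show "antisymp_on (cfms (LAll X L)) (sub (LAll X L))"
    using antisymp_bsub by (auto intro!: antisymp_onI simp: cfms_quantifier sub_quantifier dest: antisymp_onD)
  show "lin_on (cfms (LAll X L)) (le (LAll X L))"
    unfolding cfms_quantifier by (rule lin_on_image[OF lin_on_bcanon]) simp
qed (use finite_bcanon bcanon_in_fms bsub_bcanon in
    \<open>auto simp: canon_quantifier sub_quantifier cfms_quantifier\<close>)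

text \<open>Universal and existential formulas are related in one direction only, by subsumption and
  by the order alike, so antisymmetry reduces to formulas with the same quantifier.\<close>

lemma well_canon_LExAll: "well_canon (LExAll X L)"
  unfolding well_canon_def
proof (intro conjI ballI)
  show "antisymp_on (cfms (LExAll X L)) (sub (LExAll X L))"
    using antisymp_bsub by (auto intro!: antisymp_onI simp: cfms_quantifier sub_quantifier dest: antisymp_onD)
  note lin = lin_onD[OF lin_on_bcanon]
  show "lin_on (cfms (LExAll X L)) (le (LExAll X L))"
  proof (rule lin_onI, goal_cases)
    case (1 \<phi>)
    then show ?case using lin(1) by (auto simp: cfms_quantifier)
  next
    case (2 \<phi> \<psi> \<chi>)
    then show ?case
      unfolding cfms_quantifier by (elim UnE imageE; simp; use lin(2) in blast)
  next
    case (3 \<phi> \<psi>)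
    then show ?case
      unfolding cfms_quantifier by (elim UnE imageE; simp; use lin(3) in blast)
  next
    case (4 \<phi> \<psi>)
    then show ?case
      unfolding cfms_quantifier by (elim UnE imageE; simp; use lin(4) in blast)
  qed
qed (use finite_bcanon bcanon_in_fms bsub_bcanon in
    \<open>auto simp: canon_quantifier sub_quantifier cfms_quantifier\<close>)

end

lemma well_canon: "bounded_lang S V L \<Longrightarrow> well_canon L"
proof (induction L)
  case (LBase A r)
  then show ?case by (rule well_canon_LBase)
next
  case (LOr L1 L2)
  then show ?case by (auto intro: well_canon_LOr)
next
  case (LAnd L1 L2)
  then show ?case by (auto intro: well_canon_LAnd)
next
  case (LBigOr k L)
  then show ?case by (auto intro: well_canon_LBigOr)
next
  case (LBigAnd L)
  then show ?case by (auto intro: well_canon_LBigAnd)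
next
  case (LEx X L)
  then show ?case using well_canon_LEx[of S V X L] by simp
next
  case (LAll X L)
  then show ?case using well_canon_LAll[of S V X L] by simp
next
  case (LExAll X L)
  then show ?case using well_canon_LExAll[of S V X L] by simp
qed

section \<open>The weaken operator\<close>

definition upper :: "('f, 'p, 'v) lang \<Rightarrow> ('f, 'p, 'v) fm \<Rightarrow> ('u, 'f, 'p, 'v) state \<Rightarrow> ('f, 'p, 'v) fm set" where
  "upper L \<phi> s = {\<chi> \<in> cfms L. sub L \<phi> \<chi> \<and> s \<Turnstile> \<chi>}"

lemma sub_sat_state:
  assumes "bounded_lang S V L" "s \<in> states S" "\<phi> \<in> fms L" "\<psi> \<in> fms L" "sub L \<phi> \<psi>" "s \<Turnstile> \<phi>"
  shows "s \<Turnstile> \<psi>"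
  using sub_sat[OF assms(1) _ assms(5,3,4)] assms(2,6) by (cases s) auto

text \<open>Canonicalization stays within a class of mutual subsumption, hence keeps a formula above
  \<open>\<phi>\<close> and true in \<open>s\<close>. Canonicalizing the formulas above
  \<open>\<phi>\<close> thus yields precisely the canonical ones among them.\<close>

lemma weaken_eq_minimals:
  assumes L: "bounded_lang S V L" and s: "s \<in> states S" and \<phi>: "\<phi> \<in> fms L"
  shows "weaken L \<phi> s = minimals (sub L) (upper L \<phi> s)"
proof -
  note wc = well_canon[OF L]
  note wcD = well_canonD[OF wc]
  have "{canon L \<psi> | \<psi>. \<psi> \<in> fms L \<and> sub L \<phi> \<psi> \<and> s \<Turnstile> \<psi>} = upper L \<phi> s"
  proof (intro equalityI subsetI)
    fix \<chi> assume "\<chi> \<in> {canon L \<psi> | \<psi>. \<psi> \<in> fms L \<and> sub L \<phi> \<psi> \<and> s \<Turnstile> \<psi>}"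
    then obtain \<psi> where \<psi>: "\<psi> \<in> fms L" "sub L \<phi> \<psi>" "s \<Turnstile> \<psi>" "\<chi> = canon L \<psi>" by blast
    then show "\<chi> \<in> upper L \<phi> s"
      using sub_canon_iff(1)[OF L wc \<phi> \<psi>(1)] sub_sat_state[OF L s \<psi>(1) wcD(1)[OF \<psi>(1)] wcD(2)[OF \<psi>(1)]]
      by (simp add: upper_def canon_in_cfms)
  next
    fix \<chi> assume "\<chi> \<in> upper L \<phi> s"
    moreover from this have "canon L \<chi> = \<chi>" "\<chi> \<in> fms L"
      using canon_cfms[OF L wc] cfms_subset_fms[OF wc] by (auto simp: upper_def)
    ultimately show "\<chi> \<in> {canon L \<psi> | \<psi>. \<psi> \<in> fms L \<and> sub L \<phi> \<psi> \<and> s \<Turnstile> \<psi>}"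
      by (force simp: upper_def)
  qed
  then show ?thesis by (simp add: weaken_def)
qed

lemma weakenD:
  assumes "bounded_lang S V L" "s \<in> states S" "\<phi> \<in> fms L" "\<chi> \<in> weaken L \<phi> s"
  shows "\<chi> \<in> cfms L" "\<chi> \<in> fms L" "sub L \<phi> \<chi>" "s \<Turnstile> \<chi>"
  using assms(4) cfms_subset_fms[OF well_canon[OF assms(1)]]
  unfolding weaken_eq_minimals[OF assms(1-3)] by (auto simp: minimals_def upper_def)

lemma weaken_minimal:
  "\<chi> \<in> weaken L \<phi> s \<Longrightarrow> \<chi>' \<in> weaken L \<phi> s \<Longrightarrow> sub L \<chi>' \<chi> \<Longrightarrow> sub L \<chi> \<chi>'"
  by (simp add: weaken_def minimals_def)

lemma weaken_eqI:
  assumes "bounded_lang S V L" "s \<in> states S" "\<phi> \<in> fms L"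
    and "\<And>\<chi>. \<chi> \<in> W \<Longrightarrow> \<chi> \<in> cfms L \<and> sub L \<phi> \<chi> \<and> s \<Turnstile> \<chi>"
    and "\<And>\<chi>. \<chi> \<in> cfms L \<Longrightarrow> \<chi> \<in> fms L \<Longrightarrow> sub L \<phi> \<chi> \<Longrightarrow> s \<Turnstile> \<chi> \<Longrightarrow> \<exists>w\<in>W. sub L w \<chi>"
  shows "weaken L \<phi> s = minimals (sub L) W"
proof -
  note wc = well_canon[OF assms(1)]
  have up: "upper L \<phi> s \<subseteq> cfms L" by (auto simp: upper_def)
  show ?thesis
    unfolding weaken_eq_minimals[OF assms(1-3)]
  proof (rule minimals_eq_of_dense)
    show "transp_on (upper L \<phi> s) (sub L)"
      using transp_cfms_sub[OF assms(1) wc] up by (rule transp_on_subset)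
    show "antisymp_on (upper L \<phi> s) (sub L)"
      using antisymp_cfms_sub[OF wc] up by (rule antisymp_on_subset)
    show "W \<subseteq> upper L \<phi> s" using assms(4) by (auto simp: upper_def)
    show "\<exists>w\<in>W. sub L w \<chi>" if "\<chi> \<in> upper L \<phi> s" for \<chi>
      using that assms(5) cfms_subset_fms[OF wc] by (auto simp: upper_def)
  qed
qed

text \<open>The formula \<open>\<psi>\<close> may be arbitrary: one descends from its canonical form
  to a minimal element. This is how the recursive equations obtain weakenings of components below
  given subformulas.\<close>

lemma weaken_below:
  assumes L: "bounded_lang S V L" and s: "s \<in> states S" and fms: "\<phi> \<in> fms L" "\<psi> \<in> fms L"
    and sub: "sub L \<phi> \<psi>" and sat: "s \<Turnstile> \<psi>"
  shows "\<exists>\<chi>\<in>weaken L \<phi> s. sub L \<chi> \<psi>"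
proof -
  note wc = well_canon[OF L]
  note wcD = well_canonD[OF wc]
  have up: "upper L \<phi> s \<subseteq> cfms L" by (auto simp: upper_def)
  have "canon L \<psi> \<in> upper L \<phi> s"
    using sub_canon_iff(1)[OF L wc fms] sub sat canon_in_cfms[OF fms(2)]
      sub_sat_state[OF L s fms(2) wcD(1)[OF fms(2)] wcD(2)[OF fms(2)]]
    by (simp add: upper_def)
  then obtain \<chi> where \<chi>: "\<chi> \<in> weaken L \<phi> s" "sub L \<chi> (canon L \<psi>)"
    using ex_minimal_below[of "upper L \<phi> s" "sub L"] finite_subset[OF up wcD(6)]
      reflp_on_subset[OF reflp_cfms_sub[OF wc] up] transp_on_subset[OF transp_cfms_sub[OF L wc] up]
    unfolding weaken_eq_minimals[OF L s fms(1)] by blast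
  then show ?thesis
    using sub_canon_iff(1)[OF L wc weakenD(2)[OF L s fms(1) \<chi>(1)] fms(2)] by blast
qed

lemma minimals_empty [simp]: "minimals R {} = {}"
  by (simp add: minimals_def)

lemma minimals_singleton [simp]: "minimals R {x} = {x}"
  by (auto simp: minimals_def)

lemma minimals_antichain:
  "(\<And>x y. x \<in> W \<Longrightarrow> y \<in> W \<Longrightarrow> R y x \<Longrightarrow> R x y) \<Longrightarrow> minimals R W = W"
  by (auto simp: minimals_def)

section \<open>Recursive equations for base languages and binary connectives\<close>

lemma weaken_sat:
  assumes L: "bounded_lang S V L" and s: "s \<in> states S" and \<phi>: "\<phi> \<in> cfms L" and sat: "s \<Turnstile> \<phi>"
  shows "weaken L \<phi> s = {\<phi>}"
proof -
  have fms: "\<phi> \<in> fms L" using \<phi> cfms_subset_fms[OF well_canon[OF L]] by blast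
  have "weaken L \<phi> s = minimals (sub L) {\<phi>}"
    by (rule weaken_eqI[OF L s fms]) (use \<phi> sat sub_refl[OF fms] in auto)
  then show ?thesis by simp
qed

text \<open>Only \<open>Bot\<close> has something else above it. Distinct members of the result are
  incomparable, since the sole comparison would involve \<open>Bot\<close>, which no state
  satisfies.\<close>

lemma weaken_LBase:
  assumes L: "bounded_lang S V (LBase A r)" and s: "s \<in> states S" and \<phi>: "\<phi> \<in> fms (LBase A r)"
    and unsat: "\<not> s \<Turnstile> \<phi>"
  shows "weaken (LBase A r) \<phi> s = (if \<phi> = Bot then {\<psi> \<in> A. s \<Turnstile> \<psi>} else {})"
proof -
  have bot: "\<not> s \<Turnstile> Bot" by (cases s) simp
  let ?W = "if \<phi> = Bot then {\<psi> \<in> A. s \<Turnstile> \<psi>} else {}"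
  have "weaken (LBase A r) \<phi> s = minimals (sub (LBase A r)) ?W"
    by (rule weaken_eqI[OF L s \<phi>])
      (use unsat bot in \<open>auto simp: cfms_def split: if_splits\<close>)
  also have "\<dots> = ?W" by (rule minimals_antichain) (use bot in \<open>auto split: if_splits\<close>)
  finally show ?thesis .
qed

lemma sat_Or: "s \<Turnstile> Or \<phi> \<psi> \<longleftrightarrow> s \<Turnstile> \<phi> \<or> s \<Turnstile> \<psi>"
  by (cases s) simp

lemma sat_And: "s \<Turnstile> And \<phi> \<psi> \<longleftrightarrow> s \<Turnstile> \<phi> \<and> s \<Turnstile> \<psi>"
  by (cases s) simp

lemma sat_BigOr: "s \<Turnstile> BigOr \<phi>s \<longleftrightarrow> (\<exists>\<phi>\<in>set \<phi>s. s \<Turnstile> \<phi>)"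
  by (cases s) simp

lemma sat_BigAnd: "s \<Turnstile> BigAnd \<phi>s \<longleftrightarrow> (\<forall>\<phi>\<in>set \<phi>s. s \<Turnstile> \<phi>)"
  by (cases s) simp

lemma Or_in_cfms: "Or \<phi> \<psi> \<in> cfms (LOr L1 L2) \<longleftrightarrow> \<phi> \<in> cfms L1 \<and> \<psi> \<in> cfms L2"
  by (auto simp: cfms_LOr)

lemma And_in_cfms: "And \<phi> \<psi> \<in> cfms (LAnd L1 L2) \<longleftrightarrow> \<phi> \<in> cfms L1 \<and> \<psi> \<in> cfms L2"
  by (auto simp: cfms_LAnd)

text \<open>One true disjunct suffices, so the cheapest repair changes one side and leaves the other
  as it is.\<close>

lemma weaken_LOr:
  assumes L: "bounded_lang S V (LOr L1 L2)" and s: "s \<in> states S"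
    and \<phi>: "\<phi>1 \<in> cfms L1" "\<phi>2 \<in> cfms L2" and unsat: "\<not> s \<Turnstile> Or \<phi>1 \<phi>2"
  shows "weaken (LOr L1 L2) (Or \<phi>1 \<phi>2) s =
    {Or \<psi> \<phi>2 | \<psi>. \<psi> \<in> weaken L1 \<phi>1 s} \<union> {Or \<phi>1 \<psi> | \<psi>. \<psi> \<in> weaken L2 \<phi>2 s}"
proof -
  let ?L = "LOr L1 L2"
  let ?W = "{Or \<psi> \<phi>2 | \<psi>. \<psi> \<in> weaken L1 \<phi>1 s} \<union> {Or \<phi>1 \<psi> | \<psi>. \<psi> \<in> weaken L2 \<phi>2 s}"
  have L1: "bounded_lang S V L1" and L2: "bounded_lang S V L2" using L by auto
  have fms: "\<phi>1 \<in> fms L1" "\<phi>2 \<in> fms L2"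
    using \<phi> cfms_subset_fms well_canon[OF L1] well_canon[OF L2] by auto
  note D1 = weakenD[OF L1 s fms(1)] and D2 = weakenD[OF L2 s fms(2)]
  have "weaken ?L (Or \<phi>1 \<phi>2) s = minimals (sub ?L) ?W"
  proof (rule weaken_eqI[OF L s])
    show "Or \<phi>1 \<phi>2 \<in> fms ?L" using fms by simp
    show "\<chi> \<in> cfms ?L \<and> sub ?L (Or \<phi>1 \<phi>2) \<chi> \<and> s \<Turnstile> \<chi>" if "\<chi> \<in> ?W" for \<chi>
      using that
    proof
      assume "\<chi> \<in> {Or \<psi> \<phi>2 | \<psi>. \<psi> \<in> weaken L1 \<phi>1 s}"
      then obtain \<psi> where \<psi>: "\<chi> = Or \<psi> \<phi>2" "\<psi> \<in> weaken L1 \<phi>1 s" by blast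
      then show ?thesis
        using D1[OF \<psi>(2)] \<phi>(2) sub_refl[OF fms(2)] by (simp add: sat_Or Or_in_cfms)
    next
      assume "\<chi> \<in> {Or \<phi>1 \<psi> | \<psi>. \<psi> \<in> weaken L2 \<phi>2 s}"
      then obtain \<psi> where \<psi>: "\<chi> = Or \<phi>1 \<psi>" "\<psi> \<in> weaken L2 \<phi>2 s" by blast
      then show ?thesis
        using D2[OF \<psi>(2)] \<phi>(1) sub_refl[OF fms(1)] by (simp add: sat_Or Or_in_cfms)
    qed
    show "\<exists>w\<in>?W. sub ?L w \<chi>"
      if \<chi>: "\<chi> \<in> fms ?L" "sub ?L (Or \<phi>1 \<phi>2) \<chi>" "s \<Turnstile> \<chi>" for \<chi>
    proof -
      obtain \<psi>1 \<psi>2 where \<psi>: "\<chi> = Or \<psi>1 \<psi>2" "\<psi>1 \<in> fms L1" "\<psi>2 \<in> fms L2" "sub L1 \<phi>1 \<psi>1" "sub L2 \<phi>2 \<psi>2"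
        using \<chi>(1,2) by auto
      from \<chi>(3) consider "s \<Turnstile> \<psi>1" | "s \<Turnstile> \<psi>2" by (auto simp: \<psi>(1) sat_Or)
      then show ?thesis
      proof cases
        case 1
        then obtain w where "w \<in> weaken L1 \<phi>1 s" "sub L1 w \<psi>1"
          using weaken_below[OF L1 s fms(1) \<psi>(2,4)] by blast
        then show ?thesis using \<psi> by (intro bexI[of _ "Or w \<phi>2"]) auto
      next
        case 2
        then obtain w where "w \<in> weaken L2 \<phi>2 s" "sub L2 w \<psi>2"
          using weaken_below[OF L2 s fms(2) \<psi>(3,5)] by blast
        then show ?thesis using \<psi> by (intro bexI[of _ "Or \<phi>1 w"]) auto
      qed
    qed
  qed
  also have "\<dots> = ?W"
  proof (rule minimals_antichain)
    fix x y assume xy: "x \<in> ?W" "y \<in> ?W" "sub ?L y x"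
    \<comment> \<open>A repaired side is true in \<open>s\<close>, the old side is false, and
      subsumption preserves truth. Hence formulas repaired on different sides are never
      comparable.\<close>
    have n1: "\<not> sub L1 \<psi> \<phi>1" if "\<psi> \<in> weaken L1 \<phi>1 s" for \<psi>
      using sub_sat_state[OF L1 s D1(2)[OF that] fms(1) _ D1(4)[OF that]] unsat by (auto simp: sat_Or)
    have n2: "\<not> sub L2 \<psi> \<phi>2" if "\<psi> \<in> weaken L2 \<phi>2 s" for \<psi>
      using sub_sat_state[OF L2 s D2(2)[OF that] fms(2) _ D2(4)[OF that]] unsat by (auto simp: sat_Or)
    consider
        (1) \<psi> \<psi>' where "x = Or \<psi> \<phi>2" "\<psi> \<in> weaken L1 \<phi>1 s" "y = Or \<psi>' \<phi>2" "\<psi>' \<in> weaken L1 \<phi>1 s"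
      | (2) \<psi> \<psi>' where "x = Or \<psi> \<phi>2" "y = Or \<phi>1 \<psi>'" "\<psi>' \<in> weaken L2 \<phi>2 s"
      | (3) \<psi> \<psi>' where "x = Or \<phi>1 \<psi>" "y = Or \<psi>' \<phi>2" "\<psi>' \<in> weaken L1 \<phi>1 s"
      | (4) \<psi> \<psi>' where "x = Or \<phi>1 \<psi>" "\<psi> \<in> weaken L2 \<phi>2 s" "y = Or \<phi>1 \<psi>'" "\<psi>' \<in> weaken L2 \<phi>2 s"
      using xy(1,2) by blast
    then show "sub ?L x y"
    proof cases
      case 1
      then show ?thesis using xy(3) weaken_minimal[OF 1(2,4)] sub_refl[OF fms(2)] by simp
    next
      case 2
      then show ?thesis using xy(3) n2[OF 2(3)] by simp
    next
      case 3
      then show ?thesis using xy(3) n1[OF 3(3)] by simp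
    next
      case 4
      then show ?thesis using xy(3) weaken_minimal[OF 4(2,4)] sub_refl[OF fms(1)] by simp
    qed
  qed
  finally show ?thesis .
qed

text \<open>Both conjuncts have to become true and can be repaired independently; minimal elements
  of a product order are pairs of minimal elements.\<close>

lemma weaken_LAnd:
  assumes L: "bounded_lang S V (LAnd L1 L2)" and s: "s \<in> states S"
    and \<phi>: "\<phi>1 \<in> fms L1" "\<phi>2 \<in> fms L2"
  shows "weaken (LAnd L1 L2) (And \<phi>1 \<phi>2) s =
    {And \<psi>1 \<psi>2 | \<psi>1 \<psi>2. \<psi>1 \<in> weaken L1 \<phi>1 s \<and> \<psi>2 \<in> weaken L2 \<phi>2 s}"
proof -
  let ?L = "LAnd L1 L2"
  let ?W = "{And \<psi>1 \<psi>2 | \<psi>1 \<psi>2. \<psi>1 \<in> weaken L1 \<phi>1 s \<and> \<psi>2 \<in> weaken L2 \<phi>2 s}"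
  have L1: "bounded_lang S V L1" and L2: "bounded_lang S V L2" using L by auto
  note D1 = weakenD[OF L1 s \<phi>(1)] and D2 = weakenD[OF L2 s \<phi>(2)]
  have "weaken ?L (And \<phi>1 \<phi>2) s = minimals (sub ?L) ?W"
  proof (rule weaken_eqI[OF L s])
    show "And \<phi>1 \<phi>2 \<in> fms ?L" using \<phi> by simp
    show "\<chi> \<in> cfms ?L \<and> sub ?L (And \<phi>1 \<phi>2) \<chi> \<and> s \<Turnstile> \<chi>" if \<chi>: "\<chi> \<in> ?W" for \<chi>
    proof -
      from \<chi> obtain \<psi>1 \<psi>2 where \<psi>: "\<chi> = And \<psi>1 \<psi>2" "\<psi>1 \<in> weaken L1 \<phi>1 s" "\<psi>2 \<in> weaken L2 \<phi>2 s"
        by blast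
      then show ?thesis
        using D1[OF \<psi>(2)] D2[OF \<psi>(3)] by (simp add: sat_And And_in_cfms)
    qed
    show "\<exists>w\<in>?W. sub ?L w \<chi>"
      if \<chi>: "\<chi> \<in> fms ?L" "sub ?L (And \<phi>1 \<phi>2) \<chi>" "s \<Turnstile> \<chi>" for \<chi>
    proof -
      obtain \<psi>1 \<psi>2 where \<psi>: "\<chi> = And \<psi>1 \<psi>2" "\<psi>1 \<in> fms L1" "\<psi>2 \<in> fms L2" "sub L1 \<phi>1 \<psi>1" "sub L2 \<phi>2 \<psi>2"
        using \<chi>(1,2) by auto
      have sat: "s \<Turnstile> \<psi>1" "s \<Turnstile> \<psi>2" using \<chi>(3) by (auto simp: \<psi>(1) sat_And)
      obtain w1 where "w1 \<in> weaken L1 \<phi>1 s" "sub L1 w1 \<psi>1"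
        using weaken_below[OF L1 s \<phi>(1) \<psi>(2,4) sat(1)] by blast
      moreover obtain w2 where "w2 \<in> weaken L2 \<phi>2 s" "sub L2 w2 \<psi>2"
        using weaken_below[OF L2 s \<phi>(2) \<psi>(3,5) sat(2)] by blast
      ultimately show ?thesis using \<psi>(1) by (intro bexI[of _ "And w1 w2"]) auto
    qed
  qed
  also have "\<dots> = ?W"
    using weaken_minimal[of _ L1 \<phi>1 s] weaken_minimal[of _ L2 \<phi>2 s]
    by (intro minimals_antichain) auto
  finally show ?thesis .
qed

section \<open>Recursive equations for sequence connectives\<close>

lemma emb_update:
  assumes "i < length xs" "\<And>x. x \<in> set xs \<Longrightarrow> R x x" "R (xs ! i) y"
  shows "emb R xs (xs[i := y])"
  using assms by (intro emb_map) (auto simp: list_all2_conv_all_nth nth_list_update)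

lemma emb_append:
  assumes "\<And>x. x \<in> set xs \<Longrightarrow> R x x"
  shows "emb R xs (xs @ ys)"
  unfolding emb_def using assms by (intro exI[of _ id]) (auto simp: nth_append)

text \<open>A satisfied formula above the disjunction has a true disjunct. If that disjunct is the
  match of some \<open>\<phi>s ! i\<close>, weakening this entry suffices; otherwise there is room
  for a new entry, obtained by weakening the bottom. The results can be comparable: from
  \<open>[Bot]\<close> over a base language, \<open>[p]\<close> arises by replacement and lies below
  the sorted list of \<open>Bot\<close> and \<open>p\<close>, which arises by appending if
  \<open>k\<close> is at least 2.\<close>

lemma weaken_LBigOr:
  assumes K: "bounded_lang S V (LBigOr k L)" and s: "s \<in> states S"
    and \<phi>s: "set \<phi>s \<subseteq> cfms L" "length \<phi>s \<le> k"
  shows "weaken (LBigOr k L) (BigOr \<phi>s) s = minimals (sub (LBigOr k L))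
    ({BigOr (sort_list (le L) (\<phi>s[i := \<psi>])) | i \<psi>. i < length \<phi>s \<and> \<psi> \<in> weaken L (\<phi>s ! i) s} \<union>
     {BigOr (sort_list (le L) (\<phi>s @ [\<psi>])) | \<psi>. \<psi> \<in> weaken L (bottom L) s \<and> length \<phi>s < k})"
    (is "_ = minimals _ (?W1 \<union> ?W2)")
proof (rule weaken_eqI[OF K s])
  let ?K = "LBigOr k L"
  have L: "bounded_lang S V L" using K by simp
  note wc = well_canon[OF L]
  note lin = well_canonD(5)[OF wc]
  note c_fms = cfms_subset_fms[OF wc]
  have \<phi>s_fms: "set \<phi>s \<subseteq> fms L" using \<phi>s(1) c_fms by blast
  then show fms: "BigOr \<phi>s \<in> fms ?K" using \<phi>s(2) by simp
  have \<phi>i: "\<phi>s ! i \<in> fms L" if "i < length \<phi>s" for i using \<phi>s_fms that by (auto simp: subset_iff)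
  have refl: "sub L \<phi> \<phi>" if "\<phi> \<in> set \<phi>s" for \<phi> using \<phi>s_fms that sub_refl by blast
  have sorted: "BigOr (sort_list (le L) xs) \<in> cfms ?K \<and> sub ?K (BigOr \<phi>s) (BigOr (sort_list (le L) xs))
      \<and> s \<Turnstile> BigOr (sort_list (le L) xs)"
    if xs: "set xs \<subseteq> cfms L" "length xs \<le> k" "emb (sub L) \<phi>s xs" "\<exists>x\<in>set xs. s \<Turnstile> x" for xs
  proof (intro conjI)
    show cfms: "BigOr (sort_list (le L) xs) \<in> cfms ?K" by (rule BigOr_in_cfms[OF L wc xs(1,2)])
    have "sub ?K (BigOr \<phi>s) (BigOr xs)" using xs(3) by (simp add: sub_BigOr)
    moreover have "BigOr xs \<in> fms ?K" using xs(1,2) c_fms by auto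
    moreover have "BigOr (sort_list (le L) xs) \<in> fms ?K"
      using cfms cfms_subset_fms[OF well_canon[OF K]] by blast
    ultimately show "sub ?K (BigOr \<phi>s) (BigOr (sort_list (le L) xs))"
      using sub_trans[OF K _ sub_BigOr_sort_list(1)[OF lin c_fms xs(1)] fms] by blast
    show "s \<Turnstile> BigOr (sort_list (le L) xs)"
      using xs(4) by (simp add: sat_BigOr set_sort_list[OF lin xs(1)])
  qed
  show "\<chi> \<in> cfms ?K \<and> sub ?K (BigOr \<phi>s) \<chi> \<and> s \<Turnstile> \<chi>" if "\<chi> \<in> ?W1 \<union> ?W2" for \<chi>
    using that
  proof
    assume "\<chi> \<in> ?W1"
    then obtain i \<psi> where i: "i < length \<phi>s" "\<psi> \<in> weaken L (\<phi>s ! i) s"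
      "\<chi> = BigOr (sort_list (le L) (\<phi>s[i := \<psi>]))" by blast
    note D = weakenD[OF L s \<phi>i[OF i(1)] i(2)]
    show ?thesis
      unfolding i(3)
    proof (rule sorted)
      show "set (\<phi>s[i := \<psi>]) \<subseteq> cfms L"
        using set_update_subset_insert[of \<phi>s i \<psi>] \<phi>s(1) D(1) by blast
      show "emb (sub L) \<phi>s (\<phi>s[i := \<psi>])" using i(1) refl D(3) by (rule emb_update)
      show "\<exists>x\<in>set (\<phi>s[i := \<psi>]). s \<Turnstile> x" using set_update_memI[OF i(1)] D(4) by blast
    qed (use \<phi>s(2) in simp)
  next
    assume "\<chi> \<in> ?W2"
    then obtain \<psi> where \<psi>: "\<psi> \<in> weaken L (bottom L) s" "length \<phi>s < k"
      "\<chi> = BigOr (sort_list (le L) (\<phi>s @ [\<psi>]))" by blast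
    note D = weakenD[OF L s bottom_in_fms \<psi>(1)]
    show ?thesis
      unfolding \<psi>(3) by (rule sorted) (use \<phi>s(1) \<psi>(2) D refl in \<open>auto intro: emb_append\<close>)
  qed
  show "\<exists>w\<in>?W1 \<union> ?W2. sub ?K w \<chi>"
    if \<chi>: "\<chi> \<in> cfms ?K" "\<chi> \<in> fms ?K" "sub ?K (BigOr \<phi>s) \<chi>" "s \<Turnstile> \<chi>" for \<chi>
  proof -
    from \<chi>(2,3) obtain \<psi>s m where eq: "\<chi> = BigOr \<psi>s" and \<psi>s: "set \<psi>s \<subseteq> fms L" "length \<psi>s \<le> k"
      and m: "inj_on m {..<length \<phi>s}" "m ` {..<length \<phi>s} \<subseteq> {..<length \<psi>s}"
        "\<forall>i<length \<phi>s. sub L (\<phi>s ! i) (\<psi>s ! m i)"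
      by (auto simp: sub_BigOr emb_def)
    from \<chi>(4) obtain j where j: "j < length \<psi>s" "s \<Turnstile> \<psi>s ! j"
      by (auto simp: eq sat_BigOr in_set_conv_nth)
    have \<psi>j: "\<psi>s ! j \<in> fms L" using \<psi>s(1) j(1) by (auto simp: subset_iff)
    have sorted_below: "sub ?K (BigOr (sort_list (le L) xs)) \<chi>"
      if xs: "set xs \<subseteq> cfms L" "length xs \<le> k" "emb (sub L) xs \<psi>s" for xs
    proof -
      have "BigOr (sort_list (le L) xs) \<in> fms ?K"
        using BigOr_in_cfms[OF L wc xs(1,2)] cfms_subset_fms[OF well_canon[OF K]] by blast
      moreover have "BigOr xs \<in> fms ?K" using xs(1,2) c_fms by auto
      moreover have "sub ?K (BigOr xs) \<chi>" using xs(3) by (simp add: sub_BigOr eq)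
      ultimately show ?thesis
        using sub_trans[OF K sub_BigOr_sort_list(2)[OF lin c_fms xs(1)]] \<chi>(2) by blast
    qed
    show ?thesis
    proof (cases "j \<in> m ` {..<length \<phi>s}")
      case True
      then obtain i where i: "i < length \<phi>s" "j = m i" by auto
      obtain w where w: "w \<in> weaken L (\<phi>s ! i) s" "sub L w (\<psi>s ! j)"
        using weaken_below[OF L s \<phi>i[OF i(1)] \<psi>j _ j(2)] m(3) i by blast
      note D = weakenD[OF L s \<phi>i[OF i(1)] w(1)]
      have "emb (sub L) (\<phi>s[i := w]) \<psi>s"
        unfolding emb_def using m w(2) i by (intro exI[of _ m]) (auto simp: nth_list_update)
      then have "sub ?K (BigOr (sort_list (le L) (\<phi>s[i := w]))) \<chi>"
        using set_update_subset_insert[of \<phi>s i w] \<phi>s D(1) by (intro sorted_below) auto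
      then show ?thesis using i(1) w(1) by blast
    next
      case False
      let ?n = "length \<phi>s"
      \<comment> \<open>Counting: a true disjunct outside the image of \<open>m\<close> makes
        \<open>\<psi>s\<close> strictly longer than \<open>\<phi>s\<close>, so appending respects
        the bound \<open>k\<close>.\<close>
      have "insert j (m ` {..<?n}) \<subseteq> {..<length \<psi>s}" using m(2) j(1) by auto
      from card_mono[OF _ this] have "Suc ?n \<le> length \<psi>s"
        using False m(1) by (simp add: card_image)
      then have n: "?n < k" using \<psi>s(2) by simp
      obtain w where w: "w \<in> weaken L (bottom L) s" "sub L w (\<psi>s ! j)"
        using weaken_below[OF L s bottom_in_fms \<psi>j bottom_sub[OF \<psi>j] j(2)] by blast
      note D = weakenD[OF L s bottom_in_fms w(1)]
      have "inj_on (m(?n := j)) {..<Suc ?n}"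
        using m(1) False by (auto simp: lessThan_Suc inj_on_def)
      moreover have "m i < length \<psi>s" if "i < ?n" for i using m(2) that by auto
      ultimately have "emb (sub L) (\<phi>s @ [w]) \<psi>s"
        unfolding emb_def using m(3) w(2) j(1)
        by (intro exI[of _ "m(?n := j)"]) (auto simp: nth_append less_Suc_eq)
      then have "sub ?K (BigOr (sort_list (le L) (\<phi>s @ [w]))) \<chi>"
        using \<phi>s D(1) n by (intro sorted_below) auto
      then show ?thesis using n w(1) by blast
    qed
  qed
qed

text \<open>Every conjunct of a satisfied formula above \<open>BigAnd \<phi>s\<close> lies above
  some weakening of some \<open>\<phi>s\<close> entry, so the conjunction of all minimal such
  weakenings is the least candidate. If there are no weakenings at all, no candidate exists, as the
  empty conjunction is not in the language.\<close>

lemma weaken_LBigAnd: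
  assumes K: "bounded_lang S V (LBigAnd L)" and s: "s \<in> states S"
    and \<phi>s: "set \<phi>s \<subseteq> fms L" "\<phi>s \<noteq> []"
  shows "weaken (LBigAnd L) (BigAnd \<phi>s) s =
    (let W = \<Union>\<phi>'\<in>set \<phi>s. weaken L \<phi>' s
     in if W = {} then {} else {BigAnd (sort_set (le L) (minimals (sub L) W))})"
proof -
  let ?K = "LBigAnd L"
  let ?W = "\<Union>\<phi>'\<in>set \<phi>s. weaken L \<phi>' s"
  let ?B = "BigAnd (sort_set (le L) (minimals (sub L) ?W))"
  have L: "bounded_lang S V L" using K by simp
  note wc = well_canon[OF L]
  have fms: "BigAnd \<phi>s \<in> fms ?K" using \<phi>s by simp
  have D: "\<chi> \<in> cfms L" "\<exists>\<phi>\<in>set \<phi>s. sub L \<phi> \<chi>" "s \<Turnstile> \<chi>" if "\<chi> \<in> ?W" for \<chi>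
    using that weakenD[OF L s] \<phi>s(1) by blast+
  then have W: "?W \<subseteq> cfms L" by blast
  then have finW: "finite ?W" using well_canonD(6)[OF wc] finite_subset by blast
  have W_fms: "?W \<subseteq> fms L" using W cfms_subset_fms[OF wc] by blast
  have below: "\<exists>w\<in>?W. sub L w \<psi>"
    if "BigAnd \<psi>s \<in> fms ?K" "sub ?K (BigAnd \<phi>s) (BigAnd \<psi>s)" "s \<Turnstile> BigAnd \<psi>s" "\<psi> \<in> set \<psi>s" for \<psi>s \<psi>
  proof -
    from that obtain \<phi>' where "\<phi>' \<in> set \<phi>s" "sub L \<phi>' \<psi>" by (auto simp: sub_BigAnd cover_def)
    moreover have "\<psi> \<in> fms L" "s \<Turnstile> \<psi>" using that by (auto simp: sat_BigAnd)
    ultimately show ?thesis using weaken_below[OF L s, of \<phi>' \<psi>] \<phi>s(1) by blast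
  qed
  have "weaken ?K (BigAnd \<phi>s) s = minimals (sub ?K) (if ?W = {} then {} else {?B})"
  proof (rule weaken_eqI[OF K s fms])
    fix \<chi> assume "\<chi> \<in> (if ?W = {} then {} else {?B})"
    then have \<chi>: "\<chi> = ?B" and ne: "?W \<noteq> {}" by (auto split: if_splits)
    have sub: "minimals (sub L) ?W \<subseteq> cfms L" "finite (minimals (sub L) ?W)"
      using minimals_subset[of "sub L" ?W] W finW by (auto intro: finite_subset)
    note set_m = set_sort_set[OF well_canonD(5)[OF wc] sub]
    obtain ws where ws: "set ws = ?W" using finite_list[OF finW] by blast
    have "canon L ` ?W = ?W" using canon_cfms[OF L wc] W by force
    \<comment> \<open>Membership in \<open>cfms\<close> comes from presenting \<open>?B\<close> as a
      canonical form: the members of \<open>?W\<close> are canonical already, so canonicalization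
      only drops non-minimal ones and sorts.\<close>
    then have "?B = canon ?K (BigAnd ws)" by (simp add: canon_BigAnd ws)
    moreover have "BigAnd ws \<in> fms ?K" using ws ne W_fms by auto
    ultimately have "?B \<in> cfms ?K" by (metis canon_in_cfms)
    moreover have "cover (sub L) (set \<phi>s) (minimals (sub L) ?W)"
      using D(2) minimals_subset[of "sub L" ?W] unfolding cover_def by blast
    then have "sub ?K (BigAnd \<phi>s) ?B" by (simp add: sub_BigAnd set_m)
    moreover have "s \<Turnstile> ?B"
      unfolding sat_BigAnd set_m using D(3) minimals_subset[of "sub L" ?W] by blast
    ultimately show "\<chi> \<in> cfms ?K \<and> sub ?K (BigAnd \<phi>s) \<chi> \<and> s \<Turnstile> \<chi>" by (simp add: \<chi>)
  next
    fix \<chi> assume \<chi>: "\<chi> \<in> fms ?K" "sub ?K (BigAnd \<phi>s) \<chi>" "s \<Turnstile> \<chi>"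
    then obtain \<psi>s where \<psi>s: "\<chi> = BigAnd \<psi>s" "set \<psi>s \<subseteq> fms L" "\<psi>s \<noteq> []" by auto
    note below = below[OF \<chi>[unfolded \<psi>s(1)]]
    \<comment> \<open>The formula \<open>\<chi>\<close> has at least one conjunct, and that conjunct
      lies above a member of \<open>?W\<close>.\<close>
    have ne: "?W \<noteq> {}" using below[of "hd \<psi>s"] \<psi>s(3) by auto
    have sub: "minimals (sub L) ?W \<subseteq> cfms L" "finite (minimals (sub L) ?W)"
      using minimals_subset[of "sub L" ?W] W finW by (auto intro: finite_subset)
    have "cover (sub L) (minimals (sub L) ?W) (set \<psi>s)"
    proof (rule cover_trans[OF transp_sub[OF L] _ W_fms \<psi>s(2)])
      show "cover (sub L) (minimals (sub L) ?W) ?W"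
        by (rule cover_minimals(2)[OF reflp_sub transp_sub[OF L] finW W_fms])
      show "cover (sub L) ?W (set \<psi>s)" using below by (simp add: cover_def)
      show "minimals (sub L) ?W \<subseteq> fms L" using sub(1) cfms_subset_fms[OF wc] by blast
    qed
    then have "sub ?K ?B \<chi>"
      unfolding \<psi>s(1) by (simp add: sub_BigAnd set_sort_set[OF well_canonD(5)[OF wc] sub])
    then show "\<exists>w\<in>if ?W = {} then {} else {?B}. sub ?K w \<chi>" using ne by simp
  qed
  also have "\<dots> = (if ?W = {} then {} else {?B})"
    by (simp split: if_split)
  finally show ?thesis by (simp only: Let_def)
qed

section \<open>Recursive equations for quantifiers\<close>

lemma weaken_LEx:
  assumes K: "bounded_lang S V (LEx X L)" and s: "(M, \<mu>) \<in> states S" and \<phi>: "\<phi> \<in> fms L"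
  shows "weaken (LEx X L) (Ex X \<phi>) (M, \<mu>) = minimals (sub (LEx X L))
    {canon (LEx X L) (Ex X \<psi>) | \<nu> \<psi>. \<nu> \<in> assigns X (univ M) \<and> \<psi> \<in> weaken L \<phi> (M, \<mu> ++ \<nu>)}"
proof (rule weaken_eqI[OF K s])
  let ?K = "LEx X L"
  let ?W = "{canon ?K (Ex X \<psi>) | \<nu> \<psi>. \<nu> \<in> assigns X (univ M) \<and> \<psi> \<in> weaken L \<phi> (M, \<mu> ++ \<nu>)}"
  have L: "bounded_lang S V L" using K by simp
  note wcK = well_canon[OF K]
  show fms: "Ex X \<phi> \<in> fms ?K" using \<phi> by simp
  show "\<chi> \<in> cfms ?K \<and> sub ?K (Ex X \<phi>) \<chi> \<and> (M, \<mu>) \<Turnstile> \<chi>" if \<chi>: "\<chi> \<in> ?W" for \<chi>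
  proof -
    from \<chi> obtain \<nu> \<psi> where \<psi>: "\<chi> = canon ?K (Ex X \<psi>)" "\<nu> \<in> assigns X (univ M)"
      "\<psi> \<in> weaken L \<phi> (M, \<mu> ++ \<nu>)" by blast
    note D = weakenD[OF L states_map_add[OF s \<psi>(2)] \<phi> \<psi>(3)]
    have \<psi>_fms: "Ex X \<psi> \<in> fms ?K" using D(2) by simp
    have "sub ?K (Ex X \<phi>) (Ex X \<psi>)" using sub_imp_bsub[OF D(3)] by (simp add: sub_quantifier)
    then have "sub ?K (Ex X \<phi>) \<chi>"
      unfolding \<psi>(1) by (simp add: sub_canon_iff(1)[OF K wcK fms \<psi>_fms])
    moreover have "(M, \<mu>) \<Turnstile> Ex X \<psi>" using D(4) \<psi>(2) by auto
    then have "(M, \<mu>) \<Turnstile> \<chi>"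
      using sub_sat_state[OF K s \<psi>_fms well_canonD(1)[OF wcK \<psi>_fms] well_canonD(2)[OF wcK \<psi>_fms]]
      by (simp only: \<psi>(1))
    ultimately show ?thesis using canon_in_cfms[OF \<psi>_fms] by (simp add: \<psi>(1))
  qed
  show "\<exists>w\<in>?W. sub ?K w \<chi>" if \<chi>: "\<chi> \<in> fms ?K" "sub ?K (Ex X \<phi>) \<chi>" "(M, \<mu>) \<Turnstile> \<chi>" for \<chi>
  proof -
    from \<chi>(1,2) obtain \<psi> \<pi> where \<psi>: "\<chi> = Ex X \<psi>" "\<psi> \<in> fms L" "\<pi> permutes X" "sub L \<phi> (subst \<pi> \<psi>)"
      by (auto simp: sub_quantifier bsub_def)
    \<comment> \<open>Subsumption compares \<open>\<phi>\<close> with the permuted body, so the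
      witnessing assignment is chosen for that body.\<close>
    have "(M, \<mu>) \<Turnstile> Ex X (subst \<pi> \<psi>)" using \<chi>(3) sat_quantifier_subst(1)[OF K \<psi>(3,2), of M \<mu>] by (simp only: \<psi>(1))
    then obtain \<nu> where \<nu>: "\<nu> \<in> assigns X (univ M)" "(M, \<mu> ++ \<nu>) \<Turnstile> subst \<pi> \<psi>" by auto
    obtain w where w: "w \<in> weaken L \<phi> (M, \<mu> ++ \<nu>)" "sub L w (subst \<pi> \<psi>)"
      using weaken_below[OF L states_map_add[OF s \<nu>(1)] \<phi> subst_permutes_in_fms[OF K \<psi>(3,2)] \<psi>(4) \<nu>(2)]
      by blast
    have "w \<in> fms L" using weakenD(2)[OF L states_map_add[OF s \<nu>(1)] \<phi> w(1)] .
    then have "Ex X w \<in> fms ?K" by simp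
    moreover have "sub ?K (Ex X w) \<chi>" using w(2) \<psi>(3) by (auto simp: \<psi>(1) sub_quantifier bsub_def)
    ultimately have "sub ?K (canon ?K (Ex X w)) \<chi>"
      using sub_canon_iff(2)[OF K wcK \<chi>(1)] by simp
    then show ?thesis using \<nu>(1) w(1) by blast
  qed
qed

text \<open>Each weakening subsumes into the next, and subsumption preserves truth; what was
  repaired for an earlier state stays true through all later steps.\<close>

lemma weaken_seqD:
  assumes L: "bounded_lang S V L"
  shows "set ss \<subseteq> states S \<Longrightarrow> \<phi> \<in> fms L \<Longrightarrow> \<chi> \<in> weaken_seq L \<phi> ss \<Longrightarrow>
    \<chi> \<in> fms L \<and> sub L \<phi> \<chi> \<and> (\<forall>s\<in>set ss. s \<Turnstile> \<chi>)"
proof (induction ss arbitrary: \<phi>)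
  case Nil
  then show ?case by (simp add: sub_refl)
next
  case (Cons s ss)
  then obtain \<psi> where \<psi>: "\<psi> \<in> weaken L \<phi> s" "\<chi> \<in> weaken_seq L \<psi> ss" by auto
  have s: "s \<in> states S" using Cons.prems(1) by simp
  note D = weakenD[OF L s Cons.prems(2) \<psi>(1)]
  have *: "\<chi> \<in> fms L \<and> sub L \<psi> \<chi> \<and> (\<forall>s\<in>set ss. s \<Turnstile> \<chi>)"
    using Cons.IH[OF _ D(2) \<psi>(2)] Cons.prems(1) by simp
  then show ?case
    using sub_trans[OF L D(3) _ Cons.prems(2) D(2)] sub_sat_state[OF L s D(2) _ _ D(4)] by auto
qed

text \<open>At every state a weakening can be chosen that stays below the target
  \<open>\<psi>\<close>. The final results need not be minimal: if \<open>p\<close> holds in both of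
  two states and \<open>q\<close> only in the first, the empty disjunction with \<open>k\<close> at
  least 2 can become \<open>[p]\<close>, or \<open>[q]\<close> and then the larger list with
  both.\<close>

lemma weaken_seq_below:
  assumes L: "bounded_lang S V L" and \<psi>: "\<psi> \<in> fms L"
  shows "set ss \<subseteq> states S \<Longrightarrow> \<phi> \<in> fms L \<Longrightarrow> sub L \<phi> \<psi> \<Longrightarrow> \<forall>s\<in>set ss. s \<Turnstile> \<psi> \<Longrightarrow>
    \<exists>\<chi>\<in>weaken_seq L \<phi> ss. sub L \<chi> \<psi>"
proof (induction ss arbitrary: \<phi>)
  case (Cons s ss)
  have s: "s \<in> states S" using Cons.prems(1) by simp
  obtain \<phi>' where \<phi>': "\<phi>' \<in> weaken L \<phi> s" "sub L \<phi>' \<psi>"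
    using weaken_below[OF L s Cons.prems(2) \<psi> Cons.prems(3)] Cons.prems(4) by auto
  have "\<phi>' \<in> fms L" using weakenD(2)[OF L s Cons.prems(2) \<phi>'(1)] .
  with Cons.IH[OF _ this \<phi>'(2)] Cons.prems(1,4) \<phi>'(1) show ?case by auto
qed simp

text \<open>The argument rests on \<open>weaken_seqD\<close> and \<open>weaken_seq_below\<close>,
  whose truth conditions involve only the set of states; hence \<open>ss\<close> may enumerate the
  updated states in any order.\<close>

lemma weaken_LAll:
  assumes K: "bounded_lang S V (LAll X L)" and s: "(M, \<mu>) \<in> states S" and \<phi>: "\<phi> \<in> fms L"
    and ss: "set ss = {(M, \<mu> ++ \<nu>) | \<nu>. \<nu> \<in> assigns X (univ M)}"
  shows "weaken (LAll X L) (All X \<phi>) (M, \<mu>) = minimals (sub (LAll X L))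
    {canon (LAll X L) (All X \<psi>) | \<psi>. \<psi> \<in> weaken_seq L \<phi> ss}"
proof (rule weaken_eqI[OF K s])
  let ?K = "LAll X L"
  let ?W = "{canon ?K (All X \<psi>) | \<psi>. \<psi> \<in> weaken_seq L \<phi> ss}"
  have L: "bounded_lang S V L" and KE: "bounded_lang S V (LEx X L)" using K by auto
  note wcK = well_canon[OF K]
  have ss_states: "set ss \<subseteq> states S" using states_map_add[OF s] by (auto simp: ss)
  have all: "(\<forall>s\<in>set ss. s \<Turnstile> \<psi>) \<longleftrightarrow> (M, \<mu>) \<Turnstile> All X \<psi>" for \<psi> by (auto simp: ss)
  show fms: "All X \<phi> \<in> fms ?K" using \<phi> by simp
  show "\<chi> \<in> cfms ?K \<and> sub ?K (All X \<phi>) \<chi> \<and> (M, \<mu>) \<Turnstile> \<chi>" if \<chi>: "\<chi> \<in> ?W" for \<chi>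
  proof -
    from \<chi> obtain \<psi> where \<psi>: "\<chi> = canon ?K (All X \<psi>)" "\<psi> \<in> weaken_seq L \<phi> ss" by blast
    note D = weaken_seqD[OF L ss_states \<phi> \<psi>(2)]
    have \<psi>_fms: "All X \<psi> \<in> fms ?K" using D by simp
    have "sub ?K (All X \<phi>) (All X \<psi>)" using sub_imp_bsub[of L \<phi> \<psi> X] D by (simp add: sub_quantifier)
    then have "sub ?K (All X \<phi>) \<chi>"
      unfolding \<psi>(1) by (simp add: sub_canon_iff(1)[OF K wcK fms \<psi>_fms])
    moreover have "(M, \<mu>) \<Turnstile> All X \<psi>" using D all by blast
    then have "(M, \<mu>) \<Turnstile> \<chi>"
      using sub_sat_state[OF K s \<psi>_fms well_canonD(1)[OF wcK \<psi>_fms] well_canonD(2)[OF wcK \<psi>_fms]]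
      by (simp only: \<psi>(1))
    ultimately show ?thesis using canon_in_cfms[OF \<psi>_fms] by (simp add: \<psi>(1))
  qed
  show "\<exists>w\<in>?W. sub ?K w \<chi>" if \<chi>: "\<chi> \<in> fms ?K" "sub ?K (All X \<phi>) \<chi>" "(M, \<mu>) \<Turnstile> \<chi>" for \<chi>
  proof -
    from \<chi>(1,2) obtain \<psi> \<pi> where \<psi>: "\<chi> = All X \<psi>" "\<psi> \<in> fms L" "\<pi> permutes X" "sub L \<phi> (subst \<pi> \<psi>)"
      by (auto simp: sub_quantifier bsub_def)
    have "(M, \<mu>) \<Turnstile> All X (subst \<pi> \<psi>)" using \<chi>(3) sat_quantifier_subst(2)[OF KE \<psi>(3,2), of M \<mu>] by (simp only: \<psi>(1))
    then obtain w where w: "w \<in> weaken_seq L \<phi> ss" "sub L w (subst \<pi> \<psi>)"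
      using weaken_seq_below[OF L subst_permutes_in_fms[OF KE \<psi>(3,2)] ss_states \<phi> \<psi>(4)] all by blast
    have "w \<in> fms L" using weaken_seqD[OF L ss_states \<phi> w(1)] by blast
    then have "All X w \<in> fms ?K" by simp
    moreover have "sub ?K (All X w) \<chi>" using w(2) \<psi>(3) by (auto simp: \<psi>(1) sub_quantifier bsub_def)
    ultimately have "sub ?K (canon ?K (All X w)) \<chi>"
      using sub_canon_iff(2)[OF K wcK \<chi>(1)] by simp
    then show ?thesis using w(1) by blast
  qed
qed

lemma minimals_cong:
  assumes "\<And>x y. x \<in> F \<Longrightarrow> y \<in> F \<Longrightarrow> R x y \<longleftrightarrow> Q x y"
  shows "minimals R F = minimals Q F"
  using assms unfolding minimals_def by blast

text \<open>Only existential formulas lie above an existential one, so both languages have the same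
  candidates, compared in the same way.\<close>

lemma weaken_LExAll_Ex:
  assumes K: "bounded_lang S V (LExAll X L)" and s: "s \<in> states S" and \<phi>: "\<phi> \<in> fms L"
  shows "weaken (LExAll X L) (Ex X \<phi>) s = weaken (LEx X L) (Ex X \<phi>) s"
proof -
  have KE: "bounded_lang S V (LEx X L)" using K by simp
  have fms: "Ex X \<phi> \<in> fms (LExAll X L)" "Ex X \<phi> \<in> fms (LEx X L)" using \<phi> by auto
  have "upper (LExAll X L) (Ex X \<phi>) s = upper (LEx X L) (Ex X \<phi>) s"
    by (auto simp: upper_def cfms_quantifier sub_quantifier)
  moreover have "minimals (sub (LExAll X L)) (upper (LEx X L) (Ex X \<phi>) s) =
      minimals (sub (LEx X L)) (upper (LEx X L) (Ex X \<phi>) s)"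
    by (rule minimals_cong) (auto simp: upper_def cfms_quantifier sub_quantifier)
  ultimately show ?thesis
    by (simp only: weaken_eq_minimals[OF K s fms(1)] weaken_eq_minimals[OF KE s fms(2)])
qed

text \<open>The candidates above a universal formula split by quantifier into those above
  \<open>Ex X \<phi>\<close> and those above \<open>All X \<phi>\<close>. The outer
  \<open>minimals\<close> remains since a universal candidate may subsume an existential
  one.\<close>

lemma weaken_LExAll_All:
  assumes K: "bounded_lang S V (LExAll X L)" and s: "s \<in> states S" and \<phi>: "\<phi> \<in> fms L"
  shows "weaken (LExAll X L) (All X \<phi>) s = minimals (sub (LExAll X L))
    (weaken (LEx X L) (Ex X \<phi>) s \<union> weaken (LAll X L) (All X \<phi>) s)"
    (is "_ = minimals _ (?E \<union> ?A)")
proof (rule weaken_eqI[OF K s])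
  let ?K = "LExAll X L"
  have KE: "bounded_lang S V (LEx X L)" and KA: "bounded_lang S V (LAll X L)" using K by auto
  have fms: "Ex X \<phi> \<in> fms (LEx X L)" "All X \<phi> \<in> fms (LAll X L)" using \<phi> by auto
  show "All X \<phi> \<in> fms ?K" using \<phi> by simp
  show "\<chi> \<in> cfms ?K \<and> sub ?K (All X \<phi>) \<chi> \<and> s \<Turnstile> \<chi>" if "\<chi> \<in> ?E \<union> ?A" for \<chi>
    using that
  proof
    assume "\<chi> \<in> ?E"
    from weakenD[OF KE s fms(1) this] show ?thesis by (auto simp: cfms_quantifier sub_quantifier)
  next
    assume "\<chi> \<in> ?A"
    from weakenD[OF KA s fms(2) this] show ?thesis by (auto simp: cfms_quantifier sub_quantifier)
  qed
  show "\<exists>w\<in>?E \<union> ?A. sub ?K w \<chi>" if \<chi>: "\<chi> \<in> fms ?K" "sub ?K (All X \<phi>) \<chi>" "s \<Turnstile> \<chi>" for \<chi>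
  proof -
    from \<chi>(1,2) obtain \<psi> where \<psi>: "\<psi> \<in> fms L" "bsub X L \<phi> \<psi>" "\<chi> = Ex X \<psi> \<or> \<chi> = All X \<psi>"
      by (auto simp: sub_quantifier)
    from \<psi>(3) show ?thesis
    proof
      assume eq: "\<chi> = Ex X \<psi>"
      then obtain w where "w \<in> ?E" "sub (LEx X L) w \<chi>"
        using weaken_below[OF KE s fms(1), of \<chi>] \<psi> \<chi>(3) by (auto simp: sub_quantifier)
      moreover from this(2) have "sub ?K w \<chi>" by (auto simp: sub_quantifier)
      ultimately show ?thesis by blast
    next
      assume eq: "\<chi> = All X \<psi>"
      then obtain w where "w \<in> ?A" "sub (LAll X L) w \<chi>"
        using weaken_below[OF KA s fms(2), of \<chi>] \<psi> \<chi>(3) by (auto simp: sub_quantifier)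
      moreover from this(2) have "sub ?K w \<chi>" by (auto simp: sub_quantifier)
      ultimately show ?thesis by blast
    qed
  qed
qed

text \<open>The clauses are guarded by the shapes of \<open>L\<close> and \<open>\<phi>\<close>. The
  empty case in the conjunction clause is forced because \<open>BigAnd []\<close> is not a formula
  of the language, and quantifying over \<open>ss\<close> makes the universal clause hold for every
  enumeration.\<close>

theorem theorem4:
  fixes S :: "('f, 'p) signature" and V :: "'v set"
    and L :: "('f, 'p, 'v) lang" and \<phi> :: "('f, 'p, 'v) fm"
    and M :: "('u, 'f, 'p) fo_struct" and \<mu> :: "'v \<rightharpoonup> 'u" and s :: "('u, 'f, 'p, 'v) state"
  assumes "bounded_lang S V L"
    and "\<phi> \<in> fms L" and "canonical L \<phi>"
    and "s \<in> states S" and "s = (M, \<mu>)"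
  shows "(s \<Turnstile> \<phi> \<longrightarrow> weaken L \<phi> s = {\<phi>}) \<and>
    (\<not> s \<Turnstile> \<phi> \<longrightarrow>
      (\<forall>A r. L = LBase A r \<longrightarrow>
         weaken L \<phi> s = (if \<phi> = Bot then {\<psi> \<in> A. s \<Turnstile> \<psi>} else {})) \<and>
      (\<forall>L1 L2 \<phi>1 \<phi>2. L = LOr L1 L2 \<and> \<phi> = Or \<phi>1 \<phi>2 \<longrightarrow>
         weaken L \<phi> s = {Or \<psi> \<phi>2 | \<psi>. \<psi> \<in> weaken L1 \<phi>1 s} \<union> {Or \<phi>1 \<psi> | \<psi>. \<psi> \<in> weaken L2 \<phi>2 s}) \<and>
      (\<forall>L1 L2 \<phi>1 \<phi>2. L = LAnd L1 L2 \<and> \<phi> = And \<phi>1 \<phi>2 \<longrightarrow>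
         weaken L \<phi> s = {And \<psi>1 \<psi>2 | \<psi>1 \<psi>2. \<psi>1 \<in> weaken L1 \<phi>1 s \<and> \<psi>2 \<in> weaken L2 \<phi>2 s}) \<and>
      (\<forall>k L' \<phi>s. L = LBigOr k L' \<and> \<phi> = BigOr \<phi>s \<longrightarrow>
         weaken L \<phi> s = minimals (sub L)
           ({BigOr (sort_list (le L') (\<phi>s[i := \<psi>])) | i \<psi>.
               i < length \<phi>s \<and> \<psi> \<in> weaken L' (\<phi>s ! i) s} \<union>
            {BigOr (sort_list (le L') (\<phi>s @ [\<psi>])) | \<psi>.
               \<psi> \<in> weaken L' (bottom L') s \<and> length \<phi>s < k})) \<and>
      (\<forall>L' \<phi>s. L = LBigAnd L' \<and> \<phi> = BigAnd \<phi>s \<longrightarrow>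
         weaken L \<phi> s =
           (let W = \<Union>\<phi>'\<in>set \<phi>s. weaken L' \<phi>' s
            in if W = {} then {} else {BigAnd (sort_set (le L') (minimals (sub L') W))})) \<and>
      (\<forall>X L' \<phi>'. L = LEx X L' \<and> \<phi> = Ex X \<phi>' \<longrightarrow>
         weaken L \<phi> s = minimals (sub L)
           {canon L (Ex X \<psi>) | \<nu> \<psi>. \<nu> \<in> assigns X (univ M) \<and> \<psi> \<in> weaken L' \<phi>' (M, \<mu> ++ \<nu>)}) \<and>
      (\<forall>X L' \<phi>' ss. L = LAll X L' \<and> \<phi> = All X \<phi>' \<and>
           set ss = {(M, \<mu> ++ \<nu>) | \<nu>. \<nu> \<in> assigns X (univ M)} \<longrightarrow>
         weaken L \<phi> s = minimals (sub L) {canon L (All X \<psi>) | \<psi>. \<psi> \<in> weaken_seq L' \<phi>' ss}) \<and>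
      (\<forall>X L' \<phi>'. L = LExAll X L' \<and> \<phi> = Ex X \<phi>' \<longrightarrow>
         weaken L \<phi> s = weaken (LEx X L') (Ex X \<phi>') s) \<and>
      (\<forall>X L' \<phi>'. L = LExAll X L' \<and> \<phi> = All X \<phi>' \<longrightarrow>
         weaken L \<phi> s = minimals (sub L)
           (weaken (LEx X L') (Ex X \<phi>') s \<union> weaken (LAll X L') (All X \<phi>') s)))"
proof (intro conjI impI allI; (elim conjE)?)
  have cfms: "\<phi> \<in> cfms L" using canon_in_cfms[OF assms(2)] assms(3) by (simp add: canonical_def)
  note L = assms(1) and s = assms(4) and fms = assms(2)
  show "weaken L \<phi> s = {\<phi>}" if "s \<Turnstile> \<phi>"
    by (rule weaken_sat[OF L s cfms that])
  assume unsat: "\<not> s \<Turnstile> \<phi>"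
  show "weaken L \<phi> s = (if \<phi> = Bot then {\<psi> \<in> A. s \<Turnstile> \<psi>} else {})" if eq: "L = LBase A r" for A r
    using weaken_LBase[OF L[unfolded eq] s fms[unfolded eq] unsat] by (simp only: eq)
  show "weaken L \<phi> s = {Or \<psi> \<phi>2 | \<psi>. \<psi> \<in> weaken L1 \<phi>1 s} \<union> {Or \<phi>1 \<psi> | \<psi>. \<psi> \<in> weaken L2 \<phi>2 s}"
    if eq: "L = LOr L1 L2" "\<phi> = Or \<phi>1 \<phi>2" for L1 L2 \<phi>1 \<phi>2
  proof -
    have "\<phi>1 \<in> cfms L1" "\<phi>2 \<in> cfms L2" using cfms by (auto simp: eq Or_in_cfms)
    from weaken_LOr[OF L[unfolded eq] s this unsat[unfolded eq]] show ?thesis by (simp only: eq)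
  qed
  show "weaken L \<phi> s = {And \<psi>1 \<psi>2 | \<psi>1 \<psi>2. \<psi>1 \<in> weaken L1 \<phi>1 s \<and> \<psi>2 \<in> weaken L2 \<phi>2 s}"
    if eq: "L = LAnd L1 L2" "\<phi> = And \<phi>1 \<phi>2" for L1 L2 \<phi>1 \<phi>2
    using weaken_LAnd[OF L[unfolded eq] s] fms by (simp add: eq)
  show "weaken L \<phi> s = minimals (sub L)
      ({BigOr (sort_list (le L') (\<phi>s[i := \<psi>])) | i \<psi>.
          i < length \<phi>s \<and> \<psi> \<in> weaken L' (\<phi>s ! i) s} \<union>
       {BigOr (sort_list (le L') (\<phi>s @ [\<psi>])) | \<psi>.
          \<psi> \<in> weaken L' (bottom L') s \<and> length \<phi>s < k})"
    if eq: "L = LBigOr k L'" "\<phi> = BigOr \<phi>s" for k L' \<phi>s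
  proof -
    have "well_canon L'" using L well_canon by (auto simp: eq)
    then have "set \<phi>s \<subseteq> cfms L'" "length \<phi>s \<le> k"
      using cfms by (auto simp: eq elim!: cfms_LBigOrD)
    from weaken_LBigOr[OF L[unfolded eq] s this] show ?thesis by (simp only: eq)
  qed
  show "weaken L \<phi> s =
      (let W = \<Union>\<phi>'\<in>set \<phi>s. weaken L' \<phi>' s
       in if W = {} then {} else {BigAnd (sort_set (le L') (minimals (sub L') W))})"
    if eq: "L = LBigAnd L'" "\<phi> = BigAnd \<phi>s" for L' \<phi>s
    using weaken_LBigAnd[OF L[unfolded eq] s, of \<phi>s] fms by (simp add: eq)
  show "weaken L \<phi> s = minimals (sub L)
      {canon L (Ex X \<psi>) | \<nu> \<psi>. \<nu> \<in> assigns X (univ M) \<and> \<psi> \<in> weaken L' \<phi>' (M, \<mu> ++ \<nu>)}"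
    if eq: "L = LEx X L'" "\<phi> = Ex X \<phi>'" for X L' \<phi>'
    using weaken_LEx[OF L[unfolded eq] s[unfolded assms(5)], of \<phi>'] fms by (simp add: eq assms(5))
  show "weaken L \<phi> s = minimals (sub L) {canon L (All X \<psi>) | \<psi>. \<psi> \<in> weaken_seq L' \<phi>' ss}"
    if eq: "L = LAll X L'" "\<phi> = All X \<phi>'"
      and ss: "set ss = {(M, \<mu> ++ \<nu>) | \<nu>. \<nu> \<in> assigns X (univ M)}" for X L' \<phi>' ss
    using weaken_LAll[OF L[unfolded eq] s[unfolded assms(5)] _ ss, of \<phi>'] fms by (simp add: eq assms(5))
  show "weaken L \<phi> s = weaken (LEx X L') (Ex X \<phi>') s"
    if eq: "L = LExAll X L'" "\<phi> = Ex X \<phi>'" for X L' \<phi>'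
    using weaken_LExAll_Ex[OF L[unfolded eq] s, of \<phi>'] fms by (auto simp add: eq)
  show "weaken L \<phi> s = minimals (sub L)
      (weaken (LEx X L') (Ex X \<phi>') s \<union> weaken (LAll X L') (All X \<phi>') s)"
    if eq: "L = LExAll X L'" "\<phi> = All X \<phi>'" for X L' \<phi>'
    using weaken_LExAll_All[OF L[unfolded eq] s, of \<phi>'] fms by (auto simp add: eq)
qed

end
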